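(* Let $X_0,X_1,\dots$ be a stationary real-valued stochastic process with normalising levels $u_n(\tau)$, let $N_n=\sum_{j=0}^\infty\delta_{(j/n,\,u_n^{-1}(X_j))}$, and let $Z_n(t)=u_n^{-1}(M_{\lfloor nt\rfloor+1})$, $t\ge0$, where $M_n=\max\{X_0,\dots,X_{n-1}\}$. Let $\tilde N$ be a point process on $[0,\infty)^2$ of Mori–Hsing type with parameter $\theta\in(0,1]$. If $N_n$ converges weakly to $\tilde N$, then the process $Z_n$ converges weakly to $Z_H$ in $\mathbb D([0,\infty))$ endowed with Skorokhod's $M_1$ topology, where $Z_H$ is a stochastic process such that $$\mathbb P(Z_H(t_1)\ge y_1,\dots,Z_H(t_k)\ge y_k)=\bar H^{t_1}\Big(\bigvee_{i=1}^ky_i\Big)\,\bar H^{t_2-t_1}\Big(\bigvee_{i=2}^ky_i\Big)\cdots\bar H^{t_k-t_{k-1}}(y_k)$$ for $0\le t_1<t_2<\dots<t_k$ and $y_1,\dots,y_k\ge0$, with $\bar H(\tau)=e^{-\theta\tau}$ and $\bigvee$ denoting the maximum.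
   Context: Levels: for each $n$, $u_n(\tau)$, $\tau>0$, is continuous and strictly decreasing in $\tau$, with inverse $u_n^{-1}$ defined on the range of $X_0$, and for every $\tau>0$, $n\mathbb P(X_0>u_n(\tau))\to\tau$ as $n\to\infty$. The parameter $\theta$ is the extremal index, whose existence is assumed; $\bar H=1-H$, where $H$ is a distribution function. $M_p([0,\infty)^2)$ is the space of Radon point measures on $[0,\infty)^2$ with the vague topology; weak convergence of point processes is convergence in distribution in this space. Mori–Hsing type with parameter $\theta$: $\tilde N=\sum_{i,j=1}^\infty\sum_{\ell=1}^{K_{i,j}}\delta_{(T_{i,j},\,U_{i,j}Y_{i,j,\ell})}$, where $T_{i,j}=\sum_{\ell=1}^j\bar T_{i,\ell}$ with $(\bar T_{i,j})_{i,j\in\mathbb N}$ i.i.d. exponential of rate $\theta$; $(U_{i,j})_{i,j\in\mathbb N}$ are independent with $U_{i,j}$ uniform on $(i-1,i]$; $(Y_{i,j,\ell})_{\ell}$ are the points ($K_{i,j}$ in number) of a point process $\gamma_{i,j}$ on $[1,\infty)$ with $1$ as an atom; all the $\gamma_{i,j}$, $i,j\in\mathbb N$, are identically distributed; and $(\bar T_{i,j})_{i,j}$, $(U_{i,j})_{i,j}$ and $(Y_{i,j,\ell})_{i,j}$ are mutually independent for all $\ell$. $\mathbb D([0,\infty))$ (resp. $\mathbb D([0,T])$) is the space of real functions on $[0,\infty)$ (resp. $[0,T]$) that are right continuous with left-hand limits. $M_1$ topology: for $g\in\mathbb D([0,T])$ let $\Gamma(g)=\{(t,x)\in[0,T]\times\mathbb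 R: x\in[g(t^-)\wedge g(t),\,g(t^-)\vee g(t)]\}$ be its completed graph, and let $\Lambda^*(g)$ be the set of all its parametrizations, that is, all continuous $G=(\lambda,\gamma):[0,T]\to\Gamma(g)$ such that $t'<t$ implies either $\lambda(t')<\lambda(t)$, or $\lambda(t')=\lambda(t)$ and $|\gamma(t)-g(\lambda(t))|<|\gamma(t')-g(\lambda(t))|$. With $\|\cdot\|$ the uniform norm, put $$d_{M_1,T}(g_1,g_2)=\inf\{\|\lambda_1-\lambda_2\|\vee\|\gamma_1-\gamma_2\|:\ (\lambda_i,\gamma_i)\in\Lambda^*(g_i),\ i=1,2\}.$$ On $\mathbb D([0,\infty))$ the $M_1$ topology is defined by the metric $d_{M_1,\infty}(g_1,g_2)=\int_0^\infty e^{-t}(1\wedge d_{M_1,t}(g_1,g_2))\,dt$; convergence $g_n\to g$ means that $d_{M_1,T}(g_n,g)\to0$ for every continuity point $T$ of $g$.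
   Formalization: The formula forces Z_H(0)=+∞ almost surely, so no Z_H in D([0,∞)) of real functions has this law; Z_H may instead take the value +∞ at time 0, and existence of Z_H and M1 convergence of Z_n to Z_H are stated for the paths from time s on, for every s>0. *)

theory Defs
  imports "HOL-Probability.Probability"
begin
definition borel_of :: "'a topology \<Rightarrow> 'a measure" where
  "borel_of T = sigma (topspace T) {U. openin T U}"

text \<open>The random elements \<open>X n\<close> live on \<open>P\<close> and the limit \<open>Y\<close> on a possibly different
  probability space \<open>Q\<close>. Being random elements (Borel measurable) is part of the notion.\<close>

definition converges_weakly ::
    "'s topology \<Rightarrow> 'a measure \<Rightarrow> (nat \<Rightarrow> 'a \<Rightarrow> 's) \<Rightarrow> 'b measure \<Rightarrow> ('b \<Rightarrow> 's) \<Rightarrow> bool" where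
  "converges_weakly T P X Q Y \<longleftrightarrow>
     (\<forall>n. X n \<in> P \<rightarrow>\<^sub>M borel_of T) \<and> Y \<in> Q \<rightarrow>\<^sub>M borel_of T \<and>
     (\<forall>F :: 's \<Rightarrow> real. continuous_map T euclideanreal F \<and> bounded (F ` topspace T) \<longrightarrow>
        (\<lambda>n. \<integral>\<omega>. F (X n \<omega>) \<partial>P) \<longlonglongrightarrow> (\<integral>\<omega>. F (Y \<omega>) \<partial>Q))"

text \<open>The point measure \<open>\<Sum>j\<in>J. \<delta>\<^bsub>x j\<^esub>\<close> on \<open>E\<close>, as the image of the counting measure on \<open>J\<close>:
  it assigns to \<open>A\<close> the number of \<open>j \<in> J\<close> with \<open>x j \<in> A\<close>, and points outside \<open>E\<close>
  do not contribute.\<close>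

definition point_measure ::
    "'s::topological_space set \<Rightarrow> 'j set \<Rightarrow> ('j \<Rightarrow> 's) \<Rightarrow> 's measure" where
  "point_measure E J x = distr (count_space J) (restrict_space borel E) x"

definition radon_point_measures :: "'s::topological_space set \<Rightarrow> 's measure set" where
  "radon_point_measures E =
     {point_measure E J x | (J :: nat set) x.
        x ` J \<subseteq> E \<and> (\<forall>C. compact C \<and> C \<subseteq> E \<longrightarrow> finite {j \<in> J. x j \<in> C})}"

definition compactly_supported :: "'s::topological_space set \<Rightarrow> ('s \<Rightarrow> real) set" where
  "compactly_supported E =
     {f. continuous_on E f \<and> (\<forall>x\<in>E. 0 \<le> f x) \<and>
         (\<exists>C. compact C \<and> C \<subseteq> E \<and> (\<forall>x\<in>E - C. f x = 0))}"

definition vague_topology :: "'s::topological_space set \<Rightarrow> 's measure topology" where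
  "vague_topology E = topology_generated_by
     {{m \<in> radon_point_measures E. (\<integral>x. f x \<partial>m) \<in> V} | f V.
        f \<in> compactly_supported E \<and> open V}"

abbreviation quadrant :: "(real \<times> real) set" where
  "quadrant \<equiv> {0..} \<times> {0..}"

text \<open>Functions on \<open>[0,\<infinity>)\<close> are represented by their extensional extensions to the reals.\<close>

definition cadlag :: "(real \<Rightarrow> real) set" where
  "cadlag = {g \<in> extensional {0..}.
     (\<forall>t\<ge>0. (g \<longlongrightarrow> g t) (at_right t)) \<and> (\<forall>t>0. \<exists>l. (g \<longlongrightarrow> l) (at_left t))}"

text \<open>The usual convention \<open>g(0-) = g(0)\<close> is used at the left end point.\<close>

definition left_lim :: "(real \<Rightarrow> real) \<Rightarrow> real \<Rightarrow> real" where
  "left_lim g t = (if t = 0 then g 0 else Lim (at_left t) g)"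

definition completed_graph :: "real \<Rightarrow> (real \<Rightarrow> real) \<Rightarrow> (real \<times> real) set" where
  "completed_graph T g =
     {(t, x). t \<in> {0..T} \<and> x \<in> {min (left_lim g t) (g t)..max (left_lim g t) (g t)}}"

text \<open>A parametrization of the completed graph traverses all of it; without surjectivity the
  infimum below would not be a metric.\<close>

definition parametrizations ::
    "real \<Rightarrow> (real \<Rightarrow> real) \<Rightarrow> ((real \<Rightarrow> real) \<times> (real \<Rightarrow> real)) set" where
  "parametrizations T g =
     {(l, c). continuous_on {0..T} l \<and> continuous_on {0..T} c \<and>
        (\<lambda>t. (l t, c t)) ` {0..T} = completed_graph T g \<and>
        (\<forall>t'\<in>{0..T}. \<forall>t\<in>{0..T}. t' < t \<longrightarrow>
           l t' < l t \<or> (l t' = l t \<and> \<bar>c t - g (l t)\<bar> < \<bar>c t' - g (l t)\<bar>))}"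

definition unif_dist :: "real \<Rightarrow> (real \<Rightarrow> real) \<Rightarrow> (real \<Rightarrow> real) \<Rightarrow> real" where
  "unif_dist T f g = (SUP t\<in>{0..T}. \<bar>f t - g t\<bar>)"

definition M1_dist_upto :: "real \<Rightarrow> (real \<Rightarrow> real) \<Rightarrow> (real \<Rightarrow> real) \<Rightarrow> real" where
  "M1_dist_upto T g1 g2 =
     Inf {max (unif_dist T l1 l2) (unif_dist T c1 c2) | l1 c1 l2 c2.
            (l1, c1) \<in> parametrizations T g1 \<and> (l2, c2) \<in> parametrizations T g2}"

definition M1_dist :: "(real \<Rightarrow> real) \<Rightarrow> (real \<Rightarrow> real) \<Rightarrow> real" where
  "M1_dist g1 g2 = (LINT t:{0..}|lborel. exp (- t) * min 1 (M1_dist_upto t g1 g2))"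

definition M1_open :: "(real \<Rightarrow> real) set \<Rightarrow> bool" where
  "M1_open U \<longleftrightarrow> U \<subseteq> cadlag \<and> (\<forall>g\<in>U. \<exists>r>0. \<forall>h\<in>cadlag. M1_dist g h < r \<longrightarrow> h \<in> U)"

definition M1_topology :: "(real \<Rightarrow> real) topology" where
  "M1_topology = topology M1_open"

lemma istopology_M1_open: "istopology M1_open"
  unfolding istopology_def
proof (intro conjI allI impI)
  fix S T assume S: "M1_open S" and T: "M1_open T"
  show "M1_open (S \<inter> T)"
    unfolding M1_open_def
  proof (intro conjI ballI)
    show "S \<inter> T \<subseteq> cadlag" using S by (auto simp: M1_open_def)
    fix g assume "g \<in> S \<inter> T"
    with S T obtain r r' where "r > 0" "\<forall>h\<in>cadlag. M1_dist g h < r \<longrightarrow> h \<in> S"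
      "r' > 0" "\<forall>h\<in>cadlag. M1_dist g h < r' \<longrightarrow> h \<in> T"
      unfolding M1_open_def by blast
    then show "\<exists>r>0. \<forall>h\<in>cadlag. M1_dist g h < r \<longrightarrow> h \<in> S \<inter> T"
      by (intro exI[of _ "min r r'"]) auto
  qed
next
  fix \<K> assume "\<forall>K\<in>\<K>. M1_open K"
  then show "M1_open (\<Union>\<K>)"
    unfolding M1_open_def by (meson Sup_le_iff UnionE UnionI)
qed

lemma openin_M1_topology: "openin M1_topology U \<longleftrightarrow> M1_open U"
  unfolding M1_topology_def by (simp add: topology_inverse' istopology_M1_open)

lemma topspace_M1_topology: "topspace M1_topology = cadlag"
proof -
  have "M1_open cadlag" by (auto simp: M1_open_def intro: exI[of _ 1])
  then show ?thesis
    unfolding topspace_def openin_M1_topology by (auto simp: M1_open_def)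
qed

definition stationary_process :: "'a measure \<Rightarrow> (nat \<Rightarrow> 'a \<Rightarrow> real) \<Rightarrow> bool" where
  "stationary_process P X \<longleftrightarrow>
     (\<forall>j. X j \<in> borel_measurable P) \<and>
     (\<forall>m. distr P (Pi\<^sub>M UNIV (\<lambda>_. borel)) (\<lambda>\<omega> j. X (j + m) \<omega>) =
          distr P (Pi\<^sub>M UNIV (\<lambda>_. borel)) (\<lambda>\<omega> j. X j \<omega>))"

definition normalising_levels ::
    "'a measure \<Rightarrow> (nat \<Rightarrow> 'a \<Rightarrow> real) \<Rightarrow> (nat \<Rightarrow> real \<Rightarrow> real) \<Rightarrow> bool" where
  "normalising_levels P X u \<longleftrightarrow>
     (\<forall>n\<ge>1. continuous_on {0<..} (u n) \<and>
        (\<forall>\<sigma>>0. \<forall>\<tau>>0. \<sigma> < \<tau> \<longrightarrow> u n \<tau> < u n \<sigma>) \<and>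
        X 0 ` space P \<subseteq> u n ` {0<..}) \<and>
     (\<forall>\<tau>>0. (\<lambda>n. real n * measure P {\<omega> \<in> space P. X 0 \<omega> > u n \<tau>}) \<longlonglongrightarrow> \<tau>)"

definition level_inv :: "(nat \<Rightarrow> real \<Rightarrow> real) \<Rightarrow> nat \<Rightarrow> real \<Rightarrow> real" where
  "level_inv u n = the_inv_into {0<..} (u n)"

text \<open>\<open>partial_max X n\<close> is the maximum of the first \<open>n\<close> variables and only meaningful
  for \<open>n \<ge> 1\<close>.\<close>

definition partial_max :: "(nat \<Rightarrow> 'a \<Rightarrow> real) \<Rightarrow> nat \<Rightarrow> 'a \<Rightarrow> real" where
  "partial_max X n \<omega> = Max ((\<lambda>j. X j \<omega>) ` {..<n})"

definition extremal_index ::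
    "'a measure \<Rightarrow> (nat \<Rightarrow> 'a \<Rightarrow> real) \<Rightarrow> (nat \<Rightarrow> real \<Rightarrow> real) \<Rightarrow> real \<Rightarrow> bool" where
  "extremal_index P X u \<theta> \<longleftrightarrow>
     (\<forall>\<tau>>0. (\<lambda>n. measure P {\<omega> \<in> space P. partial_max X n \<omega> \<le> u n \<tau>})
        \<longlonglongrightarrow> exp (- \<theta> * \<tau>))"

definition empirical_process ::
    "(nat \<Rightarrow> 'a \<Rightarrow> real) \<Rightarrow> (nat \<Rightarrow> real \<Rightarrow> real) \<Rightarrow> nat \<Rightarrow> 'a \<Rightarrow> (real \<times> real) measure" where
  "empirical_process X u n \<omega> =
     point_measure quadrant UNIV (\<lambda>j. (real j / real n, level_inv u n (X j \<omega>)))"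

definition max_process ::
    "(nat \<Rightarrow> 'a \<Rightarrow> real) \<Rightarrow> (nat \<Rightarrow> real \<Rightarrow> real) \<Rightarrow> nat \<Rightarrow> real \<Rightarrow> 'a \<Rightarrow> real" where
  "max_process X u n t \<omega> = level_inv u n (partial_max X (nat \<lfloor>real n * t\<rfloor> + 1) \<omega>)"

abbreviation pos_pairs :: "(nat \<times> nat) set" where
  "pos_pairs \<equiv> {1..} \<times> {1..}"

text \<open>In the independence requirement, the value \<open>0\<close> (which is not in \<open>[1,\<infinity>)\<close>) stands for a
  nonexistent point, that is, for an index beyond the number \<open>K i j\<close> of points. The three arrays
  are required to be mutually independent for each \<open>k\<close> separately; no independence
  among the processes \<open>\<gamma> i j\<close> is required.\<close>

definition mori_hsing_type :: "'b measure \<Rightarrow> real \<Rightarrow> ('b \<Rightarrow> (real \<times> real) measure) \<Rightarrow> bool" where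
  "mori_hsing_type R \<theta> N \<longleftrightarrow>
     N \<in> R \<rightarrow>\<^sub>M borel_of (vague_topology quadrant) \<and>
     (\<exists>(S :: nat \<Rightarrow> nat \<Rightarrow> 'b \<Rightarrow> real) (U :: nat \<Rightarrow> nat \<Rightarrow> 'b \<Rightarrow> real)
        (K :: nat \<Rightarrow> nat \<Rightarrow> 'b \<Rightarrow> enat) (Y :: nat \<Rightarrow> nat \<Rightarrow> nat \<Rightarrow> 'b \<Rightarrow> real).
       let T = (\<lambda>i j \<omega>. \<Sum>m=1..j. S i m \<omega>);
           \<gamma> = (\<lambda>i j \<omega>. point_measure {1..} {k. 1 \<le> k \<and> enat k \<le> K i j \<omega>} (\<lambda>k. Y i j k \<omega>));
           \<gamma>_space = borel_of (vague_topology {1::real..})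
       in
       prob_space.indep_vars R (\<lambda>_. borel) (\<lambda>(i, j). S i j) pos_pairs \<and>
       (\<forall>i\<ge>1. \<forall>j\<ge>1. distributed R lborel (S i j) (exponential_density \<theta>)) \<and>
       prob_space.indep_vars R (\<lambda>_. borel) (\<lambda>(i, j). U i j) pos_pairs \<and>
       (\<forall>i\<ge>1. \<forall>j\<ge>1. distr R lborel (U i j) = uniform_measure lborel {real i - 1<..real i}) \<and>
       (\<forall>i\<ge>1. \<forall>j\<ge>1. \<forall>k\<ge>1. \<forall>\<omega>\<in>space R. enat k \<le> K i j \<omega> \<longrightarrow> 1 \<le> Y i j k \<omega>) \<and>
       (\<forall>i\<ge>1. \<forall>j\<ge>1. \<gamma> i j \<in> R \<rightarrow>\<^sub>M \<gamma>_space \<and> distr R \<gamma>_space (\<gamma> i j) = distr R \<gamma>_space (\<gamma> 1 1) \<and>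
          (AE \<omega> in R. 1 \<le> emeasure (\<gamma> i j \<omega>) {1})) \<and>
       (\<forall>k\<ge>1. prob_space.indep_vars R (\<lambda>_. Pi\<^sub>M pos_pairs (\<lambda>_. borel))
          (\<lambda>a \<omega>. \<lambda>(i, j)\<in>pos_pairs.
             [S i j \<omega>, U i j \<omega>, if enat k \<le> K i j \<omega> then Y i j k \<omega> else 0] ! a)
          {..<3 :: nat}) \<and>
       (AE \<omega> in R. N \<omega> =
          point_measure quadrant
            {(i, j, k). 1 \<le> i \<and> 1 \<le> j \<and> 1 \<le> k \<and> enat k \<le> K i j \<omega>}
            (\<lambda>(i, j, k). (T i j \<omega>, U i j \<omega> * Y i j k \<omega>))))"

text \<open>For \<open>t 1 = 0\<close> the formula forces \<open>Z 0\<close> to exceed every real number almost surely when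
  \<open>Hb\<close> is positive, so \<open>Z\<close> has to be allowed the value \<open>\<infinity>\<close>.\<close>

definition extremal_process ::
    "'c measure \<Rightarrow> (real \<Rightarrow> real) \<Rightarrow> (real \<Rightarrow> 'c \<Rightarrow> ereal) \<Rightarrow> bool" where
  "extremal_process Q Hb Z \<longleftrightarrow>
     (\<forall>t\<ge>0. Z t \<in> borel_measurable Q) \<and>
     (\<forall>k\<ge>1. \<forall>(t :: nat \<Rightarrow> real) (y :: nat \<Rightarrow> real).
        0 \<le> t 1 \<and> (\<forall>i\<in>{1..<k}. t i < t (i + 1)) \<and> (\<forall>i\<in>{1..k}. 0 \<le> y i) \<longrightarrow>
        measure Q {\<omega> \<in> space Q. \<forall>i\<in>{1..k}. ereal (y i) \<le> Z (t i) \<omega>} =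
          Hb (Max (y ` {1..k})) powr t 1 *
          (\<Prod>i=2..k. Hb (Max (y ` {i..k})) powr (t i - t (i - 1))))"

definition path_from :: "real \<Rightarrow> (real \<Rightarrow> 'c \<Rightarrow> real) \<Rightarrow> 'c \<Rightarrow> real \<Rightarrow> real" where
  "path_from s Z \<omega> = (\<lambda>t\<in>{0..}. Z (s + t) \<omega>)"

text \<open>From time \<open>s\<close> on, \<open>Z\<close> is real-valued and a random element of the space \<open>cadlag\<close>
  with the M1 topology. When \<open>Z\<close> is an extremal process with positive \<open>Hb\<close>, this
  can only hold for \<open>s > 0\<close>, since \<open>Z\<close> is then infinite at time \<open>0\<close>; this is why convergence
  is stated for the paths from time \<open>s\<close> on, the case \<open>s = 0\<close> being the one for whole paths.\<close>

definition cadlag_from :: "'c measure \<Rightarrow> real \<Rightarrow> (real \<Rightarrow> 'c \<Rightarrow> ereal) \<Rightarrow> bool" where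
  "cadlag_from Q s Z \<longleftrightarrow>
     (\<forall>t\<ge>s. \<forall>\<omega>\<in>space Q. \<bar>Z t \<omega>\<bar> \<noteq> \<infinity>) \<and>
     path_from s (\<lambda>t \<omega>. real_of_ereal (Z t \<omega>)) \<in> Q \<rightarrow>\<^sub>M borel_of M1_topology"

end

(*
Points in the down-set of a staircase B are seen by the running minima only through whether
there are any: min(y-coordinates up to time t_i) >= y_i for all i iff N(B) = 0. For the
Mori-Hsing limit N the clusters on [1,oo) with an atom at 1 do not matter for N(B) = 0, so this
event concerns the marked renewal rows (T_ij, U_ij) only; its probability is found from the
martingale 1{first m points avoid B} E(T_m), where E(r) is the conjectured probability of
avoiding B after time r. Continuity of void probabilities in B gives convergence of the
finite-dimensional survival functions.

Decreasing paths have a canonical parametrization of the completed graph by s = t - x, with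
1-Lipschitz inverse, so that convergence on the dyadic times implies M1 convergence. Hence M1
continuous functionals of decreasing paths are approximated from below by functionals of
finitely many coordinates, and finite-dimensional convergence suffices: no tightness argument
is needed.
*)
theory Submission
  imports Defs
begin

section \<open>Canonical parametrizations of decreasing paths\<close>

text \<open>Two obstacles shape the proof. The limit is infinite at time 0, so everything concerns
  paths started at a time s, and s = 0 turns out to be contradictory. The paths of the maxima
  decrease only almost surely, since only \<open>X 0\<close> is known to stay in the range of the
  levels; their Borel measurability is therefore proved for arbitrary step sequences, apart from the
  convergence. The clock t - x works because t and -x both increase along the graph of a decreasing
  path, so vertical pieces take up time as well. The guess E has to solve E' = \<theta> p E, where p
  r is the chance that a mark arriving at time r hits B; this equation makes - exp (- \<theta> x) E
  (r + x) an antiderivative for one exponential waiting time, which verifies the guess. Row i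
  carries marks in the band (i - 1, i]; the lengths that B cuts from the bands add up to its height,
  which puts the area of B into the exponent. Approximation from below gives only lower bounds for
  limits of expectations; C + F and C - F, with C a bound of F, supply both directions.\<close>

definition decr_paths :: "(real \<Rightarrow> real) set" where
  "decr_paths = {g \<in> cadlag. \<forall>x y. 0 \<le> x \<longrightarrow> x \<le> y \<longrightarrow> g y \<le> g x}"

lemma decr_pathsD: "g \<in> decr_paths \<Longrightarrow> 0 \<le> x \<Longrightarrow> x \<le> y \<Longrightarrow> g y \<le> g x"
  by (auto simp: decr_paths_def)

lemma cadlag_right: "g \<in> cadlag \<Longrightarrow> 0 \<le> t \<Longrightarrow> (g \<longlongrightarrow> g t) (at_right t)"
  by (auto simp: cadlag_def)

lemma left_lim_zero [simp]: "left_lim g 0 = g 0"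
  by (simp add: left_lim_def)

lemma left_lim_eq: "0 < t \<Longrightarrow> (g \<longlongrightarrow> l) (at_left t) \<Longrightarrow> left_lim g t = l"
  by (simp add: left_lim_def tendsto_Lim)

lemma tendsto_left_lim:
  assumes "g \<in> cadlag" "0 < t"
  shows "(g \<longlongrightarrow> left_lim g t) (at_left t)"
proof -
  obtain l where "(g \<longlongrightarrow> l) (at_left t)" using assms by (auto simp: cadlag_def)
  with left_lim_eq[OF assms(2) this] show ?thesis by simp
qed

lemma decr_left_lim_le:
  assumes g: "g \<in> decr_paths" and r: "0 \<le> r" "r < t"
  shows "left_lim g t \<le> g r"
proof (rule tendsto_upperbound)
  show "(g \<longlongrightarrow> left_lim g t) (at_left t)"
    using g r by (intro tendsto_left_lim) (auto simp: decr_paths_def)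
  show "\<forall>\<^sub>F x in at_left t. g x \<le> g r"
    using r eventually_at_left[of r t] by (auto intro!: exI[of _ r] decr_pathsD[OF g])
qed (use r in simp)

lemma decr_le_left_lim:
  assumes g: "g \<in> decr_paths" and t: "0 < t" and x: "\<And>r. 0 \<le> r \<Longrightarrow> r < t \<Longrightarrow> x \<le> g r"
  shows "x \<le> left_lim g t"
proof (rule tendsto_lowerbound)
  show "(g \<longlongrightarrow> left_lim g t) (at_left t)"
    using g t by (intro tendsto_left_lim) (auto simp: decr_paths_def)
  show "\<forall>\<^sub>F r in at_left t. x \<le> g r"
    using t eventually_at_left[of 0 t] by (auto intro!: exI[of _ 0] x)
qed (use t in simp)

lemma decr_le_left_lim_self:
  assumes "g \<in> decr_paths" "0 \<le> t"
  shows "g t \<le> left_lim g t"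
  using assms by (cases "t = 0") (auto intro!: decr_le_left_lim decr_pathsD[of g])

text \<open>The generalised inverse of the strictly increasing function t - g t. It is constant
  while \<sigma> runs through a jump of g; there the space coordinate
  \<open>arc_time T g \<sigma> - \<sigma>\<close> moves along the vertical segment.\<close>

definition arc_time :: "real \<Rightarrow> (real \<Rightarrow> real) \<Rightarrow> real \<Rightarrow> real" where
  "arc_time T g \<sigma> = Inf {t \<in> {0..T}. \<sigma> \<le> t - g t}"

text \<open>Right continuity of t - g t makes the infimum a minimum; the last two claims are the two
  forms of its minimality.\<close>

lemma arc_time_props:
  assumes g: "g \<in> decr_paths" and T: "0 \<le> T" and \<sigma>: "\<sigma> \<le> T - g T"
  shows "0 \<le> arc_time T g \<sigma>" "arc_time T g \<sigma> \<le> T"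
    "\<sigma> \<le> arc_time T g \<sigma> - g (arc_time T g \<sigma>)"
    "\<And>r. 0 \<le> r \<Longrightarrow> r < arc_time T g \<sigma> \<Longrightarrow> r - g r < \<sigma>"
    "\<And>r. 0 \<le> r \<Longrightarrow> r \<le> T \<Longrightarrow> \<sigma> \<le> r - g r \<Longrightarrow> arc_time T g \<sigma> \<le> r"
proof -
  let ?A = "{t \<in> {0..T}. \<sigma> \<le> t - g t}" and ?L = "arc_time T g \<sigma>"
  have TA: "T \<in> ?A" using T \<sigma> by auto
  have bdd: "bdd_below ?A" by (auto intro!: bdd_belowI[of _ 0])
  show lower: "?L \<le> r" if "0 \<le> r" "r \<le> T" "\<sigma> \<le> r - g r" for r
    unfolding arc_time_def using that bdd by (intro cInf_lower) auto
  show L0: "0 \<le> ?L" unfolding arc_time_def using TA by (intro cInf_greatest) auto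
  show LT: "?L \<le> T" using T \<sigma> by (intro lower) auto
  show "r - g r < \<sigma>" if "0 \<le> r" "r < ?L" for r
    using lower[of r] that LT by force
  show "\<sigma> \<le> ?L - g ?L"
  proof (rule ccontr)
    assume "\<not> ?thesis"
    then have less: "?L - g ?L < \<sigma>" by simp
    have "((\<lambda>r. r - g r) \<longlongrightarrow> ?L - g ?L) (at_right ?L)"
      using g L0 by (intro tendsto_intros cadlag_right) (auto simp: decr_paths_def)
    then have "\<forall>\<^sub>F r in at_right ?L. r - g r < \<sigma>"
      using less by (rule order_tendstoD)
    then obtain b where b: "b > ?L" "\<And>r. r > ?L \<Longrightarrow> r < b \<Longrightarrow> r - g r < \<sigma>"
      unfolding eventually_at_right_field by auto
    have "Inf ?A < b" using b(1) by (simp add: arc_time_def)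
    then obtain r where r: "r \<in> ?A" "r < b" using TA bdd cInf_lessD[of ?A b] by blast
    then have "?L \<le> r" using lower by auto
    with r b(2)[of r] less show False by (cases "r = ?L") auto
  qed
qed

lemma arc_time_mono:
  assumes g: "g \<in> decr_paths" and T: "0 \<le> T" and "\<sigma> \<le> \<sigma>'" "\<sigma>' \<le> T - g T"
  shows "arc_time T g \<sigma> \<le> arc_time T g \<sigma>'"
  using arc_time_props[OF g T, of \<sigma>] arc_time_props[OF g T, of \<sigma>'] assms(3,4)
  by (meson order_trans)

text \<open>Before the hitting time r - \<sigma> stays below g r; let r increase to it. At time 0
  nothing lies to the left, and the convention g(0-) = g 0 together with - g 0 \<le> \<sigma> takes
  the place of the limit.\<close>

lemma arc_time_le_left_lim:
  assumes g: "g \<in> decr_paths" and T: "0 \<le> T" and \<sigma>: "- g 0 \<le> \<sigma>" "\<sigma> \<le> T - g T"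
  shows "arc_time T g \<sigma> - \<sigma> \<le> left_lim g (arc_time T g \<sigma>)"
proof (cases "arc_time T g \<sigma> = 0")
  case False
  note L = arc_time_props[OF g T \<sigma>(2)]
  let ?L = "arc_time T g \<sigma>"
  have pos: "0 < ?L" using False L(1) by simp
  show ?thesis
  proof (rule tendsto_le[OF _ tendsto_left_lim])
    show "((\<lambda>r. r - \<sigma>) \<longlongrightarrow> ?L - \<sigma>) (at_left ?L)" by (intro tendsto_intros)
    have "r - \<sigma> \<le> g r" if "0 < r" "r < ?L" for r
      using L(4)[of r] that by linarith
    then show "\<forall>\<^sub>F r in at_left ?L. r - \<sigma> \<le> g r"
      unfolding eventually_at_left_field using pos by blast
  qed (use g pos in \<open>auto simp: decr_paths_def\<close>)
qed (use \<sigma> in simp)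

lemma arc_time_in_graph:
  assumes g: "g \<in> decr_paths" and T: "0 \<le> T" and \<sigma>: "- g 0 \<le> \<sigma>" "\<sigma> \<le> T - g T"
  shows "(arc_time T g \<sigma>, arc_time T g \<sigma> - \<sigma>) \<in> completed_graph T g"
  using arc_time_props[OF g T \<sigma>(2)] arc_time_le_left_lim[OF assms]
  by (auto simp: completed_graph_def min_def max_def)

text \<open>A graph point is determined by t - x: a hitting time r < t of the level t - x would give
  g r < x \<le> left_lim g t \<le> g r.\<close>

lemma arc_time_graph:
  assumes g: "g \<in> decr_paths" and T: "0 \<le> T" and tx: "(t, x) \<in> completed_graph T g"
  shows "- g 0 \<le> t - x" "t - x \<le> T - g T" "arc_time T g (t - x) = t"
proof -
  have t: "0 \<le> t" "t \<le> T" and x: "g t \<le> x" "x \<le> left_lim g t"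
    using tx decr_le_left_lim_self[OF g, of t] by (auto simp: completed_graph_def)
  show "- g 0 \<le> t - x"
    using x t decr_left_lim_le[OF g, of 0 t] by (cases "t = 0") auto
  show le: "t - x \<le> T - g T" using decr_pathsD[OF g t] t x by simp
  note L = arc_time_props[OF g T le]
  have "arc_time T g (t - x) \<le> t" using t x by (intro L(5)) auto
  moreover have "\<not> arc_time T g (t - x) < t"
  proof
    let ?r = "arc_time T g (t - x)"
    assume "?r < t"
    with L(3) x(2) decr_left_lim_le[OF g L(1)] show False by force
  qed
  ultimately show "arc_time T g (t - x) = t" by simp
qed

text \<open>Equivalently, the space coordinate does not increase with \<sigma>: the later point lies
  below the left limit there, which lies below g at the earlier time.\<close>

lemma arc_time_lipschitz:
  assumes g: "g \<in> decr_paths" and T: "0 \<le> T"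
    and \<sigma>: "- g 0 \<le> \<sigma>" "\<sigma> \<le> \<sigma>'" "\<sigma>' \<le> T - g T"
  shows "arc_time T g \<sigma>' - arc_time T g \<sigma> \<le> \<sigma>' - \<sigma>"
proof (cases "arc_time T g \<sigma> < arc_time T g \<sigma>'")
  case True
  have "arc_time T g \<sigma>' - \<sigma>' \<le> left_lim g (arc_time T g \<sigma>')"
    using \<sigma> by (intro arc_time_le_left_lim g T) auto
  also have "\<dots> \<le> g (arc_time T g \<sigma>)"
    using \<sigma> by (intro decr_left_lim_le g True arc_time_props T) auto
  also have "\<dots> \<le> arc_time T g \<sigma> - \<sigma>"
    using arc_time_props(3)[OF g T, of \<sigma>] \<sigma> by simp
  finally show ?thesis by simp
qed (use \<sigma> in simp)

text \<open>The affine map of [0, T] onto the range [- g 0, T - g T] of t - x on the graph, because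
  parametrizations must live on [0, T].\<close>

definition arc_scale :: "real \<Rightarrow> (real \<Rightarrow> real) \<Rightarrow> real \<Rightarrow> real" where
  "arc_scale T g \<tau> = - g 0 + \<tau> / T * (T - g T + g 0)"

lemma arc_scale_bounds:
  assumes g: "g \<in> decr_paths" and T: "0 < T" and \<tau>: "0 \<le> \<tau>" "\<tau> \<le> T"
  shows "- g 0 \<le> arc_scale T g \<tau>" "arc_scale T g \<tau> \<le> T - g T"
proof -
  have nn: "0 \<le> T - g T + g 0" using decr_pathsD[OF g, of 0 T] T by simp
  show "- g 0 \<le> arc_scale T g \<tau>" using nn T \<tau> by (simp add: arc_scale_def)
  have "\<tau> / T * (T - g T + g 0) \<le> 1 * (T - g T + g 0)"
    using nn T \<tau> by (intro mult_right_mono) auto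
  then show "arc_scale T g \<tau> \<le> T - g T" by (simp add: arc_scale_def)
qed

lemma arc_scale_strict_mono:
  assumes g: "g \<in> decr_paths" and T: "0 < T" and "\<tau> < \<tau>'"
  shows "arc_scale T g \<tau> < arc_scale T g \<tau>'"
proof -
  have "0 < T - g T + g 0" using decr_pathsD[OF g, of 0 T] T by simp
  with T assms(3) show ?thesis by (simp add: arc_scale_def divide_strict_right_mono)
qed

definition arc_l :: "real \<Rightarrow> (real \<Rightarrow> real) \<Rightarrow> real \<Rightarrow> real" where
  "arc_l T g \<tau> = arc_time T g (arc_scale T g \<tau>)"
definition arc_c :: "real \<Rightarrow> (real \<Rightarrow> real) \<Rightarrow> real \<Rightarrow> real" where
  "arc_c T g \<tau> = arc_l T g \<tau> - arc_scale T g \<tau>"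

text \<open>Where the time coordinate stands still, the space coordinate falls strictly towards the
  value of g, which it never passes; this is the strictness condition on a vertical segment.\<close>

lemma arc_parametrization:
  assumes g: "g \<in> decr_paths" and T: "0 < T"
  shows "(arc_l T g, arc_c T g) \<in> parametrizations T g"
proof -
  have T0: "0 \<le> T" using T by simp
  note sb = arc_scale_bounds[OF g T]
  have scont: "continuous_on {0..T} (arc_scale T g)"
    unfolding arc_scale_def using T by (intro continuous_intros) auto
  have "1-lipschitz_on {- g 0..T - g T} (arc_time T g)"
  proof (rule lipschitz_onI)
    fix x y assume xy: "x \<in> {- g 0..T - g T}" "y \<in> {- g 0..T - g T}"
    show "dist (arc_time T g x) (arc_time T g y) \<le> 1 * dist x y"
      using xy arc_time_lipschitz[OF g T0, of x y] arc_time_lipschitz[OF g T0, of y x]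
        arc_time_mono[OF g T0, of x y] arc_time_mono[OF g T0, of y x]
      by (cases "x \<le> y") (auto simp: dist_real_def)
  qed simp
  then have "continuous_on {- g 0..T - g T} (arc_time T g)"
    by (rule lipschitz_on_continuous_on)
  then have lcont: "continuous_on {0..T} (arc_l T g)"
    unfolding arc_l_def by (rule continuous_on_compose2[OF _ scont]) (use sb in auto)
  have image: "(\<lambda>t. (arc_l T g t, arc_c T g t)) ` {0..T} = completed_graph T g"
  proof (intro equalityI subsetI)
    fix p assume "p \<in> (\<lambda>t. (arc_l T g t, arc_c T g t)) ` {0..T}"
    then show "p \<in> completed_graph T g"
      unfolding arc_c_def arc_l_def using sb T0 by (auto intro!: arc_time_in_graph g)
  next
    fix p assume p: "p \<in> completed_graph T g"
    obtain t x where tx: "p = (t, x)" by (cases p)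
    note A = arc_time_graph[OF g T0, of t x, folded tx, OF p]
    have nn: "0 < T - g T + g 0" using decr_pathsD[OF g, of 0 T] T by simp
    define \<tau> where "\<tau> = (t - x + g 0) / (T - g T + g 0) * T"
    have s: "arc_scale T g \<tau> = t - x"
      unfolding arc_scale_def \<tau>_def using nn T by simp
    have "(t - x + g 0) / (T - g T + g 0) \<le> 1" using A nn by simp
    then have "\<tau> \<le> 1 * T" unfolding \<tau>_def using T0 by (rule mult_right_mono)
    moreover have "0 \<le> \<tau>" unfolding \<tau>_def using A nn T by simp
    ultimately have "\<tau> \<in> {0..T}" by simp
    moreover have "p = (arc_l T g \<tau>, arc_c T g \<tau>)"
      using A s by (simp add: arc_l_def arc_c_def tx)
    ultimately show "p \<in> (\<lambda>t. (arc_l T g t, arc_c T g t)) ` {0..T}" by blast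
  qed
  have "arc_l T g t' < arc_l T g t \<or> (arc_l T g t' = arc_l T g t \<and>
      \<bar>arc_c T g t - g (arc_l T g t)\<bar> < \<bar>arc_c T g t' - g (arc_l T g t)\<bar>)"
    if t: "t' \<in> {0..T}" "t \<in> {0..T}" "t' < t" for t t'
  proof -
    have s: "arc_scale T g t' < arc_scale T g t"
      using arc_scale_strict_mono[OF g T] t by simp
    have "arc_l T g t' \<le> arc_l T g t"
      unfolding arc_l_def using t s sb[of t] by (intro arc_time_mono g) auto
    moreover have "g (arc_l T g t) \<le> arc_c T g t"
      unfolding arc_c_def arc_l_def using arc_time_props(3)[OF g T0] sb[of t] t by force
    ultimately show ?thesis using s by (auto simp: arc_c_def)
  qed
  with lcont image scont show ?thesis
    unfolding parametrizations_def arc_c_def by (auto intro!: continuous_intros)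
qed

section \<open>Elementary bounds for the local M1 distance\<close>

lemma unif_dist_nonneg:
  assumes "0 \<le> T" "continuous_on {0..T} f" "continuous_on {0..T} g"
  shows "0 \<le> unif_dist T f g"
proof -
  have "compact ((\<lambda>t. \<bar>f t - g t\<bar>) ` {0..T})"
    using assms by (intro compact_continuous_image continuous_intros) auto
  then have "bdd_above ((\<lambda>t. \<bar>f t - g t\<bar>) ` {0..T})"
    by (intro bounded_imp_bdd_above compact_imp_bounded)
  then have "\<bar>f 0 - g 0\<bar> \<le> unif_dist T f g"
    unfolding unif_dist_def using assms(1) by (intro cSUP_upper) auto
  then show ?thesis by linarith
qed

lemma unif_dist_le:
  "0 \<le> T \<Longrightarrow> (\<And>t. 0 \<le> t \<Longrightarrow> t \<le> T \<Longrightarrow> \<bar>f t - g t\<bar> \<le> d) \<Longrightarrow> unif_dist T f g \<le> d"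
  unfolding unif_dist_def by (rule cSUP_least) auto

text \<open>The given p and q keep the infimum away from the empty set, about whose infimum nothing
  is known.\<close>

lemma M1_dist_upto_nonneg:
  assumes "0 \<le> T" "p \<in> parametrizations T g" "q \<in> parametrizations T h"
  shows "0 \<le> M1_dist_upto T g h"
  unfolding M1_dist_upto_def
proof (rule cInf_greatest)
  obtain l1 c1 l2 c2 where "p = (l1, c1)" "q = (l2, c2)" by (cases p, cases q)
  with assms show "{max (unif_dist T l1 l2) (unif_dist T c1 c2) | l1 c1 l2 c2.
      (l1, c1) \<in> parametrizations T g \<and> (l2, c2) \<in> parametrizations T h} \<noteq> {}" by blast
qed (use assms in \<open>auto simp: parametrizations_def max_def intro!: unif_dist_nonneg\<close>)

lemma M1_dist_upto_le:
  assumes T: "0 \<le> T" and p: "(l1, c1) \<in> parametrizations T g" "(l2, c2) \<in> parametrizations T h"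
    and l: "\<And>t. 0 \<le> t \<Longrightarrow> t \<le> T \<Longrightarrow> \<bar>l1 t - l2 t\<bar> \<le> d"
    and c: "\<And>t. 0 \<le> t \<Longrightarrow> t \<le> T \<Longrightarrow> \<bar>c1 t - c2 t\<bar> \<le> d"
  shows "M1_dist_upto T g h \<le> d"
proof -
  have "M1_dist_upto T g h \<le> max (unif_dist T l1 l2) (unif_dist T c1 c2)"
    unfolding M1_dist_upto_def
  proof (rule cInf_lower)
    show "bdd_below {max (unif_dist T l1 l2) (unif_dist T c1 c2) | l1 c1 l2 c2.
      (l1, c1) \<in> parametrizations T g \<and> (l2, c2) \<in> parametrizations T h}"
      using T by (intro bdd_belowI[of _ 0])
        (auto simp: parametrizations_def le_max_iff_disj intro!: unif_dist_nonneg)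
  qed (use p in blast)
  also have "\<dots> \<le> d" using unif_dist_le[OF T l] unif_dist_le[OF T c] by simp
  finally show ?thesis .
qed

text \<open>Both scalings are affine in \<tau>, so their gap is a convex combination of the gaps at
  the two ends.\<close>

lemma arc_scale_close:
  assumes T: "0 < T" and \<tau>: "0 \<le> \<tau>" "\<tau> \<le> T"
    and close: "\<bar>g 0 - h 0\<bar> \<le> \<epsilon>" "\<bar>g T - h T\<bar> \<le> \<epsilon>"
  shows "\<bar>arc_scale T g \<tau> - arc_scale T h \<tau>\<bar> \<le> \<epsilon>"
proof -
  define w where "w = \<tau> / T"
  have w: "0 \<le> w" "w \<le> 1" using T \<tau> by (auto simp: w_def)
  have "arc_scale T g \<tau> - arc_scale T h \<tau> = (1 - w) * (h 0 - g 0) + w * (h T - g T)"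
    by (simp add: arc_scale_def w_def[symmetric] algebra_simps)
  also have "\<bar>\<dots>\<bar> \<le> (1 - w) * \<epsilon> + w * \<epsilon>"
    using w close
    by (intro order_trans[OF abs_triangle_ineq] add_mono) (auto simp: abs_mult intro!: mult_left_mono)
  finally show ?thesis by (simp add: algebra_simps)
qed

text \<open>Within \<epsilon> after the hitting time of g there is a time d at which g and h are
  close. There t - h t is short of its own level by at most 2 \<epsilon>, one \<epsilon> from the
  values and one from the scalings, and since it grows with slope at least 1, a further wait of 2
  \<epsilon> makes up for this.\<close>

lemma arc_l_close:
  assumes g: "g \<in> decr_paths" and h: "h \<in> decr_paths" and T: "0 < T" and \<epsilon>: "0 \<le> \<epsilon>"
    and \<tau>: "0 \<le> \<tau>" "\<tau> \<le> T"
    and close: "\<bar>g 0 - h 0\<bar> \<le> \<epsilon>" "\<bar>g T - h T\<bar> \<le> \<epsilon>"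
    and dense: "\<And>t. 0 \<le> t \<Longrightarrow> t < T \<Longrightarrow> \<exists>d. t < d \<and> d \<le> t + \<epsilon> \<and> d \<le> T \<and> \<bar>g d - h d\<bar> \<le> \<epsilon>"
  shows "arc_l T h \<tau> \<le> arc_l T g \<tau> + 3 * \<epsilon>"
proof -
  have T0: "0 \<le> T" using T by simp
  note sg = arc_scale_bounds[OF g T \<tau>] and sh = arc_scale_bounds[OF h T \<tau>]
  note Lg = arc_time_props[OF g T0 sg(2), folded arc_l_def]
    and Lh = arc_time_props[OF h T0 sh(2), folded arc_l_def]
  show ?thesis
  proof (cases "arc_l T g \<tau> < T")
    case True
    obtain d where d: "arc_l T g \<tau> < d" "d \<le> arc_l T g \<tau> + \<epsilon>" "d \<le> T" "\<bar>g d - h d\<bar> \<le> \<epsilon>"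
      using dense[OF Lg(1) True] by blast
    have "arc_scale T g \<tau> \<le> d - g d"
      using Lg(3) decr_pathsD[OF g Lg(1), of d] d(1) by linarith
    then have *: "arc_scale T h \<tau> \<le> d + 2 * \<epsilon> - h d"
      using arc_scale_close[OF T \<tau> close] d(4) by linarith
    show ?thesis
    proof (cases "d + 2 * \<epsilon> \<le> T")
      case True
      have "h (d + 2 * \<epsilon>) \<le> h d" using Lg(1) d(1) \<epsilon> by (intro decr_pathsD[OF h]) auto
      then have "arc_l T h \<tau> \<le> d + 2 * \<epsilon>"
        using Lg(1) d(1) \<epsilon> * True by (intro Lh(5)) auto
      with d show ?thesis by linarith
    next
      case False
      with Lh(2) d show ?thesis by linarith
    qed
  next
    case False
    with Lh(2) \<epsilon> show ?thesis by linarith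
  qed
qed

text \<open>The space coordinate is the time coordinate minus the scale, so 4 \<epsilon> is 3
  \<epsilon> from the former and \<epsilon> from the latter.\<close>

lemma M1_dist_upto_decr_le:
  assumes g: "g \<in> decr_paths" and h: "h \<in> decr_paths" and T: "0 < T" and \<epsilon>: "0 \<le> \<epsilon>"
    and close: "\<bar>g 0 - h 0\<bar> \<le> \<epsilon>" "\<bar>g T - h T\<bar> \<le> \<epsilon>"
    and dense: "\<And>t. 0 \<le> t \<Longrightarrow> t < T \<Longrightarrow> \<exists>d. t < d \<and> d \<le> t + \<epsilon> \<and> d \<le> T \<and> \<bar>g d - h d\<bar> \<le> \<epsilon>"
  shows "M1_dist_upto T g h \<le> 4 * \<epsilon>"
proof (rule M1_dist_upto_le[OF _ arc_parametrization[OF g T] arc_parametrization[OF h T]])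
  fix t assume t: "0 \<le> t" "t \<le> T"
  have "arc_l T h t \<le> arc_l T g t + 3 * \<epsilon>"
    using arc_l_close[OF g h T \<epsilon> t close dense] .
  moreover have "arc_l T g t \<le> arc_l T h t + 3 * \<epsilon>"
    using close dense by (intro arc_l_close[OF h g T \<epsilon> t]) (auto simp: abs_minus_commute)
  ultimately have l: "\<bar>arc_l T g t - arc_l T h t\<bar> \<le> 3 * \<epsilon>" by linarith
  then show "\<bar>arc_l T g t - arc_l T h t\<bar> \<le> 4 * \<epsilon>" using \<epsilon> by linarith
  show "\<bar>arc_c T g t - arc_c T h t\<bar> \<le> 4 * \<epsilon>"
    using l arc_scale_close[OF T t close] unfolding arc_c_def by linarith
qed (use T in simp)

section \<open>M1 convergence of decreasing paths\<close>

text \<open>The integral of a non-integrable function is 0 by convention, so the zero function can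
  replace a non-measurable f. Dominated convergence is then applied to the replacements.\<close>

lemma integral_measurable_or_zero:
  fixes f :: "'a \<Rightarrow> real"
  obtains w where "w \<in> borel_measurable M" "integral\<^sup>L M w = integral\<^sup>L M f"
    "\<And>x. w x = f x \<or> w x = 0"
proof (cases "f \<in> borel_measurable M")
  case False
  then have "\<not> integrable M f" using borel_measurable_integrable by blast
  then have "integral\<^sup>L M f = 0" by (rule not_integrable_integral_eq)
  then show thesis by (intro that[of "\<lambda>_. 0"]) auto
qed (rule that, auto)

text \<open>Measurability in \<open>T\<close> of the local distances is not needed: a non-measurable integrand
  makes the integral \<open>0\<close>.\<close>

lemma M1_dist_tendsto:
  assumes lim: "AE T in lborel. 0 < T \<longrightarrow> (\<lambda>n. M1_dist_upto T g (h n)) \<longlonglongrightarrow> 0"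
    and nonneg: "\<And>T n. 0 < T \<Longrightarrow> 0 \<le> M1_dist_upto T g (h n)"
  shows "(\<lambda>n. M1_dist g (h n)) \<longlonglongrightarrow> 0"
proof -
  define W where "W n t = indicator {0..} t *\<^sub>R (exp (- t) * min 1 (M1_dist_upto t g (h n)))"
    for n and t :: real
  have "\<exists>w. w \<in> borel_measurable lborel \<and> integral\<^sup>L lborel w = integral\<^sup>L lborel (W n) \<and>
      (\<forall>t. w t = W n t \<or> w t = 0)" for n
    by (rule integral_measurable_or_zero[of lborel "W n"]) blast
  then obtain w where w: "\<And>n. w n \<in> borel_measurable lborel"
    "\<And>n. integral\<^sup>L lborel (w n) = integral\<^sup>L lborel (W n)"
    "\<And>n t. w n t = W n t \<or> w n t = 0" by metis
  have eq: "M1_dist g (h n) = integral\<^sup>L lborel (w n)" for n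
    unfolding w(2) M1_dist_def set_lebesgue_integral_def W_def ..
  have int: "integrable lborel (\<lambda>t::real. exp (- t) * indicator {0<..} t)"
    using has_bochner_integral_I0i_power_exp_m[of 0] by (simp add: has_bochner_integral_iff)
  have W_le: "\<bar>w n t\<bar> \<le> \<bar>W n t\<bar>" for n t using w(3)[of n t] by fastforce
  \<comment> \<open>The hypotheses say nothing about the local distance at time 0, which is a null
    set.\<close>
  have lim_w: "AE t in lborel. (\<lambda>n. w n t) \<longlonglongrightarrow> 0"
    using lim AE_lborel_singleton[of 0]
  proof eventually_elim
    case (elim t)
    have "(\<lambda>n. W n t) \<longlonglongrightarrow> 0"
    proof (cases "0 < t")
      case True
      have "(\<lambda>n. indicator {0..} t *\<^sub>R (exp (- t) * min 1 (M1_dist_upto t g (h n))))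
          \<longlonglongrightarrow> indicator {0..} t *\<^sub>R (exp (- t) * min 1 0)"
        using elim True by (intro tendsto_intros) auto
      then show ?thesis unfolding W_def by simp
    next
      case False
      with elim have "W n t = 0" for n by (simp add: W_def)
      then show ?thesis by simp
    qed
    from tendsto_rabs_zero[OF this] show ?case
      by (rule Lim_null_comparison[rotated]) (use W_le in auto)
  qed
  have bound: "\<bar>W n t\<bar> \<le> exp (- t) * indicator {0<..} t" if "t \<noteq> 0" for n t
  proof (cases "0 < t")
    case True
    then have "0 \<le> min 1 (M1_dist_upto t g (h n))" "min 1 (M1_dist_upto t g (h n)) \<le> 1"
      using nonneg[OF True] by auto
    then show ?thesis using True by (simp add: W_def abs_mult)
  qed (use that in \<open>simp add: W_def\<close>)
  have "(\<lambda>n. integral\<^sup>L lborel (w n)) \<longlonglongrightarrow> integral\<^sup>L lborel (\<lambda>_::real. 0::real)"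
  proof (rule integral_dominated_convergence[OF _ w(1) int lim_w])
    show "AE t in lborel. norm (w n t) \<le> exp (- t) * indicator {0<..} t" for n
      using AE_lborel_singleton[of 0]
    proof eventually_elim
      case (elim t)
      show ?case using order_trans[OF W_le bound[OF elim]] by simp
    qed
  qed simp
  then show ?thesis by (simp add: eq)
qed

text \<open>One index governs both the mesh and the horizon, and the sets grow with it, so that
  agreement at level k covers all coarser levels.\<close>

definition dyadic_times :: "nat \<Rightarrow> real set" where
  "dyadic_times k = (\<lambda>i. real i / 2 ^ k) ` {..k * 2 ^ k}"

lemma finite_dyadic_times [simp]: "finite (dyadic_times k)"
  by (simp add: dyadic_times_def)

lemma zero_in_dyadic_times [simp]: "0 \<in> dyadic_times k"
  by (force simp: dyadic_times_def)

lemma dyadic_times_mono: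
  assumes "k \<le> k'" shows "dyadic_times k \<subseteq> dyadic_times k'"
proof
  fix d assume "d \<in> dyadic_times k"
  then obtain i where i: "i \<le> k * 2 ^ k" "d = real i / 2 ^ k" by (auto simp: dyadic_times_def)
  have "i * 2 ^ (k' - k) \<le> (k * 2 ^ k) * 2 ^ (k' - k)" using i by simp
  also have "\<dots> = k * 2 ^ k'" using assms by (simp only: mult.assoc flip: power_add) simp
  also have "\<dots> \<le> k' * 2 ^ k'" using assms by simp
  finally have "i * 2 ^ (k' - k) \<le> k' * 2 ^ k'" .
  moreover have "d = real (i * 2 ^ (k' - k)) / 2 ^ k'"
  proof -
    have "(2::real) ^ k' = 2 ^ k * 2 ^ (k' - k)" using assms by (simp flip: power_add)
    with i show ?thesis by simp
  qed
  ultimately show "d \<in> dyadic_times k'" unfolding dyadic_times_def by blast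
qed

lemma dyadic_times_next:
  assumes t: "0 \<le> t" "t + 1 / 2 ^ k \<le> real k"
  obtains d where "d \<in> dyadic_times k" "t < d" "d \<le> t + 1 / 2 ^ k"
proof -
  define i where "i = nat \<lfloor>t * 2 ^ k\<rfloor> + 1"
  have "real (nat \<lfloor>t * 2 ^ k\<rfloor>) = of_int \<lfloor>t * 2 ^ k\<rfloor>" using t by simp
  then have i: "t * 2 ^ k < real i" "real i \<le> t * 2 ^ k + 1" unfolding i_def by linarith+
  let ?d = "real i / 2 ^ k"
  have d: "t < ?d" "?d \<le> t + 1 / 2 ^ k" using i by (auto simp: field_simps)
  then have "?d \<le> real k" using t by linarith
  then have "real i \<le> real (k * 2 ^ k)" by (simp add: field_simps)
  then have "i \<le> k * 2 ^ k" by (simp only: of_nat_le_iff)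
  then have "?d \<in> dyadic_times k" unfolding dyadic_times_def by blast
  with d that show thesis by blast
qed

lemma ex_small_dyadic:
  fixes \<epsilon> K :: real assumes "0 < \<epsilon>"
  obtains k where "1 / 2 ^ k < \<epsilon>" "K \<le> real k"
proof -
  have "(\<lambda>k. (1 / 2) ^ k :: real) \<longlonglongrightarrow> 0" by (intro LIMSEQ_power_zero) simp
  then have 1: "\<forall>\<^sub>F k in sequentially. (1 / 2) ^ k < \<epsilon>" using assms by (rule order_tendstoD)
  have 2: "\<forall>\<^sub>F k in sequentially. K \<le> real k"
    using filterlim_real_sequentially by (simp add: filterlim_at_top)
  have "\<exists>k. (1 / 2) ^ k < \<epsilon> \<and> K \<le> real k"
    using eventually_happens'[OF _ eventually_conj[OF 1 2]] by simp
  with that show thesis by (auto simp: power_one_over)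
qed

lemma dyadic_times_dense:
  assumes "0 \<le> a" "a < b"
  obtains k d where "d \<in> dyadic_times k" "a < d" "d < b"
proof -
  obtain k where k: "1 / 2 ^ k < b - a" "b \<le> real k" using ex_small_dyadic[of "b - a" b] assms by auto
  then have "a + 1 / 2 ^ k \<le> real k" by linarith
  from dyadic_times_next[OF assms(1) this]
  obtain d where "d \<in> dyadic_times k" "a < d" "d \<le> a + 1 / 2 ^ k" .
  with k that[of d k] show thesis by linarith
qed

lemma M1_dist_upto_decr_nonneg:
  "g \<in> decr_paths \<Longrightarrow> h \<in> decr_paths \<Longrightarrow> 0 < T \<Longrightarrow> 0 \<le> M1_dist_upto T g h"
  using M1_dist_upto_nonneg[OF _ arc_parametrization arc_parametrization] by auto

text \<open>Dyadic times on both sides of T squeeze \<open>h n T\<close> by monotonicity. Continuity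
  is phrased for - g (max 0 x), an increasing function on the whole line, to which the theorem on
  countably many discontinuities applies.\<close>

lemma decr_tendsto_at_cont:
  assumes g: "g \<in> decr_paths" and h: "\<And>n. h n \<in> decr_paths"
    and lim: "\<And>k d. d \<in> dyadic_times k \<Longrightarrow> (\<lambda>n. h n d) \<longlonglongrightarrow> g d"
    and T: "0 < T" and cont: "isCont (\<lambda>x. - g (max 0 x)) T"
  shows "(\<lambda>n. h n T) \<longlonglongrightarrow> g T"
proof (rule LIMSEQ_I)
  fix \<epsilon> :: real assume \<epsilon>: "0 < \<epsilon>"
  obtain \<delta> where \<delta>: "\<delta> > 0"
    "\<And>x. dist x T < \<delta> \<Longrightarrow> dist (- g (max 0 x)) (- g (max 0 T)) < \<epsilon> / 2"
    using cont half_gt_zero[OF \<epsilon>] unfolding continuous_at_eps_delta by blast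
  obtain k d1 where d1: "d1 \<in> dyadic_times k" "max 0 (T - \<delta>) < d1" "d1 < T"
    by (rule dyadic_times_dense[of "max 0 (T - \<delta>)" T]) (use T \<delta> in auto)
  obtain k' d2 where d2: "d2 \<in> dyadic_times k'" "T < d2" "d2 < T + \<delta>"
    by (rule dyadic_times_dense[of T "T + \<delta>"]) (use T \<delta> in auto)
  have c1: "\<bar>g d1 - g T\<bar> < \<epsilon> / 2" using \<delta>(2)[of d1] d1 T by (simp add: dist_real_def abs_minus_commute)
  have c2: "\<bar>g d2 - g T\<bar> < \<epsilon> / 2" using \<delta>(2)[of d2] d2 T by (simp add: dist_real_def abs_minus_commute)
  from tendstoD[OF lim[OF d1(1)] half_gt_zero[OF \<epsilon>]] tendstoD[OF lim[OF d2(1)] half_gt_zero[OF \<epsilon>]]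
  have "\<forall>\<^sub>F n in sequentially. norm (h n T - g T) < \<epsilon>"
  proof eventually_elim
    case (elim n)
    have "h n T \<le> h n d1" "h n d2 \<le> h n T"
      using d1 d2 T by (auto intro!: decr_pathsD[OF h])
    with elim c1 c2 show ?case unfolding dist_real_def real_norm_def by linarith
  qed
  then show "\<exists>no. \<forall>n\<ge>no. norm (h n T - g T) < \<epsilon>" by (simp add: eventually_sequentially)
qed

lemma M1_dist_upto_decr_tendsto:
  assumes g: "g \<in> decr_paths" and h: "\<And>n. h n \<in> decr_paths"
    and lim: "\<And>k d. d \<in> dyadic_times k \<Longrightarrow> (\<lambda>n. h n d) \<longlonglongrightarrow> g d"
    and T: "0 < T" and limT: "(\<lambda>n. h n T) \<longlonglongrightarrow> g T"
  shows "(\<lambda>n. M1_dist_upto T g (h n)) \<longlonglongrightarrow> 0"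
proof (rule LIMSEQ_I)
  fix \<epsilon> :: real assume \<epsilon>: "0 < \<epsilon>"
  \<comment> \<open>Accuracy e at the sampled times costs 4 e = \<epsilon> / 2, which leaves a
    strict inequality.\<close>
  define e where "e = \<epsilon> / 8"
  have e: "0 < e" using \<epsilon> by (simp add: e_def)
  \<comment> \<open>Mesh below 1 and horizon T + 1 ensure that every t < T has a next dyadic time
    within the horizon.\<close>
  obtain k where k: "1 / 2 ^ k < min e 1" "T + 1 \<le> real k" using ex_small_dyadic[of "min e 1" "T + 1"] e by auto
  have "\<forall>\<^sub>F n in sequentially. \<forall>d\<in>insert T (dyadic_times k). dist (h n d) (g d) < e"
    using lim limT e by (intro eventually_ball_finite) (auto intro!: tendstoD)
  then have "\<forall>\<^sub>F n in sequentially. norm (M1_dist_upto T g (h n) - 0) < \<epsilon>"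
  proof eventually_elim
    case (elim n)
    then have close: "\<bar>g d - h n d\<bar> \<le> e" if "d \<in> insert T (dyadic_times k)" for d
      using that by (auto simp: dist_real_def abs_minus_commute intro: less_imp_le)
    have "M1_dist_upto T g (h n) \<le> 4 * e"
    proof (rule M1_dist_upto_decr_le[OF g h T less_imp_le[OF e] close close])
      fix t assume t: "0 \<le> t" "t < T"
      obtain d where d: "d \<in> dyadic_times k" "t < d" "d \<le> t + 1 / 2 ^ k"
      proof (rule dyadic_times_next[of t k])
        show "t + 1 / 2 ^ k \<le> real k" using t k by linarith
      qed (use t in auto)
      \<comment> \<open>The next dyadic time may lie beyond T, so the witness is cut off at T, where
        the values are close as well.\<close>
      show "\<exists>d>t. d \<le> t + e \<and> d \<le> T \<and> \<bar>g d - h n d\<bar> \<le> e"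
      proof (intro exI conjI)
        have "1 / 2 ^ k < e" using k by simp
        then show "min T d \<le> t + e" using d(3) by linarith
        show "\<bar>g (min T d) - h n (min T d)\<bar> \<le> e" using d(1) close by (simp add: min_def)
      qed (use d t in auto)
    qed auto
    with M1_dist_upto_decr_nonneg[OF g h T, of n] e show ?case
      unfolding e_def by auto
  qed
  then show "\<exists>no. \<forall>n\<ge>no. norm (M1_dist_upto T g (h n) - 0) < \<epsilon>"
    by (simp only: eventually_sequentially)
qed

text \<open>The local distances converge at the continuity points T of g; the other T are countably
  many and do not count in the integral.\<close>

lemma M1_dist_decr_tendsto:
  assumes g: "g \<in> decr_paths" and h: "\<And>n. h n \<in> decr_paths"
    and lim: "\<And>k d. d \<in> dyadic_times k \<Longrightarrow> (\<lambda>n. h n d) \<longlonglongrightarrow> g d"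
  shows "(\<lambda>n. M1_dist g (h n)) \<longlonglongrightarrow> 0"
proof (rule M1_dist_tendsto)
  let ?D = "{x. \<not> isCont (\<lambda>x. - g (max 0 x)) x}"
  have "mono (\<lambda>x. - g (max 0 x))" by (auto intro!: monoI decr_pathsD[OF g])
  then have "countable ?D" by (rule mono_ctble_discont)
  then have "?D \<in> null_sets lborel" by (rule countable_imp_null_set_lborel)
  then have "AE T in lborel. T \<notin> ?D" by (rule AE_not_in)
  then show "AE T in lborel. 0 < T \<longrightarrow> (\<lambda>n. M1_dist_upto T g (h n)) \<longlonglongrightarrow> 0"
  proof eventually_elim
    case (elim T)
    then have "isCont (\<lambda>x. - g (max 0 x)) T" by simp
    then show ?case
      using M1_dist_upto_decr_tendsto[OF g h lim _ decr_tendsto_at_cont[OF g h lim]] by simp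
  qed
qed (rule M1_dist_upto_decr_nonneg[OF g h])

section \<open>Step paths and Borel measurability\<close>

text \<open>Step paths need not be monotone, so parametrizations are carried over from a monotone
  path by relabelling the space coordinate. On each jump segment \<Lambda> is affine with nonzero
  slope e: it maps the segment onto that of h and multiplies distances to its end by |e|, so the
  graph is covered and strictness survives.\<close>

lemma parametrization_compose:
  assumes p: "(l, c) \<in> parametrizations T g" and g: "g \<in> decr_paths"
    and h: "\<And>t. 0 \<le> t \<Longrightarrow> t \<le> T \<Longrightarrow> h t = \<Lambda> (g t)" and \<Lambda>: "continuous_on UNIV \<Lambda>"
    and affine: "\<And>t. 0 \<le> t \<Longrightarrow> t \<le> T \<Longrightarrow>
      \<exists>e. e \<noteq> 0 \<and> (\<forall>x\<in>{g t..left_lim g t}. \<Lambda> x = \<Lambda> (g t) + e * (x - g t))"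
  shows "(l, \<lambda>\<tau>. \<Lambda> (c \<tau>)) \<in> parametrizations T h"
proof -
  have left: "left_lim h t = \<Lambda> (left_lim g t)" if t: "0 \<le> t" "t \<le> T" for t
  proof (cases "t = 0")
    case False
    with t have t0: "0 < t" by simp
    have "isCont \<Lambda> (left_lim g t)" using \<Lambda> by (simp add: continuous_on_eq_continuous_at)
    then have "((\<lambda>r. \<Lambda> (g r)) \<longlongrightarrow> \<Lambda> (left_lim g t)) (at_left t)"
      by (rule isCont_tendsto_compose[OF _ tendsto_left_lim[OF _ t0]])
         (use g in \<open>simp add: decr_paths_def\<close>)
    moreover have "\<forall>\<^sub>F r in at_left t. \<Lambda> (g r) = h r"
      unfolding eventually_at_left_field using t0 t h by (intro exI[of _ 0]) auto
    ultimately have "(h \<longlongrightarrow> \<Lambda> (left_lim g t)) (at_left t)"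
      by (rule Lim_transform_eventually)
    with t0 show ?thesis by (rule left_lim_eq)
  qed (use t h in simp)
  have seg: "y \<in> {min (left_lim h t) (h t)..max (left_lim h t) (h t)} \<longleftrightarrow>
      (\<exists>x\<in>{min (left_lim g t) (g t)..max (left_lim g t) (g t)}. y = \<Lambda> x)"
    if t: "0 \<le> t" "t \<le> T" for t y
  proof -
    have le: "g t \<le> left_lim g t" using t by (intro decr_le_left_lim_self g)
    obtain e where e: "e \<noteq> 0" "\<And>x. x \<in> {g t..left_lim g t} \<Longrightarrow> \<Lambda> x = \<Lambda> (g t) + e * (x - g t)"
      using affine[OF t] by blast
    have hl: "left_lim h t = h t + e * (left_lim g t - g t)"
      using left[OF t] h[OF t] e(2)[of "left_lim g t"] le by simp
    \<comment> \<open>The quotient (y - h t) / e is the offset from g t of the preimage of y, which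
      treats upward and downward jumps of h alike.\<close>
    have "y \<in> {min (left_lim h t) (h t)..max (left_lim h t) (h t)} \<longleftrightarrow>
        0 \<le> (y - h t) / e \<and> (y - h t) / e \<le> left_lim g t - g t"
    proof (cases "0 < e")
      case True
      then have "h t \<le> left_lim h t" using le by (simp add: hl)
      then show ?thesis using True by (auto simp: hl field_simps min_def max_def)
    next
      case False
      then have neg: "e < 0" using e by simp
      then have "left_lim h t \<le> h t" using le by (simp add: hl mult_nonpos_nonneg)
      then show ?thesis using neg by (auto simp: hl field_simps min_def max_def)
    qed
    also have "\<dots> \<longleftrightarrow> (\<exists>x\<in>{g t..left_lim g t}. y = \<Lambda> x)"
    proof
      assume "0 \<le> (y - h t) / e \<and> (y - h t) / e \<le> left_lim g t - g t"
      then have x: "g t + (y - h t) / e \<in> {g t..left_lim g t}" by auto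
      have "\<Lambda> (g t + (y - h t) / e) = y" using e(2)[OF x] e(1) h[OF t] by simp
      with x show "\<exists>x\<in>{g t..left_lim g t}. y = \<Lambda> x" by metis
    next
      assume "\<exists>x\<in>{g t..left_lim g t}. y = \<Lambda> x"
      then obtain x where x: "x \<in> {g t..left_lim g t}" "y = \<Lambda> x" by blast
      have "(y - h t) / e = x - g t" using e(1) by (simp add: x(2) e(2)[OF x(1)] h[OF t])
      with x(1) show "0 \<le> (y - h t) / e \<and> (y - h t) / e \<le> left_lim g t - g t" by auto
    qed
    finally show ?thesis using le by (simp add: min_def max_def)
  qed
  from p have lc: "continuous_on {0..T} l" "continuous_on {0..T} c"
    and img: "(\<lambda>t. (l t, c t)) ` {0..T} = completed_graph T g"
    and str: "\<And>t' t. t' \<in> {0..T} \<Longrightarrow> t \<in> {0..T} \<Longrightarrow> t' < t \<Longrightarrow>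
       l t' < l t \<or> l t' = l t \<and> \<bar>c t - g (l t)\<bar> < \<bar>c t' - g (l t)\<bar>"
    by (auto simp: parametrizations_def)
  have "(\<lambda>t. (l t, \<Lambda> (c t))) ` {0..T} = (\<lambda>(t, x). (t, \<Lambda> x)) ` completed_graph T g"
    unfolding img[symmetric] by (auto simp: image_image)
  also have "\<dots> = completed_graph T h"
  proof (rule set_eqI)
    fix p :: "real \<times> real"
    obtain t y where p: "p = (t, y)" by (cases p)
    have "p \<in> (\<lambda>(t, x). (t, \<Lambda> x)) ` completed_graph T g \<longleftrightarrow> (\<exists>x. (t, x) \<in> completed_graph T g \<and> y = \<Lambda> x)"
      unfolding p by force
    also have "\<dots> \<longleftrightarrow> t \<in> {0..T} \<and>
        (\<exists>x\<in>{min (left_lim g t) (g t)..max (left_lim g t) (g t)}. y = \<Lambda> x)"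
      unfolding completed_graph_def by blast
    also have "\<dots> \<longleftrightarrow> p \<in> completed_graph T h"
      using seg[of t y] unfolding p completed_graph_def mem_Collect_eq prod.case atLeastAtMost_iff by metis
    finally show "p \<in> (\<lambda>(t, x). (t, \<Lambda> x)) ` completed_graph T g \<longleftrightarrow> p \<in> completed_graph T h" .
  qed
  finally have img': "(\<lambda>t. (l t, \<Lambda> (c t))) ` {0..T} = completed_graph T h" .
  have str': "l t' < l t \<or> l t' = l t \<and> \<bar>\<Lambda> (c t) - h (l t)\<bar> < \<bar>\<Lambda> (c t') - h (l t)\<bar>"
    if t: "t' \<in> {0..T}" "t \<in> {0..T}" "t' < t" for t' t
  proof (cases "l t' < l t")
    case False
    with str[OF t] have eq: "l t' = l t" and less: "\<bar>c t - g (l t)\<bar> < \<bar>c t' - g (l t)\<bar>" by auto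
    have "(l t, c t) \<in> completed_graph T g" "(l t, c t') \<in> completed_graph T g"
      using t eq unfolding img[symmetric] by (intro image_eqI[of _ _ t] image_eqI[of _ _ t'], auto)+
    then have lt: "0 \<le> l t" "l t \<le> T"
      and c: "c t \<in> {g (l t)..left_lim g (l t)}" "c t' \<in> {g (l t)..left_lim g (l t)}"
      using decr_le_left_lim_self[OF g, of "l t"] by (auto simp: completed_graph_def)
    obtain e where e: "e \<noteq> 0"
      "\<And>x. x \<in> {g (l t)..left_lim g (l t)} \<Longrightarrow> \<Lambda> x = \<Lambda> (g (l t)) + e * (x - g (l t))"
      using affine[OF lt] by blast
    show ?thesis
      using eq less e(1) by (simp add: h[OF lt] e(2)[OF c(1)] e(2)[OF c(2)] abs_mult)
  qed simp
  have "continuous_on {0..T} (\<lambda>\<tau>. \<Lambda> (c \<tau>))"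
    by (rule continuous_on_compose2[OF \<Lambda> lc(2)]) simp
  with lc img' str' show ?thesis unfolding parametrizations_def by blast
qed

text \<open>An abstraction of the integer part of n (s + t). Since the index jumps by at most 1,
  every jump of a step path joins neighbours \<open>a k\<close> and
  \<open>a (Suc k)\<close>.\<close>

definition lattice_index :: "(real \<Rightarrow> nat) \<Rightarrow> bool" where
  "lattice_index \<kappa> \<longleftrightarrow> (\<forall>x y. 0 \<le> x \<longrightarrow> x \<le> y \<longrightarrow> \<kappa> x \<le> \<kappa> y) \<and>
     (\<forall>t\<ge>0. \<forall>\<^sub>F r in at_right t. \<kappa> r = \<kappa> t) \<and>
     (\<forall>t>0. \<exists>k. (\<forall>\<^sub>F r in at_left t. \<kappa> r = k) \<and> (\<kappa> t = k \<or> \<kappa> t = Suc k))"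

definition step_path :: "(real \<Rightarrow> nat) \<Rightarrow> (nat \<Rightarrow> real) \<Rightarrow> real \<Rightarrow> real" where
  "step_path \<kappa> a = (\<lambda>t\<in>{0..}. a (\<kappa> t))"

lemma step_path_apply: "0 \<le> t \<Longrightarrow> step_path \<kappa> a t = a (\<kappa> t)"
  by (simp add: step_path_def)

lemma step_path_tendsto_left:
  assumes "0 < t" "\<forall>\<^sub>F r in at_left t. \<kappa> r = k"
  shows "(step_path \<kappa> a \<longlongrightarrow> a k) (at_left t)"
proof (rule tendsto_eventually)
  have "\<forall>\<^sub>F r in at_left t. 0 \<le> r"
    unfolding eventually_at_left_field using assms(1) by (intro exI[of _ 0]) auto
  with assms(2) show "\<forall>\<^sub>F r in at_left t. step_path \<kappa> a r = a k"
    by eventually_elim (simp add: step_path_apply)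
qed

lemma step_path_cadlag:
  assumes "lattice_index \<kappa>"
  shows "step_path \<kappa> a \<in> cadlag"
  unfolding cadlag_def
proof (intro CollectI conjI allI impI)
  show "step_path \<kappa> a \<in> extensional {0..}" by (simp add: step_path_def)
  fix t :: real
  show "(step_path \<kappa> a \<longlongrightarrow> step_path \<kappa> a t) (at_right t)" if "0 \<le> t"
  proof (rule tendsto_eventually)
    have "\<forall>\<^sub>F r in at_right t. \<kappa> r = \<kappa> t" using assms that by (simp add: lattice_index_def)
    moreover have "\<forall>\<^sub>F r in at_right t. t < r" by (simp add: eventually_at_right_less)
    ultimately show "\<forall>\<^sub>F r in at_right t. step_path \<kappa> a r = step_path \<kappa> a t"
      by eventually_elim (use that in \<open>simp add: step_path_apply\<close>)
  qed
  show "\<exists>l. (step_path \<kappa> a \<longlongrightarrow> l) (at_left t)" if "0 < t"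
    using assms that step_path_tendsto_left[OF that] unfolding lattice_index_def by metis
qed

text \<open>Counting only the genuine jumps makes the interpolation injective across each jump, as
  the strictness condition on parametrizations demands.\<close>

definition jumps :: "(nat \<Rightarrow> real) \<Rightarrow> nat \<Rightarrow> real" where
  "jumps a k = (\<Sum>i<k. if a i \<noteq> a (Suc i) then 1 else 0)"

lemma jumps_Suc: "jumps a (Suc k) = jumps a k + (if a k \<noteq> a (Suc k) then 1 else 0)"
  by (simp add: jumps_def)

lemma jumps_mono: "i \<le> k \<Longrightarrow> jumps a i \<le> jumps a k"
  unfolding jumps_def by (intro sum_mono2) auto

lemma jumps_cong: "(\<And>i. i < k \<Longrightarrow> a i \<noteq> a (Suc i) \<longleftrightarrow> b i \<noteq> b (Suc i)) \<Longrightarrow> jumps a k = jumps b k"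
  unfolding jumps_def by (rule sum.cong) auto

text \<open>The piecewise linear function with value \<open>a k\<close> at the point
  \<open>jumps a k\<close> for k \<le> L. As a sum of ramps it is linear in the increments once the
  jump pattern is fixed, so two sequences can be compared term by term.\<close>

definition interpol :: "nat \<Rightarrow> (nat \<Rightarrow> real) \<Rightarrow> real \<Rightarrow> real" where
  "interpol L a z = a 0 + (\<Sum>i<L. (a (Suc i) - a i) * max 0 (min 1 (z - jumps a i)))"

text \<open>Ramps of genuine jumps before k are complete and those after k have not begun; an index
  with \<open>a i = a (Suc i)\<close> contributes the factor 0 whatever its ramp does.\<close>

lemma interpol_between:
  assumes "k < L" "jumps a k \<le> z" "z \<le> jumps a k + 1" "a k \<noteq> a (Suc k)"
  shows "interpol L a z = a k + (a (Suc k) - a k) * (z - jumps a k)"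
proof -
  have "(\<Sum>i<L. (a (Suc i) - a i) * max 0 (min 1 (z - jumps a i))) =
      (\<Sum>i<L. (if i < k then a (Suc i) - a i else 0) +
         (if i = k then (a (Suc i) - a i) * (z - jumps a k) else 0))"
  proof (intro sum.cong refl)
    fix i
    consider "i < k" "a i = a (Suc i)" | "i < k" "a i \<noteq> a (Suc i)" | "i = k" | "k < i" by linarith
    then show "(a (Suc i) - a i) * max 0 (min 1 (z - jumps a i)) =
      (if i < k then a (Suc i) - a i else 0) + (if i = k then (a (Suc i) - a i) * (z - jumps a k) else 0)"
    proof cases
      case 2
      then have "jumps a i + 1 \<le> jumps a k" using jumps_mono[of "Suc i" k a] by (simp add: jumps_Suc)
      with 2 assms show ?thesis by simp
    next
      case 4
      then have "jumps a k + 1 \<le> jumps a i"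
        using jumps_mono[of "Suc k" i a] assms by (simp add: jumps_Suc)
      with 4 assms show ?thesis by simp
    qed (use assms in auto)
  qed
  also have "\<dots> = (\<Sum>i<L. if i < k then a (Suc i) - a i else 0) + (a (Suc k) - a k) * (z - jumps a k)"
    using assms by (simp add: sum.distrib)
  also have "(\<Sum>i<L. if i < k then a (Suc i) - a i else 0) = (\<Sum>i<k. a (Suc i) - a i)"
    using assms by (intro sum.mono_neutral_cong_right) auto
  finally show ?thesis by (simp add: interpol_def sum_lessThan_telescope)
qed

lemma interpol_jumps:
  assumes "k \<le> L"
  shows "interpol L a (jumps a k) = a k"
proof -
  have "(\<Sum>i<L. (a (Suc i) - a i) * max 0 (min 1 (jumps a k - jumps a i))) =
      (\<Sum>i<L. (if i < k then a (Suc i) - a i else 0))"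
  proof (intro sum.cong refl)
    fix i
    consider "i < k" "a i = a (Suc i)" | "i < k" "a i \<noteq> a (Suc i)" | "k \<le> i" by linarith
    then show "(a (Suc i) - a i) * max 0 (min 1 (jumps a k - jumps a i)) =
      (if i < k then a (Suc i) - a i else 0)"
    proof cases
      case 2
      then have "jumps a i + 1 \<le> jumps a k" using jumps_mono[of "Suc i" k a] by (simp add: jumps_Suc)
      with 2 show ?thesis by simp
    next
      case 3
      with jumps_mono[of k i a] show ?thesis by simp
    qed simp
  qed
  also have "\<dots> = (\<Sum>i<k. a (Suc i) - a i)"
    using assms by (intro sum.mono_neutral_cong_right) auto
  finally show ?thesis by (simp add: interpol_def sum_lessThan_telescope)
qed

lemma continuous_interpol: "continuous_on UNIV (interpol L a)"
  unfolding interpol_def by (intro continuous_intros)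

lemma jumps_path_decr:
  assumes "lattice_index \<kappa>"
  shows "step_path \<kappa> (\<lambda>k. - jumps a k) \<in> decr_paths"
  using step_path_cadlag[OF assms] assms
  by (auto simp: decr_paths_def step_path_apply lattice_index_def intro!: jumps_mono)

text \<open>Sequences with the same jump pattern share the decreasing path - jumps. One arc
  parametrization of it therefore serves all of them, with the same time coordinate.\<close>

lemma step_parametrization:
  assumes \<kappa>: "lattice_index \<kappa>" and T: "0 < T" "\<kappa> T \<le> L"
    and same: "\<And>i. i < L \<Longrightarrow> a i \<noteq> a (Suc i) \<longleftrightarrow> b i \<noteq> b (Suc i)"
    and p: "(l, c) \<in> parametrizations T (step_path \<kappa> (\<lambda>k. - jumps a k))"
  shows "(l, \<lambda>\<tau>. interpol L b (- c \<tau>)) \<in> parametrizations T (step_path \<kappa> b)"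
proof (rule parametrization_compose[OF p jumps_path_decr[OF \<kappa>], where \<Lambda> = "\<lambda>x. interpol L b (- x)"])
  have J: "jumps a k = jumps b k" if "k \<le> L" for k
    using that by (intro jumps_cong same) auto
  have \<kappa>L: "\<kappa> t \<le> L" if "0 \<le> t" "t \<le> T" for t
    using \<kappa> that T by (meson lattice_index_def order_trans)
  show "continuous_on UNIV (\<lambda>x. interpol L b (- x))"
    by (rule continuous_on_compose2[OF continuous_interpol]) (auto intro!: continuous_intros)
  fix t assume t: "0 \<le> t" "t \<le> T"
  let ?g = "step_path \<kappa> (\<lambda>k. - jumps a k)"
  show "step_path \<kappa> b t = interpol L b (- ?g t)"
    using t \<kappa>L[OF t] by (simp add: step_path_apply J interpol_jumps)
  show "\<exists>e. e \<noteq> 0 \<and> (\<forall>x\<in>{?g t..left_lim ?g t}.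
      interpol L b (- x) = interpol L b (- ?g t) + e * (x - ?g t))"
  \<comment> \<open>Without a jump the segment is a single point and any nonzero slope will do; at a
    jump the slope is \<open>b k - b (Suc k)\<close>, nonzero since b jumps where a does.\<close>
  proof (cases "left_lim ?g t = ?g t")
    case False
    with t have t0: "0 < t" by (cases "t = 0") auto
    obtain k where k: "\<forall>\<^sub>F r in at_left t. \<kappa> r = k" "\<kappa> t = k \<or> \<kappa> t = Suc k"
      using \<kappa> t0 by (auto simp: lattice_index_def)
    have ll: "left_lim ?g t = - jumps a k"
      by (rule left_lim_eq[OF t0 step_path_tendsto_left[OF t0 k(1)]])
    have \<kappa>t: "\<kappa> t = Suc k" using k False ll t by (auto simp: step_path_apply)
    then have kL: "k < L" using \<kappa>L[OF t] by simp
    have neq: "a k \<noteq> a (Suc k)" using False ll t \<kappa>t by (auto simp: step_path_apply jumps_Suc)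
    have gt: "?g t = - (jumps b k + 1)"
      using t \<kappa>t neq J[of k] kL by (simp add: step_path_apply jumps_Suc)
    have *: "interpol L b z = b k + (b (Suc k) - b k) * (z - jumps b k)"
      if "jumps b k \<le> z" "z \<le> jumps b k + 1" for z
      using that kL neq same by (intro interpol_between) auto
    have "b (Suc k) \<noteq> b k" using neq same[OF kL] by auto
    then show ?thesis
      unfolding ll gt using J[of k] kL
      by (intro exI[of _ "b k - b (Suc k)"]) (auto simp: * algebra_simps)
  qed (auto intro!: exI[of _ 1])
qed

lemma step_M1_dist_upto_nonneg:
  assumes "lattice_index \<kappa>" "0 < T"
  shows "0 \<le> M1_dist_upto T (step_path \<kappa> a) (step_path \<kappa> b)"
proof -
  have "\<exists>p. p \<in> parametrizations T (step_path \<kappa> a)" for a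
    using step_parametrization[where a = a and b = a, OF assms order_refl _
        arc_parametrization[OF jumps_path_decr[OF assms(1)] assms(2)]] by blast
  with M1_dist_upto_nonneg assms(2) show ?thesis by (metis less_imp_le)
qed

text \<open>The time coordinates coincide. In space the initial value contributes \<delta>, and each
  of the L increments, a difference of two entries, contributes 2 \<delta>.\<close>

lemma step_M1_dist_upto_le:
  assumes \<kappa>: "lattice_index \<kappa>" and T: "0 < T" "\<kappa> T \<le> L"
    and same: "\<And>i. i < L \<Longrightarrow> a i \<noteq> a (Suc i) \<longleftrightarrow> b i \<noteq> b (Suc i)"
    and close: "\<And>i. i \<le> L \<Longrightarrow> \<bar>a i - b i\<bar> \<le> \<delta>"
  shows "M1_dist_upto T (step_path \<kappa> a) (step_path \<kappa> b) \<le> (2 * real L + 1) * \<delta>"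
proof -
  have \<delta>: "0 \<le> \<delta>" using close[of 0] by linarith
  let ?g = "step_path \<kappa> (\<lambda>k. - jumps a k)"
  note p = arc_parametrization[OF jumps_path_decr[OF \<kappa>, of a] T(1)]
  have J: "jumps a i = jumps b i" if "i \<le> L" for i
    using that by (intro jumps_cong same) auto
  show ?thesis
  proof (rule M1_dist_upto_le)
    show "(arc_l T ?g, \<lambda>\<tau>. interpol L a (- arc_c T ?g \<tau>)) \<in> parametrizations T (step_path \<kappa> a)"
      by (rule step_parametrization[where a = a and b = a, OF \<kappa> T _ p]) simp
    show "(arc_l T ?g, \<lambda>\<tau>. interpol L b (- arc_c T ?g \<tau>)) \<in> parametrizations T (step_path \<kappa> b)"
      by (rule step_parametrization[where a = a and b = b, OF \<kappa> T same p])
    fix t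
    let ?m = "\<lambda>i. max 0 (min 1 (- arc_c T ?g t - jumps a i))"
    have eq: "interpol L a (- arc_c T ?g t) - interpol L b (- arc_c T ?g t) =
        (a 0 - b 0) + (\<Sum>i<L. (a (Suc i) - a i) * ?m i - (b (Suc i) - b i) * ?m i)"
      by (simp add: interpol_def J sum_subtractf)
    have "\<bar>interpol L a (- arc_c T ?g t) - interpol L b (- arc_c T ?g t)\<bar> \<le> \<delta> + (\<Sum>i<L. 2 * \<delta>)"
      unfolding eq
    proof (intro order_trans[OF abs_triangle_ineq] add_mono order_trans[OF sum_abs] sum_mono close)
      fix i assume "i \<in> {..<L}"
      then have i: "\<bar>a i - b i\<bar> \<le> \<delta>" "\<bar>a (Suc i) - b (Suc i)\<bar> \<le> \<delta>"
        using close[of i] close[of "Suc i"] by auto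
      have "(a (Suc i) - a i) * ?m i - (b (Suc i) - b i) * ?m i =
          ((a (Suc i) - b (Suc i)) - (a i - b i)) * ?m i" by (simp add: algebra_simps)
      then have "\<bar>(a (Suc i) - a i) * ?m i - (b (Suc i) - b i) * ?m i\<bar> =
          \<bar>(a (Suc i) - b (Suc i)) - (a i - b i)\<bar> * ?m i" by (simp add: abs_mult)
      also have "\<dots> \<le> (2 * \<delta>) * 1"
        using i by (intro mult_mono) auto
      finally show "\<bar>(a (Suc i) - a i) * ?m i - (b (Suc i) - b i) * ?m i\<bar> \<le> 2 * \<delta>" by simp
    qed simp
    then show "\<bar>interpol L a (- arc_c T ?g t) - interpol L b (- arc_c T ?g t)\<bar> \<le> (2 * real L + 1) * \<delta>"
      by (simp add: algebra_simps)
  qed (use T \<delta> in auto)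
qed

text \<open>The preimage of an open set is the union of the code cells contained in it, which are
  countably many: if no cell of \<omega> were contained in it, choosing one bad \<eta> k from the
  cell at every level k would contradict convergence of f (\<eta> k) to f \<omega>.\<close>

lemma measurable_by_codes:
  fixes code :: "nat \<Rightarrow> 'a \<Rightarrow> 'i::countable"
  assumes f: "\<And>\<omega>. \<omega> \<in> space M \<Longrightarrow> f \<omega> \<in> cadlag"
    and code: "\<And>k c. {\<omega> \<in> space M. code k \<omega> = c} \<in> sets M"
    and conv: "\<And>\<omega> \<eta>. \<omega> \<in> space M \<Longrightarrow> (\<And>k. \<eta> k \<in> space M) \<Longrightarrow> (\<And>k. code k (\<eta> k) = code k \<omega>) \<Longrightarrow>
      (\<lambda>k. M1_dist (f \<omega>) (f (\<eta> k))) \<longlonglongrightarrow> 0"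
  shows "f \<in> M \<rightarrow>\<^sub>M borel_of M1_topology"
  unfolding borel_of_def topspace_M1_topology openin_M1_topology
proof (rule measurable_measure_of)
  show "{U. M1_open U} \<subseteq> Pow cadlag" by (auto simp: M1_open_def)
  show "f \<in> space M \<rightarrow> cadlag" using f by auto
  fix U assume "U \<in> {U. M1_open U}"
  then have U: "M1_open U" by simp
  let ?C = "\<lambda>k. {c. \<forall>\<omega>\<in>space M. code k \<omega> = c \<longrightarrow> f \<omega> \<in> U}"
  have "f -` U \<inter> space M \<subseteq> (\<Union>k. \<Union>c\<in>?C k. {\<omega> \<in> space M. code k \<omega> = c})"
  proof
    fix \<omega> assume "\<omega> \<in> f -` U \<inter> space M"
    then have \<omega>: "\<omega> \<in> space M" "f \<omega> \<in> U" by auto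
    have "\<exists>k. code k \<omega> \<in> ?C k"
    proof (rule ccontr)
      assume "\<nexists>k. code k \<omega> \<in> ?C k"
      then obtain \<eta> where \<eta>: "\<And>k. \<eta> k \<in> space M" "\<And>k. code k (\<eta> k) = code k \<omega>" "\<And>k. f (\<eta> k) \<notin> U"
        by simp metis
      obtain r where r: "r > 0" "\<And>h. h \<in> cadlag \<Longrightarrow> M1_dist (f \<omega>) h < r \<Longrightarrow> h \<in> U"
        using U \<omega>(2) by (auto simp: M1_open_def)
      have "\<forall>\<^sub>F k in sequentially. M1_dist (f \<omega>) (f (\<eta> k)) < r"
        using order_tendstoD(2)[OF conv[OF \<omega>(1) \<eta>(1,2)] r(1)] .
      then obtain k where "M1_dist (f \<omega>) (f (\<eta> k)) < r" by (auto simp: eventually_sequentially)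
      with r(2) f[OF \<eta>(1)] \<eta>(3) show False by blast
    qed
    with \<omega> show "\<omega> \<in> (\<Union>k. \<Union>c\<in>?C k. {\<omega> \<in> space M. code k \<omega> = c})" by blast
  qed
  then have "f -` U \<inter> space M = (\<Union>k. \<Union>c\<in>?C k. {\<omega> \<in> space M. code k \<omega> = c})" by auto
  then show "f -` U \<inter> space M \<in> sets M"
    using code by (auto intro!: sets.countable_UN'' countableI_type)
qed

lemma floor_dyadic_close:
  fixes x y :: real
  assumes "\<lfloor>2 ^ k * x\<rfloor> = \<lfloor>2 ^ k * y\<rfloor>"
  shows "\<bar>x - y\<bar> \<le> 1 / 2 ^ k"
proof -
  have "\<bar>2 ^ k * x - 2 ^ k * y\<bar> \<le> 1" using assms by linarith
  then have "2 ^ k * \<bar>x - y\<bar> \<le> 1" by (simp add: abs_mult flip: right_diff_distrib)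
  then show ?thesis by (simp add: field_simps)
qed

lemma dyadic_tendsto_zero: "(\<lambda>k. C * (1 / 2 ^ k) :: real) \<longlonglongrightarrow> 0"
proof -
  have "(\<lambda>k. C * (1 / 2) ^ k) \<longlonglongrightarrow> C * 0"
    by (intro tendsto_intros LIMSEQ_power_zero) simp
  then show ?thesis by (simp add: power_one_over)
qed

lemma sets_map_eq:
  assumes "\<And>i z. i < n \<Longrightarrow> {\<omega> \<in> space M. F i \<omega> = z} \<in> sets M"
  shows "{\<omega> \<in> space M. map (\<lambda>i. F i \<omega>) [0..<n] = c} \<in> sets M"
proof (cases "length c = n")
  case True
  have "{\<omega> \<in> space M. \<forall>i\<in>{..<n}. F i \<omega> = c ! i} \<in> sets M"
    using assms by (intro sets.sets_Collect_finite_All) auto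
  also have "{\<omega> \<in> space M. \<forall>i\<in>{..<n}. F i \<omega> = c ! i} =
      {\<omega> \<in> space M. map (\<lambda>i. F i \<omega>) [0..<n] = c}"
    using True by (auto simp: list_eq_iff_nth_eq)
  finally show ?thesis .
next
  case False
  then have "map (\<lambda>i. F i \<omega>) [0..<n] \<noteq> c" for \<omega> by auto
  then have "{\<omega> \<in> space M. map (\<lambda>i. F i \<omega>) [0..<n] = c} = {}" by blast
  then show ?thesis by (simp only: sets.empty_sets)
qed

text \<open>Monotonicity is not assumed: where some \<open>X j\<close> leaves the range of the levels,
  \<open>level_inv\<close> takes a junk value and the paths of the maximum process need not decrease.\<close>

lemma measurable_step_path:
  assumes \<kappa>: "lattice_index \<kappa>" and A[measurable]: "\<And>i. A i \<in> borel_measurable M"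
  shows "(\<lambda>\<omega>. step_path \<kappa> (\<lambda>i. A i \<omega>)) \<in> M \<rightarrow>\<^sub>M borel_of M1_topology"
\<comment> \<open>The flags in the code force equal jump patterns, on which the bound for step paths
  rests; rounded values alone would not detect small jumps.\<close>
proof (rule measurable_by_codes[where
      code = "\<lambda>k \<omega>. map (\<lambda>i. (\<lfloor>2 ^ k * A i \<omega>\<rfloor>, A i \<omega> \<noteq> A (Suc i) \<omega>)) [0..<Suc k]"])
  show "{\<omega> \<in> space M. map (\<lambda>i. (\<lfloor>2 ^ k * A i \<omega>\<rfloor>, A i \<omega> \<noteq> A (Suc i) \<omega>)) [0..<Suc k] = c} \<in> sets M" for k c
  proof (rule sets_map_eq)
    fix i z
    show "{\<omega> \<in> space M. (\<lfloor>2 ^ k * A i \<omega>\<rfloor>, A i \<omega> \<noteq> A (Suc i) \<omega>) = z} \<in> sets M"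
      by (cases z) (simp, measurable)
  qed
  fix \<omega> \<eta>
  assume eq: "\<And>k. map (\<lambda>i. (\<lfloor>2 ^ k * A i (\<eta> k)\<rfloor>, A i (\<eta> k) \<noteq> A (Suc i) (\<eta> k))) [0..<Suc k] =
      map (\<lambda>i. (\<lfloor>2 ^ k * A i \<omega>\<rfloor>, A i \<omega> \<noteq> A (Suc i) \<omega>)) [0..<Suc k]"
  have same: "A i \<omega> \<noteq> A (Suc i) \<omega> \<longleftrightarrow> A i (\<eta> k) \<noteq> A (Suc i) (\<eta> k)"
    and close: "\<bar>A i \<omega> - A i (\<eta> k)\<bar> \<le> 1 / 2 ^ k" if "i \<le> k" for i k
  proof -
    have "i \<in> set [0..<Suc k]" using that by (simp only: set_upt atLeastLessThan_iff less_Suc_eq_le le0 simp_thms)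
    from bspec[OF iffD1[OF map_eq_conv eq[of k]] this]
    have "(\<lfloor>2 ^ k * A i (\<eta> k)\<rfloor>, A i (\<eta> k) \<noteq> A (Suc i) (\<eta> k)) = (\<lfloor>2 ^ k * A i \<omega>\<rfloor>, A i \<omega> \<noteq> A (Suc i) \<omega>)" .
    then show "A i \<omega> \<noteq> A (Suc i) \<omega> \<longleftrightarrow> A i (\<eta> k) \<noteq> A (Suc i) (\<eta> k)" "\<bar>A i \<omega> - A i (\<eta> k)\<bar> \<le> 1 / 2 ^ k"
      by (auto intro: floor_dyadic_close)
  qed
  show "(\<lambda>k. M1_dist (step_path \<kappa> (\<lambda>i. A i \<omega>)) (step_path \<kappa> (\<lambda>i. A i (\<eta> k)))) \<longlonglongrightarrow> 0"
  proof (rule M1_dist_tendsto)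
    show "AE T in lborel. 0 < T \<longrightarrow>
      (\<lambda>n. M1_dist_upto T (step_path \<kappa> (\<lambda>i. A i \<omega>)) (step_path \<kappa> (\<lambda>i. A i (\<eta> n)))) \<longlonglongrightarrow> 0"
    proof (rule AE_I2, rule impI)
      fix T :: real assume T: "0 < T"
      show "(\<lambda>n. M1_dist_upto T (step_path \<kappa> (\<lambda>i. A i \<omega>)) (step_path \<kappa> (\<lambda>i. A i (\<eta> n)))) \<longlonglongrightarrow> 0"
      proof (rule Lim_null_comparison[OF _ dyadic_tendsto_zero])
        show "\<forall>\<^sub>F n in sequentially.
          norm (M1_dist_upto T (step_path \<kappa> (\<lambda>i. A i \<omega>)) (step_path \<kappa> (\<lambda>i. A i (\<eta> n))))
            \<le> (2 * real (\<kappa> T) + 1) * (1 / 2 ^ n)"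
          unfolding eventually_sequentially
        \<comment> \<open>Code n records the indices up to n, hence for n \<ge> \<kappa> T all those
          that occur up to time T.\<close>
        proof (intro exI[of _ "\<kappa> T"] allI impI)
          fix n assume n: "\<kappa> T \<le> n"
          have "M1_dist_upto T (step_path \<kappa> (\<lambda>i. A i \<omega>)) (step_path \<kappa> (\<lambda>i. A i (\<eta> n)))
              \<le> (2 * real (\<kappa> T) + 1) * (1 / 2 ^ n)"
            using n same close by (intro step_M1_dist_upto_le[OF \<kappa> T order_refl]) auto
          then show "norm (M1_dist_upto T (step_path \<kappa> (\<lambda>i. A i \<omega>)) (step_path \<kappa> (\<lambda>i. A i (\<eta> n))))
            \<le> (2 * real (\<kappa> T) + 1) * (1 / 2 ^ n)"
            using step_M1_dist_upto_nonneg[OF \<kappa> T] by simp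
        qed
      qed
    qed
  qed (rule step_M1_dist_upto_nonneg[OF \<kappa>])
qed (rule step_path_cadlag[OF \<kappa>])

section \<open>Codes of decreasing paths by rounded values\<close>

definition decr_code :: "nat \<Rightarrow> (real \<Rightarrow> real) \<Rightarrow> int list" where
  "decr_code k g = map (\<lambda>i. \<lfloor>2 ^ k * g (real i / 2 ^ k)\<rfloor>) [0..<Suc (k * 2 ^ k)]"

lemma decr_code_close:
  assumes "decr_code k g = decr_code k h" "d \<in> dyadic_times k"
  shows "\<bar>g d - h d\<bar> \<le> 1 / 2 ^ k"
  using assms unfolding decr_code_def dyadic_times_def map_eq_conv
  by (auto simp: le_imp_less_Suc intro!: floor_dyadic_close)

lemma decr_close_M1_tendsto:
  assumes g: "g \<in> decr_paths" and h: "\<And>k. h k \<in> decr_paths"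
    and close: "\<And>k d. d \<in> dyadic_times k \<Longrightarrow> \<bar>h k d - g d\<bar> \<le> 1 / 2 ^ k"
  shows "(\<lambda>k. M1_dist g (h k)) \<longlonglongrightarrow> 0"
proof (rule M1_dist_decr_tendsto[OF g h])
  fix k d assume d: "d \<in> dyadic_times k"
  show "(\<lambda>n. h n d) \<longlonglongrightarrow> g d"
  proof (rule LIM_zero_cancel, rule Lim_null_comparison[OF _ dyadic_tendsto_zero[of 1]])
    show "\<forall>\<^sub>F n in sequentially. norm (h n d - g d) \<le> 1 * (1 / 2 ^ n)"
      unfolding eventually_sequentially
      using close subsetD[OF dyadic_times_mono d] by (intro exI[of _ k]) auto
  qed
qed

lemma sets_decr_code_eq:
  assumes "\<And>t. 0 \<le> t \<Longrightarrow> (\<lambda>\<omega>. f \<omega> t) \<in> borel_measurable M"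
  shows "{\<omega> \<in> space M. decr_code k (f \<omega>) = c} \<in> sets M"
  unfolding decr_code_def
proof (rule sets_map_eq)
  fix i z
  have [measurable]: "(\<lambda>\<omega>. f \<omega> (real i / 2 ^ k)) \<in> borel_measurable M" by (rule assms) simp
  show "{\<omega> \<in> space M. \<lfloor>2 ^ k * f \<omega> (real i / 2 ^ k)\<rfloor> = z} \<in> sets M" by measurable
qed

lemma measurable_decr_path:
  assumes f: "\<And>\<omega>. \<omega> \<in> space M \<Longrightarrow> f \<omega> \<in> decr_paths"
    and meas: "\<And>t. 0 \<le> t \<Longrightarrow> (\<lambda>\<omega>. f \<omega> t) \<in> borel_measurable M"
  shows "f \<in> M \<rightarrow>\<^sub>M borel_of M1_topology"
proof (rule measurable_by_codes[where code = "\<lambda>k \<omega>. decr_code k (f \<omega>)"])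
  fix \<omega> \<eta>
  assume \<omega>: "\<omega> \<in> space M" and \<eta>: "\<And>k. \<eta> k \<in> space M"
    "\<And>k. decr_code k (f (\<eta> k)) = decr_code k (f \<omega>)"
  show "(\<lambda>k. M1_dist (f \<omega>) (f (\<eta> k))) \<longlonglongrightarrow> 0"
    by (rule decr_close_M1_tendsto[OF f[OF \<omega>] f[OF \<eta>(1)]]) (rule decr_code_close[OF \<eta>(2)])
qed (use f in \<open>auto simp: decr_paths_def intro!: sets_decr_code_eq meas\<close>)

section \<open>Weak convergence to a decreasing limit\<close>

lemma space_borel_of: "space (borel_of T) = topspace T"
  unfolding borel_of_def by (rule space_measure_of) (auto dest: openin_subset)

lemma openin_sets_borel_of: "openin T U \<Longrightarrow> U \<in> sets (borel_of T)"
  unfolding borel_of_def by (subst sets_measure_of) (auto dest: openin_subset)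

lemma continuous_map_borel_of:
  assumes "continuous_map T euclideanreal F"
  shows "F \<in> borel_measurable (borel_of T)"
proof (rule borel_measurableI)
  fix S :: "real set" assume "open S"
  then have "openin T {x \<in> topspace T. F x \<in> S}"
    using assms by (auto simp: continuous_map_def)
  moreover have "F -` S \<inter> space (borel_of T) = {x \<in> topspace T. F x \<in> S}"
    by (auto simp: space_borel_of)
  ultimately show "F -` S \<inter> space (borel_of T) \<in> sets (borel_of T)"
    by (simp add: openin_sets_borel_of)
qed

text \<open>Upper bounds are imposed only on the coordinates in E, so that induction on E leads from
  survival functions, where E is empty, to probabilities of half-open cells.\<close>

definition half_open_prob ::
    "'a measure \<Rightarrow> ('i \<Rightarrow> 'a \<Rightarrow> real) \<Rightarrow> 'i set \<Rightarrow> ('i \<Rightarrow> real) \<Rightarrow> 'i set \<Rightarrow> ('i \<Rightarrow> real) \<Rightarrow> real" where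
  "half_open_prob M V D y E b =
     measure M {\<omega> \<in> space M. (\<forall>i\<in>D. y i \<le> V i \<omega>) \<and> (\<forall>i\<in>E. V i \<omega> < b i)}"

lemma (in finite_measure) half_open_prob_insert:
  fixes V :: "'i \<Rightarrow> 'a \<Rightarrow> real"
  assumes D: "finite D" "E \<subseteq> D" "d \<in> D" "d \<notin> E" and yb: "y d \<le> b d"
    and [measurable]: "\<And>i. i \<in> D \<Longrightarrow> V i \<in> borel_measurable M"
  shows "half_open_prob M V D y (insert d E) b =
    half_open_prob M V D y E b - half_open_prob M V D (y(d := b d)) E b"
proof -
  let ?A = "{\<omega> \<in> space M. (\<forall>i\<in>D. y i \<le> V i \<omega>) \<and> (\<forall>i\<in>E. V i \<omega> < b i)}"
  let ?B = "{\<omega> \<in> space M. (\<forall>i\<in>D. (y(d := b d)) i \<le> V i \<omega>) \<and> (\<forall>i\<in>E. V i \<omega> < b i)}"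
  let ?C = "{\<omega> \<in> space M. (\<forall>i\<in>D. y i \<le> V i \<omega>) \<and> (\<forall>i\<in>insert d E. V i \<omega> < b i)}"
  have E: "finite E" using D finite_subset by blast
  have [measurable]: "V i \<in> borel_measurable M" if "i \<in> E" for i using that D by auto
  have sets: "?A \<in> sets M" "?B \<in> sets M" using D(1) E by measurable
  have 1: "y i \<le> V i \<omega>" if "\<forall>i\<in>D. (y(d := b d)) i \<le> V i \<omega>" "i \<in> D" for i \<omega>
    using bspec[OF that] yb by (cases "i = d") auto
  have "?B \<subseteq> ?A" using 1 by blast
  moreover have "?C = ?A - ?B"
  proof (rule set_eqI)
    fix \<omega>
    show "\<omega> \<in> ?C \<longleftrightarrow> \<omega> \<in> ?A - ?B"
    proof (cases "\<forall>i\<in>D. y i \<le> V i \<omega>")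
      case True
      have "(\<forall>i\<in>D. (y(d := b d)) i \<le> V i \<omega>) \<longleftrightarrow> b d \<le> V d \<omega>"
      proof
        assume "b d \<le> V d \<omega>"
        with True show "\<forall>i\<in>D. (y(d := b d)) i \<le> V i \<omega>" by simp
      qed (use D(3) in \<open>auto dest: bspec[of _ _ d]\<close>)
      with True show ?thesis by (auto simp: not_less)
    next
      case False
      then show ?thesis by blast
    qed
  qed
  ultimately show ?thesis unfolding half_open_prob_def using finite_measure_Diff[OF sets] by simp
qed

text \<open>Inclusion and exclusion, one coordinate at a time: an upper bound at d is a difference
  of two lower bounds at d. Lower bounds are only ever raised and so remain nonnegative, as
  \<open>conv\<close> demands.\<close>

lemma half_open_cells_tendsto:
  fixes V :: "nat \<Rightarrow> 'i \<Rightarrow> 'a \<Rightarrow> real" and W :: "'i \<Rightarrow> 'b \<Rightarrow> real"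
  assumes P: "finite_measure P" and Q: "finite_measure Q" and D: "finite D"
    and V: "\<And>n i. i \<in> D \<Longrightarrow> V n i \<in> borel_measurable P"
    and W: "\<And>i. i \<in> D \<Longrightarrow> W i \<in> borel_measurable Q"
    and conv: "\<And>y. (\<And>i. 0 \<le> y i) \<Longrightarrow> (\<lambda>n. measure P {\<omega> \<in> space P. \<forall>i\<in>D. y i \<le> V n i \<omega>})
      \<longlonglongrightarrow> measure Q {\<omega> \<in> space Q. \<forall>i\<in>D. y i \<le> W i \<omega>}"
    and E: "E \<subseteq> D" and y: "\<And>i. 0 \<le> y i" and b: "\<And>i. i \<in> E \<Longrightarrow> y i \<le> b i"
  shows "(\<lambda>n. half_open_prob P (V n) D y E b) \<longlonglongrightarrow> half_open_prob Q W D y E b"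
proof -
  have "finite E" using E D finite_subset by blast
  then show ?thesis using E y b
  proof (induction E arbitrary: y rule: finite_induct)
    case empty
    with conv[of y] show ?case by (simp add: half_open_prob_def)
  next
    case (insert d E)
    have *: "0 \<le> (y(d := b d)) i" for i
      using insert.prems(2)[of d] insert.prems(2)[of i] insert.prems(3)[of d] by (auto intro: order_trans)
    have eq: "E \<subseteq> D" "d \<in> D" "d \<notin> E" "y d \<le> b d" using insert by auto
    have eqP: "half_open_prob P (V n) D y (insert d E) b =
        half_open_prob P (V n) D y E b - half_open_prob P (V n) D (y(d := b d)) E b" for n
      by (rule finite_measure.half_open_prob_insert[OF P D]) (use eq V in auto)
    have eqQ: "half_open_prob Q W D y (insert d E) b =
        half_open_prob Q W D y E b - half_open_prob Q W D (y(d := b d)) E b"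
      by (rule finite_measure.half_open_prob_insert[OF Q D]) (use eq W in auto)
    have "(\<lambda>n. half_open_prob P (V n) D (y(d := b d)) E b) \<longlonglongrightarrow> half_open_prob Q W D (y(d := b d)) E b"
      using insert.prems insert.hyps * by (intro insert.IH) auto
    moreover have "(\<lambda>n. half_open_prob P (V n) D y E b) \<longlonglongrightarrow> half_open_prob Q W D y E b"
      using insert.prems by (intro insert.IH) auto
    ultimately show ?case unfolding eqP eqQ by (intro tendsto_diff)
  qed
qed

lemma decr_code_eq_iff:
  assumes "length c = Suc (k * 2 ^ k)"
  shows "decr_code k g = c \<longleftrightarrow>
    (\<forall>i\<in>{..k * 2 ^ k}. of_int (c ! i) / 2 ^ k \<le> g (real i / 2 ^ k)) \<and>
    (\<forall>i\<in>{..k * 2 ^ k}. g (real i / 2 ^ k) < (of_int (c ! i) + 1) / 2 ^ k)"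
proof -
  have "decr_code k g = c \<longleftrightarrow> (\<forall>i\<le>k * 2 ^ k. \<lfloor>2 ^ k * g (real i / 2 ^ k)\<rfloor> = c ! i)"
    using assms unfolding decr_code_def list_eq_iff_nth_eq
    by (auto simp: less_Suc_eq_le simp del: upt_Suc)
  also have "\<dots> \<longleftrightarrow> (\<forall>i\<le>k * 2 ^ k. of_int (c ! i) / 2 ^ k \<le> g (real i / 2 ^ k) \<and>
      g (real i / 2 ^ k) < (of_int (c ! i) + 1) / 2 ^ k)"
    by (simp add: floor_eq_iff field_simps)
  finally show ?thesis by auto
qed

lemma decr_code_prob_tendsto:
  assumes P: "finite_measure P" and Q: "finite_measure Q"
    and f: "\<And>n t. 0 \<le> t \<Longrightarrow> (\<lambda>\<omega>. f n \<omega> t) \<in> borel_measurable P"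
    and g: "\<And>t. 0 \<le> t \<Longrightarrow> (\<lambda>\<omega>. g \<omega> t) \<in> borel_measurable Q"
    and conv: "\<And>y. (\<And>i. 0 \<le> y i) \<Longrightarrow>
      (\<lambda>n. measure P {\<omega> \<in> space P. \<forall>i\<in>{..k * 2 ^ k}. y i \<le> f n \<omega> (real i / 2 ^ k)})
      \<longlonglongrightarrow> measure Q {\<omega> \<in> space Q. \<forall>i\<in>{..k * 2 ^ k}. y i \<le> g \<omega> (real i / 2 ^ k)}"
    and c: "length c = Suc (k * 2 ^ k)" "\<And>z. z \<in> set c \<Longrightarrow> 0 \<le> z"
  shows "(\<lambda>n. measure P {\<omega> \<in> space P. decr_code k (f n \<omega>) = c})
      \<longlonglongrightarrow> measure Q {\<omega> \<in> space Q. decr_code k (g \<omega>) = c}"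
proof -
  \<comment> \<open>The value 0 past the end of the list provides the nonnegativity at every index
    that \<open>conv\<close> asks for.\<close>
  let ?y = "\<lambda>i. if i \<le> k * 2 ^ k then of_int (c ! i) / 2 ^ k else (0::real)"
  have y: "0 \<le> ?y i" for i using c by auto
  have "(\<lambda>n. measure P {\<omega> \<in> space P. (\<forall>i\<in>{..k * 2 ^ k}. ?y i \<le> f n \<omega> (real i / 2 ^ k)) \<and>
        (\<forall>i\<in>{..k * 2 ^ k}. f n \<omega> (real i / 2 ^ k) < (of_int (c ! i) + 1) / 2 ^ k)})
      \<longlonglongrightarrow> measure Q {\<omega> \<in> space Q. (\<forall>i\<in>{..k * 2 ^ k}. ?y i \<le> g \<omega> (real i / 2 ^ k)) \<and>
        (\<forall>i\<in>{..k * 2 ^ k}. g \<omega> (real i / 2 ^ k) < (of_int (c ! i) + 1) / 2 ^ k)}"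
    by (rule half_open_cells_tendsto[OF P Q, unfolded half_open_prob_def, where V = "\<lambda>n i \<omega>. f n \<omega> (real i / 2 ^ k)"
          and W = "\<lambda>i \<omega>. g \<omega> (real i / 2 ^ k)"])
       (use y in \<open>auto intro!: f g conv divide_right_mono\<close>)
  moreover have "(\<forall>i\<in>{..k * 2 ^ k}. ?y i \<le> h i) \<longleftrightarrow> (\<forall>i\<in>{..k * 2 ^ k}. of_int (c ! i) / 2 ^ k \<le> h i)" for h
    by auto
  ultimately show ?thesis by (simp only: decr_code_eq_iff[OF c(1)])
qed

section \<open>Lower approximation of functionals by finitely many cells\<close>

definition cell_inf :: "((real \<Rightarrow> real) \<Rightarrow> real) \<Rightarrow> nat \<Rightarrow> int list \<Rightarrow> real" where
  "cell_inf F k c = Inf {F h | h. h \<in> decr_paths \<and> decr_code k h = c}"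

text \<open>Only codes of values in [0, k) are kept, which leaves finitely many. A path outside
  these cells gets the approximation 0, which is still a lower bound for a nonnegative
  functional.\<close>

definition cells :: "nat \<Rightarrow> int list set" where
  "cells k = {c. set c \<subseteq> {0..<int (k * 2 ^ k)} \<and> length c = Suc (k * 2 ^ k)}"

definition lower_approx :: "((real \<Rightarrow> real) \<Rightarrow> real) \<Rightarrow> nat \<Rightarrow> (real \<Rightarrow> real) \<Rightarrow> real" where
  "lower_approx F k h = (\<Sum>c\<in>cells k. cell_inf F k c * (if decr_code k h = c then 1 else 0))"

lemma finite_cells [simp]: "finite (cells k)"
  unfolding cells_def by (rule finite_lists_length_eq) simp

lemma lower_approx_eq:
  "lower_approx F k h = (if decr_code k h \<in> cells k then cell_inf F k (decr_code k h) else 0)"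
  unfolding lower_approx_def by (simp add: if_distrib[of "(*) _"] sum.delta' cong: if_cong)

lemma lower_approx_le:
  assumes F: "\<And>x. x \<in> cadlag \<Longrightarrow> 0 \<le> F x" and h: "h \<in> decr_paths"
  shows "lower_approx F k h \<le> F h"
proof -
  have "cell_inf F k (decr_code k h) \<le> F h"
    unfolding cell_inf_def
    by (rule cInf_lower) (use F h in \<open>auto simp: decr_paths_def intro!: bdd_belowI[of _ 0]\<close>)
  with F[of h] h show ?thesis by (simp add: lower_approx_eq decr_paths_def)
qed

lemma lower_approx_nonneg:
  assumes F: "\<And>x. x \<in> cadlag \<Longrightarrow> 0 \<le> F x" and h: "h \<in> decr_paths"
  shows "0 \<le> lower_approx F k h"
proof -
  have "0 \<le> cell_inf F k (decr_code k h)"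
    unfolding cell_inf_def
    by (rule cInf_greatest) (use F h in \<open>auto simp: decr_paths_def\<close>)
  then show ?thesis by (simp add: lower_approx_eq)
qed

lemma decr_code_in_cells:
  assumes h: "h \<in> decr_paths" and nonneg: "\<And>t. 0 \<le> t \<Longrightarrow> 0 \<le> h t" and k: "h 0 < real k"
  shows "decr_code k h \<in> cells k"
proof -
  have "0 \<le> \<lfloor>2 ^ k * h (real i / 2 ^ k)\<rfloor> \<and> \<lfloor>2 ^ k * h (real i / 2 ^ k)\<rfloor> < int (k * 2 ^ k)" for i
  proof -
    have "h (real i / 2 ^ k) < real k" using decr_pathsD[OF h, of 0 "real i / 2 ^ k"] k by simp
    then have "2 ^ k * h (real i / 2 ^ k) < of_int (int (k * 2 ^ k))" by simp
    with nonneg[of "real i / 2 ^ k"] show ?thesis by (auto simp: floor_less_iff)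
  qed
  then show ?thesis by (auto simp: cells_def decr_code_def simp del: upt_Suc)
qed

text \<open>Otherwise there are paths that share the code of g at ever finer levels but on which F
  stays below F g by \<epsilon>; these paths converge to g in M1. The bound holds on whole cells and
  hence for their infima.\<close>

lemma decr_locally_close:
  assumes F: "continuous_map M1_topology euclideanreal F" and g: "g \<in> decr_paths" and \<epsilon>: "0 < \<epsilon>"
  obtains k0 where "\<And>k h. k0 \<le> k \<Longrightarrow> h \<in> decr_paths \<Longrightarrow> decr_code k h = decr_code k g \<Longrightarrow> F g - \<epsilon> < F h"
proof (rule ccontr)
  assume "\<not> thesis"
  then have "\<forall>k0. \<exists>k h. k0 \<le> k \<and> h \<in> decr_paths \<and> decr_code k h = decr_code k g \<and> F h \<le> F g - \<epsilon>"
    using that by (meson not_le)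
  then obtain K h where h: "\<And>k. k \<le> K k" "\<And>k. h k \<in> decr_paths"
    "\<And>k. decr_code (K k) (h k) = decr_code (K k) g" "\<And>k. F (h k) \<le> F g - \<epsilon>" by metis
  have lim: "(\<lambda>k. M1_dist g (h k)) \<longlonglongrightarrow> 0"
  proof (rule decr_close_M1_tendsto[OF g h(2)])
    fix k d assume "d \<in> dyadic_times k"
    then have "d \<in> dyadic_times (K k)" using dyadic_times_mono[OF h(1)] by blast
    then have "\<bar>h k d - g d\<bar> \<le> 1 / 2 ^ K k" by (rule decr_code_close[OF h(3)])
    also have "\<dots> \<le> 1 / 2 ^ k" using h(1)[of k] by (simp add: field_simps power_increasing)
    finally show "\<bar>h k d - g d\<bar> \<le> 1 / 2 ^ k" .
  qed
  let ?U = "{x \<in> cadlag. F x \<in> {F g - \<epsilon><..}}"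
  have "openin M1_topology ?U"
    using F open_greaterThan by (auto simp: continuous_map_def topspace_M1_topology simp del: greaterThan_iff)
  then have "M1_open ?U" by (simp add: openin_M1_topology)
  moreover have "g \<in> ?U" using g \<epsilon> by (auto simp: decr_paths_def)
  ultimately obtain r where r: "r > 0" "\<And>x. x \<in> cadlag \<Longrightarrow> M1_dist g x < r \<Longrightarrow> x \<in> ?U"
    unfolding M1_open_def by blast
  obtain k where "M1_dist g (h k) < r"
    using order_tendstoD(2)[OF lim r(1)] by (auto simp: eventually_sequentially)
  with r(2)[of "h k"] h(2)[of k] h(4)[of k] show False by (auto simp: decr_paths_def)
qed

lemma lower_approx_tendsto:
  assumes F: "continuous_map M1_topology euclideanreal F" and F0: "\<And>x. x \<in> cadlag \<Longrightarrow> 0 \<le> F x"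
    and g: "g \<in> decr_paths" and nonneg: "\<And>t. 0 \<le> t \<Longrightarrow> 0 \<le> g t"
  shows "(\<lambda>k. lower_approx F k g) \<longlonglongrightarrow> F g"
proof (rule LIMSEQ_I)
  fix \<epsilon> :: real assume \<epsilon>: "0 < \<epsilon>"
  obtain k0 where k0: "\<And>k h. k0 \<le> k \<Longrightarrow> h \<in> decr_paths \<Longrightarrow> decr_code k h = decr_code k g \<Longrightarrow> F g - \<epsilon> / 2 < F h"
    using decr_locally_close[OF F g, of "\<epsilon> / 2"] \<epsilon> by auto
  obtain k1 where k1: "g 0 < real k1" using reals_Archimedean2 by blast
  have "norm (lower_approx F k g - F g) < \<epsilon>" if k: "max k0 k1 \<le> k" for k
  proof -
    have "decr_code k g \<in> cells k"
      using k k1 by (intro decr_code_in_cells g nonneg) auto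
    moreover have "F g - \<epsilon> / 2 \<le> cell_inf F k (decr_code k g)"
      unfolding cell_inf_def
      by (rule cInf_greatest) (use g k0 k in \<open>auto intro: less_imp_le\<close>)
    ultimately have "F g - \<epsilon> / 2 \<le> lower_approx F k g" by (simp add: lower_approx_eq)
    with lower_approx_le[where k = k and F = F, OF F0 g] \<epsilon> show ?thesis by (simp add: abs_if)
  qed
  then show "\<exists>no. \<forall>k\<ge>no. norm (lower_approx F k g - F g) < \<epsilon>" by blast
qed

definition nonneg_decr_paths :: "(real \<Rightarrow> real) set" where
  "nonneg_decr_paths = {g \<in> decr_paths. \<forall>t\<ge>0. 0 \<le> g t}"

lemma integral_lower_approx:
  assumes P: "prob_space P" and f: "\<And>t. 0 \<le> t \<Longrightarrow> (\<lambda>\<omega>. f \<omega> t) \<in> borel_measurable P"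
  shows "integrable P (\<lambda>\<omega>. lower_approx F k (f \<omega>))"
    and "(\<integral>\<omega>. lower_approx F k (f \<omega>) \<partial>P) =
      (\<Sum>c\<in>cells k. cell_inf F k c * measure P {\<omega> \<in> space P. decr_code k (f \<omega>) = c})"
proof -
  interpret prob_space P by fact
  note sets = sets_decr_code_eq[where f = f and M = P and k = k, OF f]
  have eq: "(if decr_code k (f \<omega>) = c then 1 else 0) =
      indicat_real {\<omega> \<in> space P. decr_code k (f \<omega>) = c} \<omega>" if "\<omega> \<in> space P" for \<omega> c
    using that by auto
  have int: "integrable P (\<lambda>\<omega>. if decr_code k (f \<omega>) = c then 1 else 0 :: real)" for c
    using sets[of c] by (subst Bochner_Integration.integrable_cong[OF refl eq])
      (auto intro!: integrable_real_indicator simp: less_top[symmetric])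
  have "(\<integral>\<omega>. (if decr_code k (f \<omega>) = c then 1 else 0) \<partial>P) =
      measure P {\<omega> \<in> space P. decr_code k (f \<omega>) = c}" for c
    using sets[of c] by (subst Bochner_Integration.integral_cong[OF refl eq]) auto
  with int show "(\<integral>\<omega>. lower_approx F k (f \<omega>) \<partial>P) =
      (\<Sum>c\<in>cells k. cell_inf F k c * measure P {\<omega> \<in> space P. decr_code k (f \<omega>) = c})"
    unfolding lower_approx_def by (simp add: Bochner_Integration.integral_sum)
  show "integrable P (\<lambda>\<omega>. lower_approx F k (f \<omega>))"
    unfolding lower_approx_def using int by (intro Bochner_Integration.integrable_sum integrable_mult_right) 
qed

text \<open>The lower half of a portmanteau theorem: fix a level k whose lower approximation already
  has integral above a under Q, let n tend to infinity in the finite sum over cells, and use that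
  the approximation lies below F.\<close>

lemma integral_eventually_greater:
  assumes P: "prob_space P" and Q: "prob_space Q"
    and f: "\<And>n. f n \<in> P \<rightarrow>\<^sub>M borel_of M1_topology" and g: "g \<in> Q \<rightarrow>\<^sub>M borel_of M1_topology"
    and fc: "\<And>n t. 0 \<le> t \<Longrightarrow> (\<lambda>\<omega>. f n \<omega> t) \<in> borel_measurable P"
    and gc: "\<And>t. 0 \<le> t \<Longrightarrow> (\<lambda>\<omega>. g \<omega> t) \<in> borel_measurable Q"
    and fd: "\<And>n. AE \<omega> in P. f n \<omega> \<in> nonneg_decr_paths"
    and gd: "AE \<omega> in Q. g \<omega> \<in> nonneg_decr_paths"
    and conv: "\<And>k y. (\<And>i. 0 \<le> y i) \<Longrightarrow>
      (\<lambda>n. measure P {\<omega> \<in> space P. \<forall>i\<in>{..k * 2 ^ k}. y i \<le> f n \<omega> (real i / 2 ^ k)})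
      \<longlonglongrightarrow> measure Q {\<omega> \<in> space Q. \<forall>i\<in>{..k * 2 ^ k}. y i \<le> g \<omega> (real i / 2 ^ k)}"
    and F: "continuous_map M1_topology euclideanreal F"
    and F0: "\<And>x. x \<in> cadlag \<Longrightarrow> 0 \<le> F x" and FC: "\<And>x. x \<in> cadlag \<Longrightarrow> F x \<le> C"
    and a: "a < (\<integral>\<omega>. F (g \<omega>) \<partial>Q)"
  shows "\<forall>\<^sub>F n in sequentially. a < (\<integral>\<omega>. F (f n \<omega>) \<partial>P)"
proof -
  interpret P: prob_space P by fact
  interpret Q: prob_space Q by fact
  have fsp: "f n \<omega> \<in> cadlag" if "\<omega> \<in> space P" for n \<omega>
    using measurable_space[OF f that, of n] by (simp add: space_borel_of topspace_M1_topology)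
  have "(\<lambda>k. \<integral>\<omega>. lower_approx F k (g \<omega>) \<partial>Q) \<longlonglongrightarrow> (\<integral>\<omega>. F (g \<omega>) \<partial>Q)"
  proof (rule integral_dominated_convergence[where w = "\<lambda>_. C"])
    show "(\<lambda>\<omega>. F (g \<omega>)) \<in> borel_measurable Q"
      using measurable_comp[OF g continuous_map_borel_of[OF F]] by (simp add: comp_def)
    show "(\<lambda>\<omega>. lower_approx F k (g \<omega>)) \<in> borel_measurable Q" for k
      using integral_lower_approx(1)[OF Q gc] by auto
    show "AE \<omega> in Q. (\<lambda>k. lower_approx F k (g \<omega>)) \<longlonglongrightarrow> F (g \<omega>)"
      using gd by eventually_elim (auto simp: nonneg_decr_paths_def intro!: lower_approx_tendsto F F0)
    show "AE \<omega> in Q. norm (lower_approx F k (g \<omega>)) \<le> C" for k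
      using gd
    proof eventually_elim
      case (elim \<omega>)
      then have g': "g \<omega> \<in> decr_paths" "g \<omega> \<in> cadlag" by (auto simp: nonneg_decr_paths_def decr_paths_def)
      show ?case
        using lower_approx_nonneg[where k = k and F = F, OF F0 g'(1)] lower_approx_le[where k = k and F = F, OF F0 g'(1)] FC[OF g'(2)]
        by simp
    qed
  qed simp
  from order_tendstoD(1)[OF this a]
  obtain k where k: "a < (\<integral>\<omega>. lower_approx F k (g \<omega>) \<partial>Q)" by (auto simp: eventually_sequentially)
  have eqP: "(\<integral>\<omega>. lower_approx F k (f n \<omega>) \<partial>P) =
      (\<Sum>c\<in>cells k. cell_inf F k c * measure P {\<omega> \<in> space P. decr_code k (f n \<omega>) = c})" for n
    by (rule integral_lower_approx(2)[OF P fc])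
  have eqQ: "(\<integral>\<omega>. lower_approx F k (g \<omega>) \<partial>Q) =
      (\<Sum>c\<in>cells k. cell_inf F k c * measure Q {\<omega> \<in> space Q. decr_code k (g \<omega>) = c})"
    by (rule integral_lower_approx(2)[OF Q gc])
  have "(\<lambda>n. \<integral>\<omega>. lower_approx F k (f n \<omega>) \<partial>P) \<longlonglongrightarrow> (\<integral>\<omega>. lower_approx F k (g \<omega>) \<partial>Q)"
    unfolding eqP eqQ
    by (intro tendsto_sum tendsto_mult tendsto_const decr_code_prob_tendsto fc gc conv
        P.finite_measure_axioms Q.finite_measure_axioms) (auto simp: cells_def)
  from order_tendstoD(1)[OF this k] show ?thesis
  proof eventually_elim
    case (elim n)
    have "(\<integral>\<omega>. lower_approx F k (f n \<omega>) \<partial>P) \<le> (\<integral>\<omega>. F (f n \<omega>) \<partial>P)"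
    proof (rule integral_mono_AE)
      have "(\<lambda>\<omega>. F (f n \<omega>)) \<in> borel_measurable P"
        using measurable_comp[OF f continuous_map_borel_of[OF F]] by (simp add: comp_def)
      then show "integrable P (\<lambda>\<omega>. F (f n \<omega>))"
        using fsp F0 FC by (intro P.integrable_const_bound[of _ C] AE_I2) auto
      show "AE \<omega> in P. lower_approx F k (f n \<omega>) \<le> F (f n \<omega>)"
        using fd[of n] by eventually_elim (auto simp: nonneg_decr_paths_def intro!: lower_approx_le F0)
    qed (rule integral_lower_approx(1)[OF P fc])
    with elim show ?case by simp
  qed
qed

lemma converges_weakly_decr_paths:
  assumes P: "prob_space P" and Q: "prob_space Q"
    and f: "\<And>n. f n \<in> P \<rightarrow>\<^sub>M borel_of M1_topology" and g: "g \<in> Q \<rightarrow>\<^sub>M borel_of M1_topology"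
    and fc: "\<And>n t. 0 \<le> t \<Longrightarrow> (\<lambda>\<omega>. f n \<omega> t) \<in> borel_measurable P"
    and gc: "\<And>t. 0 \<le> t \<Longrightarrow> (\<lambda>\<omega>. g \<omega> t) \<in> borel_measurable Q"
    and fd: "\<And>n. AE \<omega> in P. f n \<omega> \<in> nonneg_decr_paths"
    and gd: "AE \<omega> in Q. g \<omega> \<in> nonneg_decr_paths"
    and conv: "\<And>k y. (\<And>i. 0 \<le> y i) \<Longrightarrow>
      (\<lambda>n. measure P {\<omega> \<in> space P. \<forall>i\<in>{..k * 2 ^ k}. y i \<le> f n \<omega> (real i / 2 ^ k)})
      \<longlonglongrightarrow> measure Q {\<omega> \<in> space Q. \<forall>i\<in>{..k * 2 ^ k}. y i \<le> g \<omega> (real i / 2 ^ k)}"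
  shows "converges_weakly M1_topology P f Q g"
  unfolding converges_weakly_def
proof (intro conjI allI impI f g)
  interpret P: prob_space P by fact
  interpret Q: prob_space Q by fact
  fix F :: "(real \<Rightarrow> real) \<Rightarrow> real"
  assume "continuous_map M1_topology euclideanreal F \<and> bounded (F ` topspace M1_topology)"
  then have F: "continuous_map M1_topology euclideanreal F" and "bounded (F ` cadlag)"
    by (auto simp: topspace_M1_topology)
  then obtain C where C: "\<And>x. x \<in> cadlag \<Longrightarrow> \<bar>F x\<bar> \<le> C"
    by (auto simp: bounded_iff)
  have fsp: "f n \<omega> \<in> cadlag" if "\<omega> \<in> space P" for n \<omega>
    using measurable_space[OF f that, of n] by (simp add: space_borel_of topspace_M1_topology)
  have gsp: "g \<omega> \<in> cadlag" if "\<omega> \<in> space Q" for \<omega>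
    using measurable_space[OF g that] by (simp add: space_borel_of topspace_M1_topology)
  have intf: "integrable P (\<lambda>\<omega>. F (f n \<omega>))" for n
    using measurable_comp[OF f[of n] continuous_map_borel_of[OF F]] fsp C
    by (intro P.integrable_const_bound[of _ C] AE_I2) (auto simp: comp_def)
  have intg: "integrable Q (\<lambda>\<omega>. F (g \<omega>))"
    using measurable_comp[OF g continuous_map_borel_of[OF F]] gsp C
    by (intro Q.integrable_const_bound[of _ C] AE_I2) (auto simp: comp_def)
  note ev = integral_eventually_greater[OF P Q f g fc gc fd gd conv, where C = "2 * C"]
  \<comment> \<open>Adding C makes both F and its negative nonnegative, so the lower half yields
    both inequalities.\<close>
  have F1: "continuous_map M1_topology euclideanreal (\<lambda>x. C + F x)"
    and F2: "continuous_map M1_topology euclideanreal (\<lambda>x. C - F x)"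
    by (intro continuous_intros F; simp)+
  have B1: "0 \<le> C + F x" "C + F x \<le> 2 * C" and B2: "0 \<le> C - F x" "C - F x \<le> 2 * C"
    if "x \<in> cadlag" for x using C[OF that] by linarith+
  show "(\<lambda>n. \<integral>\<omega>. F (f n \<omega>) \<partial>P) \<longlonglongrightarrow> (\<integral>\<omega>. F (g \<omega>) \<partial>Q)"
  proof (rule order_tendstoI)
    fix a assume "a < (\<integral>\<omega>. F (g \<omega>) \<partial>Q)"
    then have "C + a < (\<integral>\<omega>. C + F (g \<omega>) \<partial>Q)" using intg by (simp add: Q.prob_space)
    from ev[OF _ _ _ F1 B1 this]
    show "\<forall>\<^sub>F n in sequentially. a < (\<integral>\<omega>. F (f n \<omega>) \<partial>P)"
      using intf by (simp add: P.prob_space)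
  next
    fix a assume "a > (\<integral>\<omega>. F (g \<omega>) \<partial>Q)"
    then have "C - a < (\<integral>\<omega>. C - F (g \<omega>) \<partial>Q)" using intg by (simp add: Q.prob_space)
    from ev[OF _ _ _ F2 B2 this]
    show "\<forall>\<^sub>F n in sequentially. a > (\<integral>\<omega>. F (f n \<omega>) \<partial>P)"
      using intf by (simp add: P.prob_space)
  qed
qed

section \<open>Marked renewal processes\<close>

text \<open>By the equation for E, the function - exp (- \<theta> x) E (r + x) of x has the
  integrand as its derivative off the translates of K, and it vanishes at infinity because E \<le>
  1.\<close>

lemma nn_integral_renewal:
  fixes E p :: "real \<Rightarrow> real"
  assumes \<theta>: "0 < \<theta>" and K: "finite K" and cont: "continuous_on UNIV E"
    and E: "\<And>r. 0 \<le> E r" "\<And>r. E r \<le> 1" and p: "\<And>r. p r \<le> 1"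
    and [measurable]: "p \<in> borel_measurable borel"
    and deriv: "\<And>r. 0 < r \<Longrightarrow> r \<notin> K \<Longrightarrow> (E has_real_derivative \<theta> * p r * E r) (at r)"
    and r: "0 \<le> r"
  shows "(\<integral>\<^sup>+x. ennreal (exponential_density \<theta> x) * ennreal ((1 - p (r + x)) * E (r + x)) \<partial>lborel) = ennreal (E r)"
proof -
  have [measurable]: "E \<in> borel_measurable borel" using cont by (rule borel_measurable_continuous_onI)
  define f where "f x = \<theta> * exp (- (\<theta> * x)) * ((1 - p (r + x)) * E (r + x))" for x
  have f0: "0 \<le> f x" for x using E p \<theta> by (simp add: f_def)
  define F where "F x = - (exp (- (\<theta> * x)) * E (r + x))" for x
  have FTC: "(f has_integral (F B - F 0)) {0..B}" if "0 \<le> B" for B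
  proof (rule fundamental_theorem_of_calculus_interior_strong[of "(\<lambda>k. k - r) ` K"])
    show "continuous_on {0..B} F"
      unfolding F_def by (intro continuous_intros continuous_on_compose2[OF cont]) auto
    fix x assume x: "x \<in> {0<..<B} - (\<lambda>k. k - r) ` K"
    then have "r + x \<notin> K" by (force simp: image_iff)
    then have "(E has_real_derivative \<theta> * p (r + x) * E (r + x)) (at (r + x))"
      using x r by (intro deriv) auto
    then have "((\<lambda>x. E (r + x)) has_real_derivative \<theta> * p (r + x) * E (r + x)) (at x)"
      using DERIV_shift[of E _ x r] by (simp add: add.commute)
    then have "(F has_real_derivative f x) (at x)"
      unfolding F_def by (auto intro!: derivative_eq_intros simp: f_def algebra_simps)
    then show "(F has_vector_derivative f x) (at x)"
      by (simp add: has_real_derivative_iff_has_vector_derivative)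
  qed (use K that in auto)
  have *: "(\<integral>\<^sup>+x. ennreal (f x) * indicator {0..real n} x \<partial>lborel) =
      ennreal (E r - exp (- (\<theta> * n)) * E (r + n))" for n
    using nn_integral_has_integral_lebesgue'[OF _ FTC, of "real n"] f0 by (simp add: F_def)
  have "(\<lambda>n. E r - exp (- (\<theta> * real n)) * E (r + real n)) \<longlonglongrightarrow> E r - 0"
  proof (rule tendsto_diff[OF tendsto_const], rule Lim_null_comparison[where g = "\<lambda>n. exp (- (\<theta> * real n))"])
    show "\<forall>\<^sub>F n in sequentially. norm (exp (- (\<theta> * real n)) * E (r + real n)) \<le> exp (- (\<theta> * real n))"
      using E by (auto simp: abs_mult intro!: always_eventually mult_left_le)
    have "filterlim (\<lambda>n. \<theta> * real n) at_top sequentially"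
      using \<theta> by (intro filterlim_tendsto_pos_mult_at_top[OF tendsto_const _ filterlim_real_sequentially])
    then show "(\<lambda>n. exp (- (\<theta> * real n))) \<longlonglongrightarrow> 0"
      by (intro filterlim_compose[OF exp_at_bot] filterlim_uminus_at_bot_at_top[THEN filterlim_compose])
  qed
  then have lim1: "(\<lambda>n. \<integral>\<^sup>+x. ennreal (f x) * indicator {0..real n} x \<partial>lborel) \<longlonglongrightarrow> ennreal (E r)"
    unfolding * by (intro tendsto_ennrealI) simp
  have "(\<lambda>n. \<integral>\<^sup>+x. ennreal (f x) * indicator {0..real n} x \<partial>lborel) \<longlonglongrightarrow>
      (\<integral>\<^sup>+x. ennreal (f x) * indicator {0..} x \<partial>lborel)"
  proof (rule nn_integral_LIMSEQ)
    show "incseq (\<lambda>n x. ennreal (f x) * indicator {0..real n} x)"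
      by (auto simp: incseq_def le_fun_def indicator_def)
    show "(\<lambda>x. ennreal (f x) * indicator {0..real n} x) \<in> borel_measurable lborel" for n
      unfolding f_def by measurable
    fix x :: real
    obtain n0 where n0: "x \<le> real n0" using real_arch_simple by blast
    have "\<forall>\<^sub>F n in sequentially. ennreal (f x) * indicator {0..} x = ennreal (f x) * indicator {0..real n} x"
      unfolding eventually_sequentially using n0 by (intro exI[of _ n0]) (auto simp: indicator_def)
    then show "(\<lambda>n. ennreal (f x) * indicator {0..real n} x) \<longlonglongrightarrow> ennreal (f x) * indicator {0..} x"
      by (rule Lim_transform_eventually[OF tendsto_const])
  qed
  from LIMSEQ_unique[OF this lim1]
  have "(\<integral>\<^sup>+x. ennreal (f x) * indicator {0..} x \<partial>lborel) = ennreal (E r)" .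
  moreover have "ennreal (exponential_density \<theta> x) * ennreal ((1 - p (r + x)) * E (r + x)) =
      ennreal (f x) * indicator {0..} x" for x
    using E(1)[of "r + x"] p[of "r + x"] \<theta>
    by (auto simp: exponential_density_def f_def mult.commute indicator_def ennreal_mult'[symmetric])
  ultimately show ?thesis by simp
qed

lemma (in prob_space) nn_integral_indep_var:
  assumes ind: "indep_var N1 X N2 Y" and h: "h \<in> borel_measurable (N1 \<Otimes>\<^sub>M N2)"
  shows "(\<integral>\<^sup>+\<omega>. h (X \<omega>, Y \<omega>) \<partial>M) = (\<integral>\<^sup>+\<omega>. \<integral>\<^sup>+\<omega>'. h (X \<omega>, Y \<omega>') \<partial>M \<partial>M)"
proof -
  note [measurable] = h
  have X[measurable]: "X \<in> M \<rightarrow>\<^sub>M N1" and Y[measurable]: "Y \<in> M \<rightarrow>\<^sub>M N2"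
    and eq: "distr M N1 X \<Otimes>\<^sub>M distr M N2 Y = distr M (N1 \<Otimes>\<^sub>M N2) (\<lambda>x. (X x, Y x))"
    using ind by (auto simp: indep_var_distribution_eq)
  interpret DX: prob_space "distr M N1 X" by (rule prob_space_distr[OF X])
  interpret DY: prob_space "distr M N2 Y" by (rule prob_space_distr[OF Y])
  interpret pair_sigma_finite "distr M N1 X" "distr M N2 Y" ..
  have hm: "h \<in> borel_measurable (distr M N1 X \<Otimes>\<^sub>M distr M N2 Y)"
    using h by (simp cong: measurable_cong_sets sets_pair_measure_cong)
  have "(\<integral>\<^sup>+\<omega>. h (X \<omega>, Y \<omega>) \<partial>M) = (\<integral>\<^sup>+z. h z \<partial>distr M (N1 \<Otimes>\<^sub>M N2) (\<lambda>x. (X x, Y x)))"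
    by (simp add: nn_integral_distr)
  also have "\<dots> = (\<integral>\<^sup>+x. \<integral>\<^sup>+y. h (x, y) \<partial>distr M N2 Y \<partial>distr M N1 X)"
    unfolding eq[symmetric] by (rule DY.nn_integral_fst[OF hm, symmetric])
  also have "\<dots> = (\<integral>\<^sup>+x. \<integral>\<^sup>+\<omega>'. h (x, Y \<omega>') \<partial>M \<partial>distr M N1 X)"
    by (intro nn_integral_cong, subst nn_integral_distr) auto
  also have "\<dots> = (\<integral>\<^sup>+\<omega>. \<integral>\<^sup>+\<omega>'. h (X \<omega>, Y \<omega>') \<partial>M \<partial>M)"
    by (subst nn_integral_distr) auto
  finally show ?thesis .
qed

text \<open>Gaps and marks form one independent family, the Boolean selecting the mark, so that past
  and future are disjoint blocks of indices.\<close>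

locale marked_renewal = prob_space M for M :: "'b measure" +
  fixes s v :: "nat \<Rightarrow> 'b \<Rightarrow> real" and \<theta> :: real
  assumes \<theta>: "0 < \<theta>"
    and indep: "indep_vars (\<lambda>_. borel) (\<lambda>(j, b). if b then v j else s j) ({1..} \<times> UNIV)"
    and dist_s: "\<And>j. 1 \<le> j \<Longrightarrow> distributed M lborel (s j) (exponential_density \<theta>)"
begin

definition arrival :: "nat \<Rightarrow> 'b \<Rightarrow> real" where
  "arrival m \<omega> = (\<Sum>j=1..m. s j \<omega>)"

definition avoids :: "(real \<times> real) set \<Rightarrow> nat \<Rightarrow> 'b \<Rightarrow> bool" where
  "avoids Ok m \<omega> \<longleftrightarrow> (\<forall>j\<in>{1..m}. (arrival j \<omega>, v j \<omega>) \<in> Ok)"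

lemma arrival_Suc: "arrival (Suc m) \<omega> = arrival m \<omega> + s (Suc m) \<omega>"
  by (simp add: arrival_def)

lemma avoids_Suc:
  "avoids Ok (Suc m) \<omega> \<longleftrightarrow> avoids Ok m \<omega> \<and> (arrival m \<omega> + s (Suc m) \<omega>, v (Suc m) \<omega>) \<in> Ok"
proof -
  have "{1..Suc m} = insert (Suc m) {1..m}" by auto
  then show ?thesis by (auto simp: avoids_def arrival_Suc)
qed

lemma measurable_sv:
  assumes "1 \<le> j"
  shows "s j \<in> borel_measurable M" "v j \<in> borel_measurable M"
proof -
  have "(case q of (j, b) \<Rightarrow> if b then v j else s j) \<in> borel_measurable M" if "q \<in> {1..} \<times> UNIV" for q
    using indep that by (auto simp: indep_vars_def)
  from this[of "(j, False)"] this[of "(j, True)"] assms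
  show "s j \<in> borel_measurable M" "v j \<in> borel_measurable M" by auto
qed

lemma measurable_arrival [measurable]: "arrival m \<in> borel_measurable M"
  unfolding arrival_def by (intro borel_measurable_sum measurable_sv) auto

lemma pred_avoids:
  assumes "Ok \<in> sets (borel \<Otimes>\<^sub>M borel)"
  shows "Measurable.pred M (avoids Ok m)"
  unfolding avoids_def
proof (intro pred_intros_finite)
  fix j assume "j \<in> {1..m}"
  then have [measurable]: "v j \<in> borel_measurable M" by (intro measurable_sv) auto
  show "Measurable.pred M (\<lambda>\<omega>. (arrival j \<omega>, v j \<omega>) \<in> Ok)"
    using assms by measurable
qed simp

text \<open>The past enters the next step only through the current arrival time and the indicator of
  avoidance. Both are functions of the block of indices up to m, while the next gap and mark belong
  to the block of \<open>Suc m\<close>.\<close>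

lemma indep_past_future:
  assumes Ok: "Ok \<in> sets (borel \<Otimes>\<^sub>M borel)"
  shows "indep_var (borel \<Otimes>\<^sub>M borel) (\<lambda>\<omega>. (arrival m \<omega>, if avoids Ok m \<omega> then 1 else 0 :: real))
    (borel \<Otimes>\<^sub>M borel) (\<lambda>\<omega>. (s (Suc m) \<omega>, v (Suc m) \<omega>))"
proof -
  let ?J = "{1..m} \<times> (UNIV :: bool set)" and ?J' = "{Suc m} \<times> (UNIV :: bool set)"
  let ?X = "\<lambda>(j, b). if b then v j else s j"
  define f where "f x = (\<Sum>j=1..m. x (j, False),
      if \<forall>j\<in>{1..m}. (\<Sum>l=1..j. x (l, False), x (j, True)) \<in> Ok then 1 else 0 :: real)"
    for x :: "nat \<times> bool \<Rightarrow> real"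
  define g where "g x = (x (Suc m, False), x (Suc m, True))" for x :: "nat \<times> bool \<Rightarrow> real"
  have comp: "(\<lambda>x. x (l, b) :: real) \<in> borel_measurable (PiM ?J (\<lambda>_. borel))" if "l \<in> {1..m}" for l b
    using that by (intro measurable_component_singleton) auto
  have sum: "(\<lambda>x. \<Sum>l=1..j. x (l, False) :: real) \<in> borel_measurable (PiM ?J (\<lambda>_. borel))" if "j \<le> m" for j
    using that by (intro borel_measurable_sum comp) auto
  have pair: "Measurable.pred (PiM ?J (\<lambda>_. borel)) (\<lambda>x. (\<Sum>l=1..j. x (l, False) :: real, x (j, True) :: real) \<in> Ok)"
    if "j \<in> {1..m}" for j
    using that by (intro pred_sets2[OF Ok] measurable_Pair sum comp) auto
  have "f \<in> PiM ?J (\<lambda>_. borel) \<rightarrow>\<^sub>M borel \<Otimes>\<^sub>M borel"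
    unfolding f_def by (intro measurable_Pair sum measurable_If measurable_const predE pred_intros_finite pair) auto
  moreover have "g \<in> PiM ?J' (\<lambda>_. borel) \<rightarrow>\<^sub>M borel \<Otimes>\<^sub>M borel"
    unfolding g_def by (intro measurable_Pair measurable_component_singleton) auto
  moreover have "indep_var (PiM ?J (\<lambda>_. borel)) (\<lambda>\<omega>. restrict (\<lambda>i. ?X i \<omega>) ?J)
      (PiM ?J' (\<lambda>_. borel)) (\<lambda>\<omega>. restrict (\<lambda>i. ?X i \<omega>) ?J')"
    by (rule indep_var_restrict[OF indep]) auto
  ultimately have "indep_var (borel \<Otimes>\<^sub>M borel) (f \<circ> (\<lambda>\<omega>. restrict (\<lambda>i. ?X i \<omega>) ?J))
      (borel \<Otimes>\<^sub>M borel) (g \<circ> (\<lambda>\<omega>. restrict (\<lambda>i. ?X i \<omega>) ?J'))"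
    by (intro indep_var_compose)
  moreover have "f \<circ> (\<lambda>\<omega>. restrict (\<lambda>i. ?X i \<omega>) ?J) =
      (\<lambda>\<omega>. (arrival m \<omega>, if avoids Ok m \<omega> then 1 else 0))"
    by (auto simp: f_def arrival_def avoids_def fun_eq_iff)
  moreover have "g \<circ> (\<lambda>\<omega>. restrict (\<lambda>i. ?X i \<omega>) ?J') = (\<lambda>\<omega>. (s (Suc m) \<omega>, v (Suc m) \<omega>))"
    by (auto simp: g_def fun_eq_iff)
  ultimately show ?thesis by simp
qed

lemma indep_sv:
  assumes "1 \<le> j" shows "indep_var borel (s j) borel (v j)"
proof -
  let ?X = "\<lambda>(j, b). if b then v j else s j"
  have "indep_var (PiM {(j, False)} (\<lambda>_. borel)) (\<lambda>\<omega>. restrict (\<lambda>i. ?X i \<omega>) {(j, False)})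
      (PiM {(j, True)} (\<lambda>_. borel)) (\<lambda>\<omega>. restrict (\<lambda>i. ?X i \<omega>) {(j, True)})"
    using assms by (intro indep_var_restrict[OF indep]) auto
  moreover have "(\<lambda>x. x (j, b) :: real) \<in> borel_measurable (PiM {(j, b)} (\<lambda>_. borel))" for b :: bool
    by (intro measurable_component_singleton) simp
  ultimately have "indep_var borel ((\<lambda>x. x (j, False)) \<circ> (\<lambda>\<omega>. restrict (\<lambda>i. ?X i \<omega>) {(j, False)}))
      borel ((\<lambda>x. x (j, True)) \<circ> (\<lambda>\<omega>. restrict (\<lambda>i. ?X i \<omega>) {(j, True)}))"
    by (intro indep_var_compose)
  then show ?thesis by (simp add: comp_def)
qed

text \<open>One Markov step: given the past, first the mark and then the exponential gap is
  integrated out.\<close>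

lemma nn_integral_avoids_Suc:
  assumes Ok[measurable]: "Ok \<in> sets (borel \<Otimes>\<^sub>M borel)" and E[measurable]: "E \<in> borel_measurable borel"
  shows "(\<integral>\<^sup>+\<omega>. (if avoids Ok (Suc m) \<omega> then 1 else 0) * E (arrival (Suc m) \<omega>) \<partial>M) =
    (\<integral>\<^sup>+\<omega>. (if avoids Ok m \<omega> then 1 else 0) *
      (\<integral>\<^sup>+x. ennreal (exponential_density \<theta> x) *
        (emeasure M {\<omega>' \<in> space M. (arrival m \<omega> + x, v (Suc m) \<omega>') \<in> Ok} * E (arrival m \<omega> + x)) \<partial>lborel) \<partial>M)"
proof -
  note [measurable] = measurable_sv[of "Suc m", simplified]
  \<comment> \<open>The argument is ((arrival time, indicator of avoidance), (next gap, next
    mark)).\<close>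
  define h :: "(real \<times> real) \<times> (real \<times> real) \<Rightarrow> ennreal" where
    "h z = ennreal (snd (fst z)) * (indicator Ok (fst (fst z) + fst (snd z), snd (snd z)) *
       E (fst (fst z) + fst (snd z)))" for z
  have h[measurable]: "h \<in> borel_measurable ((borel \<Otimes>\<^sub>M borel) \<Otimes>\<^sub>M (borel \<Otimes>\<^sub>M borel))"
    unfolding h_def
    by (intro borel_measurable_times_ennreal measurable_compose[OF _ borel_measurable_indicator[OF Ok]]
        measurable_compose[OF _ E]) measurable
  have "(\<integral>\<^sup>+\<omega>. (if avoids Ok (Suc m) \<omega> then 1 else 0) * E (arrival (Suc m) \<omega>) \<partial>M) =
      (\<integral>\<^sup>+\<omega>. h ((arrival m \<omega>, if avoids Ok m \<omega> then 1 else 0), (s (Suc m) \<omega>, v (Suc m) \<omega>)) \<partial>M)"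
    by (intro nn_integral_cong) (simp add: h_def avoids_Suc arrival_Suc indicator_def)
  also have "\<dots> = (\<integral>\<^sup>+\<omega>. \<integral>\<^sup>+\<omega>'. h ((arrival m \<omega>, if avoids Ok m \<omega> then 1 else 0),
      (s (Suc m) \<omega>', v (Suc m) \<omega>')) \<partial>M \<partial>M)"
    by (rule nn_integral_indep_var[OF indep_past_future[OF Ok] h])
  also have "\<dots> = (\<integral>\<^sup>+\<omega>. (if avoids Ok m \<omega> then 1 else 0) *
      (\<integral>\<^sup>+x. ennreal (exponential_density \<theta> x) *
        (emeasure M {\<omega>' \<in> space M. (arrival m \<omega> + x, v (Suc m) \<omega>') \<in> Ok} * E (arrival m \<omega> + x)) \<partial>lborel) \<partial>M)"
  proof (rule nn_integral_cong)
    fix \<omega>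
    define t where "t = arrival m \<omega>"
    define G :: "real \<times> real \<Rightarrow> ennreal" where
      "G z = indicator Ok (t + fst z, snd z) * E (t + fst z)" for z
    have G[measurable]: "G \<in> borel_measurable (borel \<Otimes>\<^sub>M borel)"
      unfolding G_def
      by (intro borel_measurable_times_ennreal measurable_compose[OF _ borel_measurable_indicator[OF Ok]]
          measurable_compose[OF _ E]) measurable
    define q where "q x = emeasure M {\<omega>' \<in> space M. (t + x, v (Suc m) \<omega>') \<in> Ok} * E (t + x)" for x
    have inner: "(\<integral>\<^sup>+\<omega>''. G (x, v (Suc m) \<omega>'') \<partial>M) = q x" for x
    proof -
      have "(\<integral>\<^sup>+\<omega>''. G (x, v (Suc m) \<omega>'') \<partial>M) =
          (\<integral>\<^sup>+\<omega>''. indicator {\<omega>' \<in> space M. (t + x, v (Suc m) \<omega>') \<in> Ok} \<omega>'' * E (t + x) \<partial>M)"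
        by (intro nn_integral_cong) (auto simp: G_def indicator_def)
      also have "\<dots> = q x"
        unfolding q_def by (subst nn_integral_multc) auto
      finally show ?thesis .
    qed
    \<comment> \<open>q is the partial integral of G over the law of the mark, so Fubini gives its
      measurability.\<close>
    have qm: "q \<in> borel_measurable borel"
    proof -
      interpret DV: prob_space "distr M borel (v (Suc m))" by (rule prob_space_distr) simp
      have "(\<lambda>x. \<integral>\<^sup>+u. G (x, u) \<partial>distr M borel (v (Suc m))) \<in> borel_measurable borel"
        by measurable
      also have "(\<lambda>x. \<integral>\<^sup>+u. G (x, u) \<partial>distr M borel (v (Suc m))) = q"
        by (rule ext, subst nn_integral_distr) (auto simp: inner)
      finally show ?thesis .
    qed
    have "(\<integral>\<^sup>+\<omega>'. G (s (Suc m) \<omega>', v (Suc m) \<omega>') \<partial>M) = (\<integral>\<^sup>+\<omega>'. q (s (Suc m) \<omega>') \<partial>M)"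
      by (subst nn_integral_indep_var[OF indep_sv G]) (auto simp: inner)
    also have "\<dots> = (\<integral>\<^sup>+x. ennreal (exponential_density \<theta> x) * q x \<partial>lborel)"
      using qm by (intro distributed_nn_integral[OF dist_s, symmetric]) auto
    finally have *: "(\<integral>\<^sup>+\<omega>'. G (s (Suc m) \<omega>', v (Suc m) \<omega>') \<partial>M) =
        (\<integral>\<^sup>+x. ennreal (exponential_density \<theta> x) * q x \<partial>lborel)" .
    have "h ((arrival m \<omega>, if avoids Ok m \<omega> then 1 else 0), (s (Suc m) \<omega>', v (Suc m) \<omega>')) =
        (if avoids Ok m \<omega> then 1 else 0) * G (s (Suc m) \<omega>', v (Suc m) \<omega>')" for \<omega>'
      by (simp add: h_def G_def t_def)
    then show "(\<integral>\<^sup>+\<omega>'. h ((arrival m \<omega>, if avoids Ok m \<omega> then 1 else 0), (s (Suc m) \<omega>', v (Suc m) \<omega>')) \<partial>M) =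
        (if avoids Ok m \<omega> then 1 else 0) * (\<integral>\<^sup>+x. ennreal (exponential_density \<theta> x) *
        (emeasure M {\<omega>' \<in> space M. (arrival m \<omega> + x, v (Suc m) \<omega>') \<in> Ok} * E (arrival m \<omega> + x)) \<partial>lborel)"
      using * by (simp add: nn_integral_cmult q_def t_def)
  qed
  finally show ?thesis .
qed

lemma AE_s_pos: "1 \<le> j \<Longrightarrow> AE \<omega> in M. 0 < s j \<omega>"
proof -
  assume j: "1 \<le> j"
  have "\<P>(\<omega> in M. s j \<omega> \<le> 0) = 0"
    using exponential_distributedD_le[OF dist_s[OF j] _ \<theta>, of 0] by simp
  moreover have [measurable]: "s j \<in> borel_measurable M" by (rule measurable_sv[OF j])
  ultimately have "AE \<omega> in M. \<not> s j \<omega> \<le> 0"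
    by (subst (asm) prob_eq_0) auto
  then show ?thesis by (simp add: not_le)
qed

lemma AE_arrival_nonneg: "AE \<omega> in M. 0 \<le> arrival m \<omega>"
proof -
  have "AE \<omega> in M. \<forall>j\<in>{1..m}. 0 < s j \<omega>"
    by (intro AE_finite_allI AE_s_pos) auto
  then show ?thesis
    by eventually_elim (auto simp: arrival_def intro!: sum_nonneg intro: less_imp_le)
qed

text \<open>A crude bound suffices: an arrival by time \<tau> forces each of the m independent gaps
  to be at most \<tau>.\<close>

lemma prob_arrival_le:
  assumes \<tau>: "0 \<le> \<tau>"
  shows "\<P>(\<omega> in M. arrival m \<omega> \<le> \<tau>) \<le> (1 - exp (- \<tau> * \<theta>)) ^ m"
proof (cases "m = 0")
  case False
  have meas: "s j \<in> borel_measurable M" if "j \<in> {1..m}" for j using that by (intro measurable_sv) auto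
  have "AE \<omega> in M. \<forall>j\<in>{1..m}. 0 < s j \<omega>"
    by (intro AE_finite_allI AE_s_pos) auto
  then have "AE \<omega> in M. arrival m \<omega> \<le> \<tau> \<longrightarrow> (\<forall>j\<in>{1..m}. s j \<omega> \<le> \<tau>)"
  proof eventually_elim
    case (elim \<omega>)
    have "s j \<omega> \<le> arrival m \<omega>" if "j \<in> {1..m}" for j
      unfolding arrival_def using elim that by (intro member_le_sum) (auto intro: less_imp_le)
    then show ?case by force
  qed
  then have "\<P>(\<omega> in M. arrival m \<omega> \<le> \<tau>) \<le> \<P>(\<omega> in M. \<forall>j\<in>{1..m}. s j \<omega> \<le> \<tau>)"
  proof (intro finite_measure_mono_AE)
    show "{\<omega> \<in> space M. \<forall>j\<in>{1..m}. s j \<omega> \<le> \<tau>} \<in> events"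
      using meas by (intro sets.sets_Collect_finite_All borel_measurable_le) auto
  qed auto
  also have "{\<omega> \<in> space M. \<forall>j\<in>{1..m}. s j \<omega> \<le> \<tau>} =
      (\<Inter>q\<in>{1..m} \<times> {False}. (\<lambda>(j, b). if b then v j else s j) q -` {..\<tau>} \<inter> space M)"
    using False by auto
  also have "prob \<dots> = (\<Prod>q\<in>{1..m} \<times> {False}. prob ((\<lambda>(j, b). if b then v j else s j) q -` {..\<tau>} \<inter> space M))"
    using False by (intro indep_varsD[OF indep]) auto
  also have "\<dots> = (\<Prod>q\<in>{1..m} \<times> {False}. 1 - exp (- \<tau> * \<theta>))"
  proof (intro prod.cong refl)
    fix q assume "q \<in> {1..m} \<times> {False}"
    then obtain j where j: "q = (j, False)" "1 \<le> j" by auto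
    have "prob ((\<lambda>(j, b). if b then v j else s j) q -` {..\<tau>} \<inter> space M) = \<P>(\<omega> in M. s j \<omega> \<le> \<tau>)"
      using j by (intro arg_cong[where f = prob]) auto
    then show "prob ((\<lambda>(j, b). if b then v j else s j) q -` {..\<tau>} \<inter> space M) = 1 - exp (- \<tau> * \<theta>)"
      using exponential_distributedD_le[OF dist_s[OF j(2)] \<tau> \<theta>] by simp
  qed
  finally show ?thesis by simp
qed simp

lemma prob_arrival_le_tendsto:
  assumes \<tau>: "0 \<le> \<tau>"
  shows "(\<lambda>m. \<P>(\<omega> in M. arrival m \<omega> \<le> \<tau>)) \<longlonglongrightarrow> 0"
proof (rule Lim_null_comparison)
  show "\<forall>\<^sub>F m in sequentially. norm \<P>(\<omega> in M. arrival m \<omega> \<le> \<tau>) \<le> (1 - exp (- \<tau> * \<theta>)) ^ m"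
    using prob_arrival_le[OF \<tau>] by simp
  have "0 \<le> 1 - exp (- \<tau> * \<theta>)" "1 - exp (- \<tau> * \<theta>) < 1" using \<tau> \<theta> by auto
  then show "(\<lambda>m. (1 - exp (- \<tau> * \<theta>)) ^ m) \<longlonglongrightarrow> 0" by (intro LIMSEQ_power_zero) simp
qed

text \<open>The renewal equation says that the expectation over the next gap and mark reproduces E
  at the current arrival time, which is almost surely nonnegative.\<close>

lemma nn_integral_avoids_martingale:
  fixes E p :: "real \<Rightarrow> real"
  assumes Ok: "Ok \<in> sets (borel \<Otimes>\<^sub>M borel)"
    and okp: "\<And>j t. 1 \<le> j \<Longrightarrow> 0 < t \<Longrightarrow> \<P>(\<omega> in M. (t, v j \<omega>) \<in> Ok) = 1 - p t"
    and K: "finite K" and cont: "continuous_on UNIV E"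
    and E: "\<And>r. 0 \<le> E r" "\<And>r. E r \<le> 1" and p: "\<And>r. p r \<le> 1"
    and pm: "p \<in> borel_measurable borel"
    and deriv: "\<And>r. 0 < r \<Longrightarrow> r \<notin> K \<Longrightarrow> (E has_real_derivative \<theta> * p r * E r) (at r)"
  shows "(\<integral>\<^sup>+\<omega>. (if avoids Ok m \<omega> then 1 else 0) * ennreal (E (arrival m \<omega>)) \<partial>M) = ennreal (E 0)"
proof (induction m)
  case 0
  then show ?case by (simp add: avoids_def arrival_def emeasure_space_1)
next
  case (Suc m)
  have "E \<in> borel_measurable borel" using cont by (rule borel_measurable_continuous_onI)
  then have Em: "(\<lambda>x. ennreal (E x)) \<in> borel_measurable borel" by measurable
  have "AE \<omega> in M. (\<integral>\<^sup>+x. ennreal (exponential_density \<theta> x) *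
        (emeasure M {\<omega>' \<in> space M. (arrival m \<omega> + x, v (Suc m) \<omega>') \<in> Ok} * ennreal (E (arrival m \<omega> + x))) \<partial>lborel)
      = ennreal (E (arrival m \<omega>))"
    using AE_arrival_nonneg[of m]
  proof eventually_elim
    case (elim \<omega>)
    let ?t = "arrival m \<omega>"
    have "(\<integral>\<^sup>+x. ennreal (exponential_density \<theta> x) *
        (emeasure M {\<omega>' \<in> space M. (?t + x, v (Suc m) \<omega>') \<in> Ok} * ennreal (E (?t + x))) \<partial>lborel) =
      (\<integral>\<^sup>+x. ennreal (exponential_density \<theta> x) * ennreal ((1 - p (?t + x)) * E (?t + x)) \<partial>lborel)"
    proof (rule nn_integral_cong_AE)
      show "AE x in lborel. ennreal (exponential_density \<theta> x) *
        (emeasure M {\<omega>' \<in> space M. (?t + x, v (Suc m) \<omega>') \<in> Ok} * ennreal (E (?t + x))) =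
        ennreal (exponential_density \<theta> x) * ennreal ((1 - p (?t + x)) * E (?t + x))"
        \<comment> \<open>For x < 0 the density vanishes, for x > 0 the time is positive and
          \<open>okp\<close> applies; the point x = 0 is dropped as a null set.\<close>
        using AE_lborel_singleton[of "0::real"]
      proof eventually_elim
        case (elim x)
        show ?case
        proof (cases "0 < x")
          case True
          then have "0 < ?t + x" using \<open>0 \<le> ?t\<close> by simp
          with okp[of "Suc m" "?t + x"]
          have "emeasure M {\<omega>' \<in> space M. (?t + x, v (Suc m) \<omega>') \<in> Ok} = ennreal (1 - p (?t + x))"
            by (simp add: emeasure_eq_measure)
          then show ?thesis using p[of "?t + x"] E(1)[of "?t + x"] by (simp add: ennreal_mult)
        next
          case False
          with elim have "exponential_density \<theta> x = 0" by (simp add: exponential_density_def)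
          then show ?thesis by simp
        qed
      qed
    qed
    also have "\<dots> = ennreal (E ?t)"
      by (rule nn_integral_renewal[OF \<theta> K cont E p pm deriv elim])
    finally show ?case .
  qed
  then have "(\<integral>\<^sup>+\<omega>. (if avoids Ok m \<omega> then 1 else 0) *
      (\<integral>\<^sup>+x. ennreal (exponential_density \<theta> x) *
        (emeasure M {\<omega>' \<in> space M. (arrival m \<omega> + x, v (Suc m) \<omega>') \<in> Ok} * ennreal (E (arrival m \<omega> + x))) \<partial>lborel) \<partial>M) =
      (\<integral>\<^sup>+\<omega>. (if avoids Ok m \<omega> then 1 else 0) * ennreal (E (arrival m \<omega>)) \<partial>M)"
    by (intro nn_integral_cong_AE) auto
  then show ?case
    unfolding nn_integral_avoids_Suc[OF Ok Em] using Suc.IH by simp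
qed

text \<open>Beyond \<tau> the function E equals 1, so the martingale differs from the indicator of
  avoidance only if the m-th arrival comes by time \<tau>, an event whose probability tends to
  0.\<close>

lemma prob_avoids_all:
  fixes E p :: "real \<Rightarrow> real"
  assumes Ok: "Ok \<in> sets (borel \<Otimes>\<^sub>M borel)"
    and okp: "\<And>j t. 1 \<le> j \<Longrightarrow> 0 < t \<Longrightarrow> \<P>(\<omega> in M. (t, v j \<omega>) \<in> Ok) = 1 - p t"
    and K: "finite K" and cont: "continuous_on UNIV E"
    and E: "\<And>r. 0 \<le> E r" "\<And>r. E r \<le> 1" and p: "\<And>r. p r \<le> 1"
    and pm: "p \<in> borel_measurable borel"
    and deriv: "\<And>r. 0 < r \<Longrightarrow> r \<notin> K \<Longrightarrow> (E has_real_derivative \<theta> * p r * E r) (at r)"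
    and \<tau>: "0 \<le> \<tau>" "\<And>r. \<tau> \<le> r \<Longrightarrow> E r = 1"
  shows "\<P>(\<omega> in M. \<forall>j\<ge>1. (arrival j \<omega>, v j \<omega>) \<in> Ok) = E 0"
proof (rule LIMSEQ_unique)
  note av[measurable] = pred_avoids[OF Ok]
  have E_m: "E \<in> borel_measurable borel" using cont by (rule borel_measurable_continuous_onI)
  have set_eq: "{\<omega> \<in> space M. \<forall>j\<ge>1. (arrival j \<omega>, v j \<omega>) \<in> Ok} = (\<Inter>m. {\<omega> \<in> space M. avoids Ok m \<omega>})"
    by (auto simp: avoids_def) fastforce
  show "(\<lambda>m. \<P>(\<omega> in M. avoids Ok m \<omega>)) \<longlonglongrightarrow> \<P>(\<omega> in M. \<forall>j\<ge>1. (arrival j \<omega>, v j \<omega>) \<in> Ok)"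
    unfolding set_eq
  proof (rule finite_Lim_measure_decseq)
    show "range (\<lambda>m. {\<omega> \<in> space M. avoids Ok m \<omega>}) \<subseteq> events"
      using av by (auto simp: pred_def)
  qed (auto simp: decseq_def avoids_def)
  have mart: "(\<integral>\<omega>. (if avoids Ok m \<omega> then 1 else 0) * E (arrival m \<omega>) \<partial>M) = E 0" for m
  proof (rule integral_eq_nn_integral[THEN trans])
    show "(\<lambda>\<omega>. (if avoids Ok m \<omega> then 1 else 0) * E (arrival m \<omega>)) \<in> borel_measurable M"
      using E_m by measurable
    have "(\<integral>\<^sup>+\<omega>. ennreal ((if avoids Ok m \<omega> then 1 else 0) * E (arrival m \<omega>)) \<partial>M) =
        (\<integral>\<^sup>+\<omega>. (if avoids Ok m \<omega> then 1 else 0) * ennreal (E (arrival m \<omega>)) \<partial>M)"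
      by (intro nn_integral_cong) simp
    also have "\<dots> = ennreal (E 0)"
      by (rule nn_integral_avoids_martingale[OF Ok okp K cont E p pm deriv])
    finally show "enn2real (\<integral>\<^sup>+\<omega>. ennreal ((if avoids Ok m \<omega> then 1 else 0) * E (arrival m \<omega>)) \<partial>M) = E 0"
      using E(1) by simp
  qed (use E in auto)
  have bound: "\<bar>\<P>(\<omega> in M. avoids Ok m \<omega>) - E 0\<bar> \<le> \<P>(\<omega> in M. arrival m \<omega> \<le> \<tau>)" for m
  proof -
    have int: "integrable M (\<lambda>\<omega>. (if avoids Ok m \<omega> then 1 else 0) * E (arrival m \<omega>))"
      using E E_m by (intro integrable_const_bound[of _ 1]) (auto intro!: AE_I2 simp: abs_le_iff intro: order_trans)
    have i1: "(\<integral>\<omega>. indicat_real {\<omega> \<in> space M. avoids Ok m \<omega>} \<omega> \<partial>M) = \<P>(\<omega> in M. avoids Ok m \<omega>)"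
      and i2: "(\<integral>\<omega>. indicat_real {\<omega> \<in> space M. arrival m \<omega> \<le> \<tau>} \<omega> \<partial>M) = \<P>(\<omega> in M. arrival m \<omega> \<le> \<tau>)"
      by simp_all
    have j1: "integrable M (indicat_real {\<omega> \<in> space M. avoids Ok m \<omega>})"
      and j2: "integrable M (indicat_real {\<omega> \<in> space M. arrival m \<omega> \<le> \<tau>})"
      by (auto intro!: integrable_real_indicator simp: less_top[symmetric])
    have "E 0 \<le> \<P>(\<omega> in M. avoids Ok m \<omega>)"
      unfolding mart[of m, symmetric] i1[symmetric]
      by (intro integral_mono int j1) (use E in auto)
    moreover have "\<P>(\<omega> in M. avoids Ok m \<omega>) \<le> E 0 + \<P>(\<omega> in M. arrival m \<omega> \<le> \<tau>)"
      unfolding mart[of m, symmetric] i1[symmetric] i2[symmetric] Bochner_Integration.integral_add[OF int j2, symmetric]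
      by (intro integral_mono j1 Bochner_Integration.integrable_add int j2)
         (use E \<tau> in \<open>auto simp: indicator_def not_le less_imp_le\<close>)
    ultimately show ?thesis by simp
  qed
  show "(\<lambda>m. \<P>(\<omega> in M. avoids Ok m \<omega>)) \<longlonglongrightarrow> E 0"
  proof (rule LIM_zero_cancel, rule Lim_null_comparison[OF _ prob_arrival_le_tendsto[OF \<tau>(1)]])
    show "\<forall>\<^sub>F m in sequentially. norm (\<P>(\<omega> in M. avoids Ok m \<omega>) - E 0) \<le> \<P>(\<omega> in M. arrival m \<omega> \<le> \<tau>)"
      using bound by simp
  qed
qed

end

section \<open>Void probabilities of staircases\<close>

text \<open>With 0 prepended to the times, the exponent \<open>t 1\<close> in the law of the
  extremal process is an increment like all others.\<close>

definition grid :: "(nat \<Rightarrow> real) \<Rightarrow> nat \<Rightarrow> real" where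
  "grid t l = (if l = 0 then 0 else t l)"

text \<open>Closed in time and open in space, so that avoiding it means exactly that every point up
  to time \<open>t l\<close> has height at least \<open>y l\<close>.\<close>

definition stair :: "nat \<Rightarrow> (nat \<Rightarrow> real) \<Rightarrow> (nat \<Rightarrow> real) \<Rightarrow> (real \<times> real) set" where
  "stair k t y = {(x, u). \<exists>l\<in>{1..k}. x \<le> t l \<and> u < y l}"

text \<open>For increasing nonnegative times and nonnegative heights this is the area of the part of
  the staircase in the quadrant; over a step its height is the maximum of all later bounds.\<close>

definition stair_area :: "nat \<Rightarrow> (nat \<Rightarrow> real) \<Rightarrow> (nat \<Rightarrow> real) \<Rightarrow> real" where
  "stair_area k t y = (\<Sum>l<k. Max (y ` {Suc l..k}) * (grid t (Suc l) - grid t l))"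

lemma sets_stair: "- stair k t y \<in> sets (borel \<Otimes>\<^sub>M borel)"
proof -
  have "stair k t y = (\<Union>l\<in>{1..k}. {..t l} \<times> {..<y l})" by (auto simp: stair_def)
  also have "\<dots> \<in> sets (borel \<Otimes>\<^sub>M borel)" by (intro sets.finite_UN pair_measureI) auto
  finally show ?thesis using sets.compl_sets[of "stair k t y" "borel \<Otimes>\<^sub>M borel"]
    by (simp add: space_pair_measure Compl_eq_Diff_UNIV)
qed

lemma exp_stair_area:
  assumes "1 \<le> k"
  shows "exp (- \<theta> * Max (y ` {1..k})) powr t 1 *
      (\<Prod>i=2..k. exp (- \<theta> * Max (y ` {i..k})) powr (t i - t (i - 1))) = exp (- \<theta> * stair_area k t y)"
proof -
  obtain n where k: "k = Suc n" using assms by (cases k) auto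
  let ?m = "\<lambda>i. Max (y ` {i..k})"
  have "(\<Prod>i=2..k. exp (- \<theta> * ?m i) powr (t i - t (i - 1))) = (\<Prod>i\<in>{2..k}. exp (- \<theta> * (?m i * (t i - t (i - 1)))))"
    by (intro prod.cong refl) (simp add: powr_def algebra_simps)
  also have "\<dots> = (\<Prod>l<n. exp (- \<theta> * (?m (Suc (Suc l)) * (t (Suc (Suc l)) - t (Suc l)))))"
    by (rule prod.reindex_bij_witness[of _ "\<lambda>l. Suc (Suc l)" "\<lambda>i. i - 2"]) (auto simp: k Suc_diff_Suc numeral_2_eq_2)
  also have "\<dots> = exp (\<Sum>l<n. - \<theta> * (?m (Suc (Suc l)) * (t (Suc (Suc l)) - t (Suc l))))"
    by (simp add: exp_sum)
  finally have 1: "(\<Prod>i=2..k. exp (- \<theta> * ?m i) powr (t i - t (i - 1))) = \<dots>" .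
  have "stair_area k t y = ?m 1 * t 1 + (\<Sum>l<n. ?m (Suc (Suc l)) * (t (Suc (Suc l)) - t (Suc l)))"
    unfolding stair_area_def k sum.lessThan_Suc_shift by (simp add: grid_def)
  then have 2: "- \<theta> * stair_area k t y = - \<theta> * ?m 1 * t 1 +
      (\<Sum>l<n. - \<theta> * (?m (Suc (Suc l)) * (t (Suc (Suc l)) - t (Suc l))))"
    by (simp add: algebra_simps sum_distrib_left sum_negf)
  have 3: "exp (- \<theta> * ?m 1) powr t 1 = exp (- \<theta> * ?m 1 * t 1)"
    by (simp add: powr_def mult.commute)
  show ?thesis unfolding 1 2 3 exp_add ..
qed

text \<open>The i-th summand is the length of the part of [i - 1, i] below c.\<close>

lemma sum_clip:
  assumes "0 \<le> (c :: real)"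
  shows "(\<Sum>i=1..I. max 0 (min 1 (c - (real i - 1)))) = min c (real I)"
proof (induction I)
  case (Suc I)
  have "{1..Suc I} = insert (Suc I) {1..I}" by auto
  then show ?case using Suc by auto
qed (use assms in simp)

section \<open>A staircase as seen by a single row of marks\<close>

locale staircase =
  fixes k :: nat and t y :: "nat \<Rightarrow> real"
  assumes t1: "0 \<le> t 1" and t_mono: "\<And>i. i \<in> {1..<k} \<Longrightarrow> t i < t (i + 1)"
    and y_nonneg: "\<And>i. i \<in> {1..k} \<Longrightarrow> 0 \<le> y i"
begin

lemma grid_Suc: "l < k \<Longrightarrow> grid t l \<le> grid t (Suc l)"
  using t1 t_mono[of l] by (auto simp: grid_def)

lemma grid_mono: "l \<le> m \<Longrightarrow> m \<le> k \<Longrightarrow> grid t l \<le> grid t m"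
proof (induction m rule: dec_induct)
  case (step m)
  then show ?case using grid_Suc[of m] by simp
qed simp

lemma grid_nonneg: "l \<le> k \<Longrightarrow> 0 \<le> grid t l"
  using grid_mono[of 0 l] by (simp add: grid_def)

text \<open>\<open>weight i l\<close> is the probability that a mark of row \<open>i\<close>, uniform on \<open>(i - 1, i]\<close>, lies
  below the staircase on its \<open>l\<close>-th step.\<close>

definition weight :: "nat \<Rightarrow> nat \<Rightarrow> real" where
  "weight i l = max 0 (min 1 (Max (y ` {l..k}) - (real i - 1)))"

definition rate :: "nat \<Rightarrow> real \<Rightarrow> real" where
  "rate i r = (\<Sum>l<k. weight i (Suc l) * indicator {grid t l<..grid t (Suc l)} r)"

text \<open>The sum is the integral of \<open>rate i\<close> over the times after r, the maxima
  cutting off what lies before r (for r \<ge> 0). Thus this is the solution of E' = \<theta> p E,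
  with p the rate, that equals 1 after the last step.\<close>

definition survival :: "real \<Rightarrow> nat \<Rightarrow> real \<Rightarrow> real" where
  "survival \<theta> i r = exp (- \<theta> * (\<Sum>l<k. weight i (Suc l) * (max r (grid t (Suc l)) - max r (grid t l))))"

lemma rate_in:
  assumes l: "l < k" "grid t l < r" "r \<le> grid t (Suc l)"
  shows "rate i r = weight i (Suc l)"
proof -
  have "rate i r = (\<Sum>m<k. if m = l then weight i (Suc l) else 0)"
    unfolding rate_def
  proof (intro sum.cong refl)
    fix m assume m: "m \<in> {..<k}"
    consider "m < l" | "m = l" | "l < m" by linarith
    then show "weight i (Suc m) * indicator {grid t m<..grid t (Suc m)} r = (if m = l then weight i (Suc l) else 0)"
    proof cases
      case 1
      then have "grid t (Suc m) \<le> grid t l" using l by (intro grid_mono) auto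
      with 1 l show ?thesis by (simp add: indicator_def)
    next
      case 3
      then have "grid t (Suc l) \<le> grid t m" using m by (intro grid_mono) auto
      with 3 l show ?thesis by (simp add: indicator_def)
    qed (use l in \<open>simp add: indicator_def\<close>)
  qed
  with l show ?thesis by simp
qed

lemma rate_beyond:
  assumes "grid t k < r \<or> r \<le> 0"
  shows "rate i r = 0"
  unfolding rate_def
proof (intro sum.neutral ballI)
  fix l assume "l \<in> {..<k}"
  then have "grid t (Suc l) \<le> grid t k" "0 \<le> grid t l" by (auto intro: grid_mono grid_nonneg)
  with assms show "weight i (Suc l) * indicator {grid t l<..grid t (Suc l)} r = 0"
    by (auto simp: indicator_def)
qed

lemma find_step:
  assumes "0 < r" "r \<le> grid t k"
  obtains l where "l < k" "grid t l < r" "r \<le> grid t (Suc l)"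
proof -
  define m where "m = (LEAST m. r \<le> grid t m)"
  have m: "r \<le> grid t m" "m \<le> k"
    unfolding m_def using assms(2) by (auto intro: LeastI Least_le)
  have "m \<noteq> 0" using m(1) assms(1) by (cases m) (auto simp: grid_def)
  then obtain l where l: "m = Suc l" by (cases m) auto
  then have "\<not> r \<le> grid t l" using not_less_Least[of l "\<lambda>m. r \<le> grid t m"] by (auto simp: m_def)
  with that[of l] m l show thesis by auto
qed

lemma weight_bounds: "0 \<le> weight i l" "weight i l \<le> 1"
  by (auto simp: weight_def)

lemma rate_le_1: "rate i r \<le> 1"
proof (cases "0 < r \<and> r \<le> grid t k")
  case True
  then obtain l where "l < k" "grid t l < r" "r \<le> grid t (Suc l)" using find_step by blast
  then show ?thesis using rate_in weight_bounds by metis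
next
  case False
  then have "rate i r = 0" by (intro rate_beyond) auto
  then show ?thesis by simp
qed

lemma avoid_stair_in:
  assumes l: "l < k" "grid t l < r" "r \<le> grid t (Suc l)"
  shows "(r, u) \<in> - stair k t y \<longleftrightarrow> Max (y ` {Suc l..k}) \<le> u"
proof -
  have "r \<le> t m \<longleftrightarrow> Suc l \<le> m" if "m \<in> {1..k}" for m
  proof -
    have g: "t m = grid t m" using that by (simp add: grid_def)
    show ?thesis
    proof
      assume "r \<le> t m"
      show "Suc l \<le> m"
      proof (rule ccontr)
        assume "\<not> Suc l \<le> m"
        then have "grid t m \<le> grid t l" using l by (intro grid_mono) auto
        with l \<open>r \<le> t m\<close> g show False by simp
      qed
    next
      assume "Suc l \<le> m"
      then have "grid t (Suc l) \<le> grid t m" using that by (intro grid_mono) auto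
      with l g show "r \<le> t m" by simp
    qed
  qed
  then have "(r, u) \<in> - stair k t y \<longleftrightarrow> (\<forall>m\<in>{Suc l..k}. y m \<le> u)"
    by (auto simp: stair_def not_less)
  also have "\<dots> \<longleftrightarrow> Max (y ` {Suc l..k}) \<le> u" using l by (subst Max_le_iff) auto
  finally show ?thesis .
qed

lemma avoid_stair_beyond:
  assumes "grid t k < r"
  shows "(r, u) \<in> - stair k t y"
proof -
  have "\<not> r \<le> t m" if "m \<in> {1..k}" for m
    using grid_mono[of m k] that assms by (auto simp: grid_def)
  then show ?thesis by (auto simp: stair_def)
qed

lemma survival_exponent_nonneg:
  "0 \<le> (\<Sum>l<k. weight i (Suc l) * (max r (grid t (Suc l)) - max r (grid t l)))"
proof (intro sum_nonneg mult_nonneg_nonneg weight_bounds)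
  fix l assume "l \<in> {..<k}"
  with grid_Suc[of l] show "0 \<le> max r (grid t (Suc l)) - max r (grid t l)" by auto
qed

lemma survival_deriv:
  assumes r: "r \<notin> grid t ` {..k}"
  shows "(survival \<theta> i has_real_derivative \<theta> * rate i r * survival \<theta> i r) (at r)"
proof -
  have max_deriv: "((\<lambda>r. max r c) has_real_derivative (if c < r then 1 else 0)) (at r)" if "r \<noteq> c" for c
  proof (cases "c < r")
    case True
    have "((\<lambda>r. r) has_real_derivative 1) (at r)" by (rule DERIV_ident)
    moreover have "\<forall>\<^sub>F x in nhds r. x = max x c"
      using eventually_nhds_in_open[of "{c<..}" r] True by (auto elim!: eventually_mono)
    ultimately have "((\<lambda>r. max r c) has_real_derivative 1) (at r)"
      by (subst (asm) DERIV_cong_ev[OF refl _ refl]) auto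
    with True show ?thesis by simp
  next
    case False
    with that have "r < c" by simp
    have "((\<lambda>_. c) has_real_derivative 0) (at r)" by (rule DERIV_const)
    moreover have "\<forall>\<^sub>F x in nhds r. c = max x c"
      using eventually_nhds_in_open[of "{..<c}" r] \<open>r < c\<close> by (auto elim!: eventually_mono)
    ultimately have "((\<lambda>r. max r c) has_real_derivative 0) (at r)"
      by (subst (asm) DERIV_cong_ev[OF refl _ refl]) auto
    with False show ?thesis by simp
  qed
  have "((\<lambda>r. \<Sum>l<k. weight i (Suc l) * (max r (grid t (Suc l)) - max r (grid t l))) has_real_derivative
      (\<Sum>l<k. weight i (Suc l) * ((if grid t (Suc l) < r then 1 else 0) - (if grid t l < r then 1 else 0)))) (at r)"
    using r by (intro DERIV_sum DERIV_cmult DERIV_diff max_deriv) auto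
  also have "(\<Sum>l<k. weight i (Suc l) * ((if grid t (Suc l) < r then 1 else 0) - (if grid t l < r then 1 else 0))) = - rate i r"
    unfolding rate_def sum_negf[symmetric]
  proof (intro sum.cong refl)
    fix l assume "l \<in> {..<k}"
    with grid_Suc[of l] show "weight i (Suc l) * ((if grid t (Suc l) < r then 1 else 0) - (if grid t l < r then 1 else 0)) =
      - (weight i (Suc l) * indicator {grid t l<..grid t (Suc l)} r)" by (auto simp: indicator_def)
  qed
  finally have "((\<lambda>r. \<Sum>l<k. weight i (Suc l) * (max r (grid t (Suc l)) - max r (grid t l))) has_real_derivative - rate i r) (at r)" .
  from DERIV_fun_exp[OF DERIV_cmult[OF this, of "- \<theta>"]] show ?thesis
    unfolding survival_def by (simp add: mult_ac)
qed

lemma survival_beyond: "grid t k \<le> r \<Longrightarrow> survival \<theta> i r = 1"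
proof -
  assume r: "grid t k \<le> r"
  have "max r (grid t l) = r" if "l \<le> k" for l using grid_mono[of l k] that r by (auto simp: max_def)
  then have "(\<Sum>l<k. weight i (Suc l) * (max r (grid t (Suc l)) - max r (grid t l))) = 0"
    by (intro sum.neutral) auto
  then show ?thesis unfolding survival_def by simp
qed

lemma survival_0: "survival \<theta> i 0 = exp (- \<theta> * (\<Sum>l<k. weight i (Suc l) * (grid t (Suc l) - grid t l)))"
proof -
  have "max 0 (grid t l) = grid t l" if "l \<le> k" for l using grid_nonneg[OF that] by simp
  then have "(\<Sum>l<k. weight i (Suc l) * (max 0 (grid t (Suc l)) - max 0 (grid t l))) =
      (\<Sum>l<k. weight i (Suc l) * (grid t (Suc l) - grid t l))"
    by (intro sum.cong) auto
  then show ?thesis unfolding survival_def by simp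
qed

text \<open>The exponents add over the rows. On each step the bands of the first I rows cover the
  whole height, so by \<open>sum_clip\<close> the weights add up to it.\<close>

lemma prod_survival:
  assumes I: "\<And>l. l \<in> {1..k} \<Longrightarrow> y l \<le> real I"
  shows "(\<Prod>i=1..I. survival \<theta> i 0) = exp (- \<theta> * stair_area k t y)"
proof -
  have "(\<Prod>i=1..I. survival \<theta> i 0) =
      exp (\<Sum>i=1..I. - \<theta> * (\<Sum>l<k. weight i (Suc l) * (grid t (Suc l) - grid t l)))"
    by (simp add: survival_0 exp_sum)
  also have "(\<Sum>i=1..I. - \<theta> * (\<Sum>l<k. weight i (Suc l) * (grid t (Suc l) - grid t l))) =
      - \<theta> * (\<Sum>l<k. (\<Sum>i=1..I. weight i (Suc l)) * (grid t (Suc l) - grid t l))"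
    unfolding sum_distrib_left[symmetric] sum_distrib_right by (subst sum.swap) simp
  also have "(\<Sum>l<k. (\<Sum>i=1..I. weight i (Suc l)) * (grid t (Suc l) - grid t l)) = stair_area k t y"
    unfolding stair_area_def
  proof (intro sum.cong refl arg_cong2[where f = "(*)"])
    fix l assume l: "l \<in> {..<k}"
    then have "Max (y ` {Suc l..k}) \<in> y ` {Suc l..k}" by (intro Max_in) auto
    then obtain m where m: "m \<in> {Suc l..k}" "Max (y ` {Suc l..k}) = y m" by auto
    then show "(\<Sum>i=1..I. weight i (Suc l)) = Max (y ` {Suc l..k})"
      unfolding weight_def using y_nonneg[of m] I[of m] by (subst sum_clip) auto
  qed
  finally show ?thesis .
qed

end

section \<open>Arrays of independent rows\<close>

lemma (in prob_space) indep_vars_reindex_inj: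
  assumes inj: "inj_on h I" and ind: "indep_vars M' X (h ` I)"
  shows "indep_vars (\<lambda>i. M' (h i)) (\<lambda>i. X (h i)) I"
  unfolding indep_vars_def2
proof (intro conjI ballI)
  let ?F = "\<lambda>q. {X q -` A \<inter> space M | A. A \<in> sets (M' q)}"
  show rv: "random_variable (M' (h i)) (X (h i))" if "i \<in> I" for i
    using ind that by (auto simp: indep_vars_def2)
  have F: "indep_sets ?F (h ` I)" using ind by (auto simp: indep_vars_def2)
  show "indep_sets (\<lambda>i. ?F (h i)) I"
  proof (rule indep_setsI)
    show "?F (h i) \<subseteq> events" if "i \<in> I" for i
      using measurable_sets[OF rv[OF that]] by auto
    fix A J assume J: "J \<noteq> {}" "J \<subseteq> I" "finite J" and A: "\<forall>j\<in>J. A j \<in> ?F (h j)"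
    define A' where "A' q = A (the_inv_into I h q)" for q
    have A': "A' (h j) = A j" if "j \<in> J" for j
      using J inj that by (auto simp: A'_def the_inv_into_f_f)
    have "prob (\<Inter>q\<in>h ` J. A' q) = (\<Prod>q\<in>h ` J. prob (A' q))"
      using J A A' by (intro indep_setsD[OF F]) auto
    also have "\<dots> = (\<Prod>j\<in>J. prob (A j))"
      using J inj A' by (subst prod.reindex) (auto intro: inj_on_subset)
    finally show "prob (\<Inter>j\<in>J. A j) = (\<Prod>j\<in>J. prob (A j))"
      using A' by (simp add: image_image cong: INF_cong)
  qed
qed

locale marked_array = prob_space M for M :: "'b measure" +
  fixes S U :: "nat \<Rightarrow> nat \<Rightarrow> 'b \<Rightarrow> real" and \<theta> :: real
  assumes \<theta>: "0 < \<theta>"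
    and indep: "indep_vars (\<lambda>_. borel) (\<lambda>(i, j, b). if b then U i j else S i j) ({1..} \<times> {1..} \<times> UNIV)"
    and dist_S: "\<And>i j. 1 \<le> i \<Longrightarrow> 1 \<le> j \<Longrightarrow> distributed M lborel (S i j) (exponential_density \<theta>)"
    and dist_U: "\<And>i j. 1 \<le> i \<Longrightarrow> 1 \<le> j \<Longrightarrow>
      distr M lborel (U i j) = uniform_measure lborel {real i - 1<..real i}"
begin

definition arr :: "nat \<Rightarrow> nat \<Rightarrow> 'b \<Rightarrow> real" where
  "arr i j \<omega> = (\<Sum>m=1..j. S i m \<omega>)"

lemma row: "1 \<le> i \<Longrightarrow> marked_renewal M (S i) (U i) \<theta>"
proof (unfold_locales, rule \<theta>)
  assume i: "1 \<le> i"
  let ?h = "\<lambda>(j, b :: bool). (i, j :: nat, b)"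
  have "indep_vars (\<lambda>_. borel) (\<lambda>(i, j, b). if b then U i j else S i j) (?h ` ({1..} \<times> UNIV))"
    using i by (intro indep_vars_subset[OF indep]) auto
  moreover have "inj_on ?h ({1..} \<times> UNIV)" by (auto simp: inj_on_def)
  ultimately have *: "indep_vars (\<lambda>q. borel) (\<lambda>q. (\<lambda>(i, j, b). if b then U i j else S i j) (?h q)) ({1..} \<times> UNIV)"
    by (rule indep_vars_reindex_inj[rotated])
  have eq: "(\<lambda>q. (\<lambda>(i, j, b). if b then U i j else S i j) (?h q)) = (\<lambda>(j, b). if b then U i j else S i j)"
    by (auto simp: fun_eq_iff)
  show "indep_vars (\<lambda>_. borel) (\<lambda>(j, b). if b then U i j else S i j) ({1..} \<times> UNIV)"
    using * unfolding eq .
qed (rule dist_S)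

lemma arrival_row: "1 \<le> i \<Longrightarrow> marked_renewal.arrival (S i) = arr i"
  by (simp add: marked_renewal.arrival_def[OF row] arr_def fun_eq_iff)

lemma measurable_U: "1 \<le> i \<Longrightarrow> 1 \<le> j \<Longrightarrow> U i j \<in> borel_measurable M"
  using marked_renewal.measurable_sv(2)[OF row] .

lemma measurable_arr: "1 \<le> i \<Longrightarrow> arr i j \<in> borel_measurable M"
  using marked_renewal.measurable_arrival[OF row] by (simp add: arrival_row)

lemma prob_U_ge:
  assumes ij: "1 \<le> i" "1 \<le> j"
  shows "\<P>(\<omega> in M. c \<le> U i j \<omega>) = 1 - max 0 (min 1 (c - (real i - 1)))"
proof -
  note [measurable] = measurable_U[OF ij]
  let ?I = "{real i - 1<..real i}"
  have "\<P>(\<omega> in M. c \<le> U i j \<omega>) = measure (distr M lborel (U i j)) {c..}"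
    by (subst measure_distr) (auto intro!: arg_cong[where f = prob])
  also have "\<dots> = measure lborel (?I \<inter> {c..}) / measure lborel ?I"
    unfolding dist_U[OF ij] by (rule measure_uniform_measure) auto
  also have "?I \<inter> {c..} = (if c \<le> real i - 1 then ?I else {c..real i})" by auto
  also have "measure lborel \<dots> / measure lborel ?I = 1 - max 0 (min 1 (c - (real i - 1)))"
    by (auto simp: max_def min_def)
  finally show ?thesis .
qed

lemma AE_U_ge: "1 \<le> i \<Longrightarrow> 1 \<le> j \<Longrightarrow> AE \<omega> in M. real i - 1 \<le> U i j \<omega>"
proof -
  assume ij: "1 \<le> i" "1 \<le> j"
  note [measurable] = measurable_U[OF ij]
  have "\<P>(\<omega> in M. real i - 1 \<le> U i j \<omega>) = 1" using prob_U_ge[OF ij, of "real i - 1"] by simp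
  then show ?thesis by (subst (asm) prob_eq_1) (auto elim: AE_mp)
qed

lemma AE_U_nonneg: "1 \<le> i \<Longrightarrow> 1 \<le> j \<Longrightarrow> AE \<omega> in M. 0 \<le> U i j \<omega>"
  using AE_U_ge[of i j] by (auto elim!: eventually_mono)

lemma prob_row_avoids:
  assumes i: "1 \<le> i" and st: "staircase k t y"
  shows "\<P>(\<omega> in M. \<forall>j\<ge>1. (arr i j \<omega>, U i j \<omega>) \<in> - stair k t y) = staircase.survival k t y \<theta> i 0"
proof -
  interpret staircase k t y by fact
  interpret r: marked_renewal M "S i" "U i" \<theta> by (rule row[OF i])
  have okp: "\<P>(\<omega> in M. (r, U i j \<omega>) \<in> - stair k t y) = 1 - rate i r" if j: "1 \<le> j" and r: "0 < r" for j r
  proof (cases "r \<le> grid t k")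
    case True
    then obtain l where l: "l < k" "grid t l < r" "r \<le> grid t (Suc l)" using find_step r by blast
    show ?thesis
      unfolding avoid_stair_in[OF l] prob_U_ge[OF i j] rate_in[OF l] weight_def ..
  next
    case False
    then have *: "(r, u) \<in> - stair k t y" for u by (intro avoid_stair_beyond) auto
    have "{\<omega> \<in> space M. (r, U i j \<omega>) \<in> - stair k t y} = space M" using * by blast
    then show ?thesis using False by (simp add: rate_beyond prob_space)
  qed
  have "\<P>(\<omega> in M. \<forall>j\<ge>1. (r.arrival j \<omega>, U i j \<omega>) \<in> - stair k t y) = survival \<theta> i 0"
  proof (rule r.prob_avoids_all[OF sets_stair okp, where K = "grid t ` {..k}" and \<tau> = "grid t k"])
    show "continuous_on UNIV (survival \<theta> i)"
      unfolding survival_def by (intro continuous_intros)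
    show "survival \<theta> i r \<le> 1" for r
      using survival_exponent_nonneg[of i r] \<theta> by (simp add: survival_def)
    show "rate i \<in> borel_measurable borel" unfolding rate_def by measurable
    show "0 \<le> survival \<theta> i r" for r by (simp add: survival_def)
  qed (auto intro: rate_le_1 survival_deriv survival_beyond grid_nonneg)
  then show ?thesis by (simp only: arrival_row[OF i])
qed

text \<open>The event of row i is measurable with respect to the block of indices of that row, and
  these blocks are disjoint.\<close>

lemma prob_rows_avoid:
  assumes I: "1 \<le> I" and st: "staircase k t y"
  shows "\<P>(\<omega> in M. \<forall>i\<in>{1..I}. \<forall>j\<ge>1. (arr i j \<omega>, U i j \<omega>) \<in> - stair k t y) =
    (\<Prod>i=1..I. \<P>(\<omega> in M. \<forall>j\<ge>1. (arr i j \<omega>, U i j \<omega>) \<in> - stair k t y))"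
proof -
  let ?K = "\<lambda>i :: nat. {i} \<times> {1::nat..} \<times> (UNIV :: bool set)"
  let ?X = "\<lambda>(i, j, b). if b then U i j else S i j"
  define B where "B i = {x \<in> space (PiM (?K i) (\<lambda>_. borel)).
      \<forall>j\<ge>1. (\<Sum>m=1..j. x (i, m, False), x (i, j, True) :: real) \<in> - stair k t y}" for i :: nat
  have ind: "indep_vars (\<lambda>i. PiM (?K i) (\<lambda>_. borel)) (\<lambda>i \<omega>. restrict (\<lambda>q. ?X q \<omega>) (?K i)) {1..I}"
    by (rule indep_vars_restrict[OF indep]) (auto simp: disjoint_family_on_def)
  have comp: "(\<lambda>x. x (i, l, b) :: real) \<in> borel_measurable (PiM (?K i) (\<lambda>_. borel))" if "1 \<le> l" for i l b
    using that by (intro measurable_component_singleton) auto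
  have pj: "Measurable.pred (PiM (?K i) (\<lambda>_. borel))
      (\<lambda>x. 1 \<le> j \<longrightarrow> (\<Sum>m=1..j. x (i, m, False), x (i, j, True) :: real) \<in> - stair k t y)" for i j
  proof (cases "1 \<le> j")
    case True
    then have "Measurable.pred (PiM (?K i) (\<lambda>_. borel))
      (\<lambda>x. (\<Sum>m=1..j. x (i, m, False), x (i, j, True) :: real) \<in> - stair k t y)"
      by (intro pred_sets2[OF sets_stair] measurable_Pair borel_measurable_sum comp) auto
    with True show ?thesis by simp
  qed simp
  have "Measurable.pred (PiM (?K i) (\<lambda>_. borel))
      (\<lambda>x. \<forall>j\<ge>1. (\<Sum>m=1..j. x (i, m, False), x (i, j, True) :: real) \<in> - stair k t y)" for i
    by (intro pred_intros_countable pj)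
  then have B: "B i \<in> sets (PiM (?K i) (\<lambda>_. borel))" for i
    unfolding B_def pred_def .
  have ev: "(\<lambda>\<omega>. restrict (\<lambda>q. ?X q \<omega>) (?K i)) -` B i \<inter> space M =
      {\<omega> \<in> space M. \<forall>j\<ge>1. (arr i j \<omega>, U i j \<omega>) \<in> - stair k t y}" for i
  proof -
    have "restrict (\<lambda>q. ?X q \<omega>) (?K i) \<in> B i \<longleftrightarrow> (\<forall>j\<ge>1. (arr i j \<omega>, U i j \<omega>) \<in> - stair k t y)" for \<omega>
    proof -
      define x where "x = restrict (\<lambda>q. ?X q \<omega>) (?K i)"
      have s: "(\<Sum>m=1..j. x (i, m, False)) = arr i j \<omega>" for j
        unfolding arr_def x_def by (intro sum.cong) auto
      have u: "x (i, j, True) = U i j \<omega>" if "1 \<le> j" for j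
        using that by (auto simp: x_def)
      have "x \<in> space (PiM (?K i) (\<lambda>_. borel))"
        by (auto simp: space_PiM x_def)
      then have "x \<in> B i \<longleftrightarrow> (\<forall>j\<ge>1. (arr i j \<omega>, U i j \<omega>) \<in> - stair k t y)"
        unfolding B_def mem_Collect_eq s using u by auto
      then show ?thesis unfolding x_def .
    qed
    then show ?thesis by blast
  qed
  have "{\<omega> \<in> space M. \<forall>i\<in>{1..I}. \<forall>j\<ge>1. (arr i j \<omega>, U i j \<omega>) \<in> - stair k t y} =
      (\<Inter>i\<in>{1..I}. (\<lambda>\<omega>. restrict (\<lambda>q. ?X q \<omega>) (?K i)) -` B i \<inter> space M)"
    unfolding ev using I by auto
  also have "prob \<dots> = (\<Prod>i=1..I. prob ((\<lambda>\<omega>. restrict (\<lambda>q. ?X q \<omega>) (?K i)) -` B i \<inter> space M))"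
    using I B by (intro indep_varsD[OF ind]) auto
  finally show ?thesis unfolding ev .
qed

lemma pred_avoid:
  assumes "1 \<le> i" "1 \<le> j"
  shows "Measurable.pred M (\<lambda>\<omega>. (arr i j \<omega>, U i j \<omega>) \<in> - stair k t y)"
  using assms by (intro pred_sets2[OF sets_stair] measurable_Pair measurable_arr measurable_U)

lemma sets_avoid: "{\<omega> \<in> space M. \<forall>i\<ge>1. \<forall>j\<ge>1. (arr i j \<omega>, U i j \<omega>) \<in> - stair k t y} \<in> sets M"
proof -
  have pij: "Measurable.pred M (\<lambda>\<omega>. 1 \<le> i \<longrightarrow> 1 \<le> j \<longrightarrow> (arr i j \<omega>, U i j \<omega>) \<in> - stair k t y)" for i j
    using pred_avoid[of i j] by (cases "1 \<le> i \<and> 1 \<le> j") auto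
  have "Measurable.pred M (\<lambda>\<omega>. \<forall>i j. 1 \<le> i \<longrightarrow> 1 \<le> j \<longrightarrow> (arr i j \<omega>, U i j \<omega>) \<in> - stair k t y)"
    by (intro pred_intros_countable pij)
  also have "(\<lambda>\<omega>. \<forall>i j. 1 \<le> i \<longrightarrow> 1 \<le> j \<longrightarrow> (arr i j \<omega>, U i j \<omega>) \<in> - stair k t y) =
      (\<lambda>\<omega>. \<forall>i\<ge>1. \<forall>j\<ge>1. (arr i j \<omega>, U i j \<omega>) \<in> - stair k t y)" by auto
  finally show ?thesis unfolding pred_def .
qed

lemma sets_avoid_rows:
  "{\<omega> \<in> space M. \<forall>i\<in>{1..I}. \<forall>j\<ge>1. (arr i j \<omega>, U i j \<omega>) \<in> - stair k t y} \<in> sets M"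
proof -
  have pij: "Measurable.pred M (\<lambda>\<omega>. 1 \<le> j \<longrightarrow> (arr i j \<omega>, U i j \<omega>) \<in> - stair k t y)" if "i \<in> {1..I}" for i j
    using pred_avoid[of i j] that by (cases "1 \<le> j") auto
  have "Measurable.pred M (\<lambda>\<omega>. \<forall>i\<in>{1..I}. \<forall>j. 1 \<le> j \<longrightarrow> (arr i j \<omega>, U i j \<omega>) \<in> - stair k t y)"
    by (intro pred_intros_finite pred_intros_countable pij) auto
  then show ?thesis unfolding pred_def .
qed

text \<open>Marks of row i are almost surely at least i - 1, so rows above the largest height cannot
  reach the staircase, and the infinite array reduces to a finite product.\<close>

lemma prob_avoid:
  assumes st: "staircase k t y"
  shows "\<P>(\<omega> in M. \<forall>i\<ge>1. \<forall>j\<ge>1. (arr i j \<omega>, U i j \<omega>) \<in> - stair k t y) = exp (- \<theta> * stair_area k t y)"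
proof -
  interpret staircase k t y by fact
  obtain I0 where I0: "Max (insert 0 (y ` {1..k})) \<le> real I0" using real_arch_simple by blast
  define I where "I = Suc I0"
  have I: "1 \<le> I" "\<And>l. l \<in> {1..k} \<Longrightarrow> y l \<le> real I"
  proof -
    fix l assume "l \<in> {1..k}"
    then have "y l \<le> Max (insert 0 (y ` {1..k}))" by (intro Max_ge) auto
    then show "y l \<le> real I" using I0 unfolding I_def by linarith
  qed (simp add: I_def)
  have "AE \<omega> in M. \<forall>i. \<forall>j. 1 \<le> i \<longrightarrow> 1 \<le> j \<longrightarrow> real i - 1 \<le> U i j \<omega>"
    unfolding AE_all_countable using AE_U_ge by auto
  then have "AE \<omega> in M. (\<forall>i\<ge>1. \<forall>j\<ge>1. (arr i j \<omega>, U i j \<omega>) \<in> - stair k t y) \<longleftrightarrow>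
      (\<forall>i\<in>{1..I}. \<forall>j\<ge>1. (arr i j \<omega>, U i j \<omega>) \<in> - stair k t y)"
  proof eventually_elim
    case (elim \<omega>)
    have "(arr i j \<omega>, U i j \<omega>) \<in> - stair k t y" if ij: "1 \<le> i" "1 \<le> j" "I < i" for i j
    proof -
      have "real I \<le> real i - 1" using ij by linarith
      then have "real I \<le> U i j \<omega>" using elim ij by (meson order_trans)
      then show ?thesis using I(2) by (force simp: stair_def)
    qed
    then show ?case by (meson atLeastAtMost_iff not_le)
  qed
  then have "\<P>(\<omega> in M. \<forall>i\<ge>1. \<forall>j\<ge>1. (arr i j \<omega>, U i j \<omega>) \<in> - stair k t y) =
      \<P>(\<omega> in M. \<forall>i\<in>{1..I}. \<forall>j\<ge>1. (arr i j \<omega>, U i j \<omega>) \<in> - stair k t y)"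
    by (intro measure_eq_AE sets_avoid sets_avoid_rows) auto
  also have "\<dots> = (\<Prod>i=1..I. survival \<theta> i 0)"
    unfolding prob_rows_avoid[OF I(1) st] by (intro prod.cong refl prob_row_avoids st) auto
  also have "\<dots> = exp (- \<theta> * stair_area k t y)" by (rule prod_survival[OF I(2)])
  finally show ?thesis .
qed

end

section \<open>Point processes of Mori--Hsing type\<close>

text \<open>A finite set of indices splits into those of S and those of U. The hypothesis
  \<open>mult\<close> separates the two cylinder events, and each of them factors by the
  independence within its own family.\<close>

lemma (in prob_space) indep_vars_join:
  fixes S U :: "'i \<Rightarrow> 'a \<Rightarrow> real"
  assumes S: "indep_vars (\<lambda>_. borel) S I" and U: "indep_vars (\<lambda>_. borel) U I"
    and mult: "\<And>A B. A \<in> sets (PiM I (\<lambda>_. borel)) \<Longrightarrow> B \<in> sets (PiM I (\<lambda>_. borel)) \<Longrightarrow>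
      prob (((\<lambda>\<omega>. \<lambda>p\<in>I. S p \<omega>) -` A \<inter> space M) \<inter> ((\<lambda>\<omega>. \<lambda>p\<in>I. U p \<omega>) -` B \<inter> space M)) =
      prob ((\<lambda>\<omega>. \<lambda>p\<in>I. S p \<omega>) -` A \<inter> space M) * prob ((\<lambda>\<omega>. \<lambda>p\<in>I. U p \<omega>) -` B \<inter> space M)"
  shows "indep_vars (\<lambda>_. borel) (\<lambda>(p, b). if b then U p else S p) (I \<times> UNIV)"
  unfolding indep_vars_def2
proof (intro conjI ballI)
  let ?V = "\<lambda>(p, b). if b then U p else S p"
  show rv: "random_variable borel (?V q)" if "q \<in> I \<times> UNIV" for q
    using S U that by (auto simp: indep_vars_def2)
  have cyl: "prob {\<omega> \<in> space M. \<forall>p\<in>J. W p \<omega> \<in> C p} = (\<Prod>p\<in>J. prob (W p -` C p \<inter> space M))"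
    if W: "indep_vars (\<lambda>_. borel) W I" and J: "finite J" "J \<subseteq> I" and C: "\<And>p. p \<in> J \<Longrightarrow> C p \<in> sets borel"
    for W :: "'i \<Rightarrow> 'a \<Rightarrow> real" and J C
  proof (cases "J = {}")
    case False
    have "{\<omega> \<in> space M. \<forall>p\<in>J. W p \<omega> \<in> C p} = (\<Inter>p\<in>J. W p -` C p \<inter> space M)" using False by auto
    also have "prob \<dots> = (\<Prod>p\<in>J. prob (W p -` C p \<inter> space M))"
      using False J C by (intro indep_varsD[OF W]) auto
    finally show ?thesis .
  qed (simp add: prob_space)
  show "indep_sets (\<lambda>q. {?V q -` A \<inter> space M | A. A \<in> sets borel}) (I \<times> UNIV)"
  proof (rule indep_setsI)
    show "{?V q -` A \<inter> space M | A. A \<in> sets borel} \<subseteq> events" if "q \<in> I \<times> UNIV" for q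
      using measurable_sets[OF rv[OF that]] by auto
    fix A J
    assume J: "J \<noteq> {}" "J \<subseteq> I \<times> (UNIV :: bool set)" "finite J"
      and A: "\<forall>q\<in>J. A q \<in> {?V q -` A \<inter> space M | A. A \<in> sets borel}"
    from A have "\<forall>q\<in>J. \<exists>C. C \<in> sets borel \<and> A q = ?V q -` C \<inter> space M" by blast
    from bchoice[OF this] obtain C where
      C': "\<forall>q\<in>J. C q \<in> sets borel \<and> A q = ?V q -` C q \<inter> space M" by blast
    have C: "C q \<in> sets borel" "A q = ?V q -` C q \<inter> space M" if "q \<in> J" for q
      using bspec[OF C' that] by blast+
    define JS where "JS = {p. (p, False) \<in> J}"
    define JU where "JU = {p. (p, True) \<in> J}"
    have JSU: "J = (\<lambda>p. (p, False)) ` JS \<union> (\<lambda>p. (p, True)) ` JU"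
      by (auto simp: JS_def JU_def image_iff split: prod.splits) (metis (full_types))+
    have fin: "finite JS" "finite JU"
      using J(3) unfolding JSU by (auto dest: finite_imageD simp: inj_on_def)
    have sub: "JS \<subseteq> I" "JU \<subseteq> I" using J(2) by (auto simp: JS_def JU_def)
    let ?CS = "{x \<in> space (PiM I (\<lambda>_. borel)). \<forall>p\<in>JS. x p \<in> C (p, False)}"
    let ?CU = "{x \<in> space (PiM I (\<lambda>_. borel)). \<forall>p\<in>JU. x p \<in> C (p, True)}"
    have CS: "?CS \<in> sets (PiM I (\<lambda>_. borel))" and CU: "?CU \<in> sets (PiM I (\<lambda>_. borel))"
    proof -
      have CJ: "C (p, False) \<in> sets borel" if "p \<in> JS" for p using C(1) that by (auto simp: JS_def)
      have CJ': "C (p, True) \<in> sets borel" if "p \<in> JU" for p using C(1) that by (auto simp: JU_def)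
      have comp: "(\<lambda>x. x p) \<in> borel_measurable (PiM I (\<lambda>_. borel :: real measure))" if "p \<in> I" for p
        using that by (rule measurable_component_singleton)
      show "?CS \<in> sets (PiM I (\<lambda>_. borel))"
        by (intro sets.sets_Collect_finite_All fin measurable_sets_Collect[OF comp] subsetD[OF sub(1)])
           (auto simp: pred_def CJ)
      show "?CU \<in> sets (PiM I (\<lambda>_. borel))"
        by (intro sets.sets_Collect_finite_All fin measurable_sets_Collect[OF comp] subsetD[OF sub(2)])
           (auto simp: pred_def CJ')
    qed
    have ES: "(\<lambda>\<omega>. \<lambda>p\<in>I. S p \<omega>) -` ?CS \<inter> space M = {\<omega> \<in> space M. \<forall>p\<in>JS. S p \<omega> \<in> C (p, False)}"
      and EU: "(\<lambda>\<omega>. \<lambda>p\<in>I. U p \<omega>) -` ?CU \<inter> space M = {\<omega> \<in> space M. \<forall>p\<in>JU. U p \<omega> \<in> C (p, True)}"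
      using sub by (auto simp: space_PiM)
    have "(\<Inter>q\<in>J. A q) = (\<Inter>q\<in>J. ?V q -` C q \<inter> space M)" using C(2) by auto
    also have "\<dots> = {\<omega> \<in> space M. \<forall>p\<in>JS. S p \<omega> \<in> C (p, False)} \<inter> {\<omega> \<in> space M. \<forall>p\<in>JU. U p \<omega> \<in> C (p, True)}"
    proof -
      have "(\<Inter>q\<in>J. ?V q -` C q \<inter> space M) = {\<omega> \<in> space M. \<forall>q\<in>J. ?V q \<omega> \<in> C q}"
        using J(1) by auto
      moreover have "(\<forall>q\<in>J. ?V q \<omega> \<in> C q) \<longleftrightarrow>
          (\<forall>p\<in>JS. S p \<omega> \<in> C (p, False)) \<and> (\<forall>p\<in>JU. U p \<omega> \<in> C (p, True))" for \<omega>
        unfolding JSU by (simp add: ball_Un)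
      ultimately show ?thesis by auto
    qed
    finally have "prob (\<Inter>q\<in>J. A q) =
        prob {\<omega> \<in> space M. \<forall>p\<in>JS. S p \<omega> \<in> C (p, False)} * prob {\<omega> \<in> space M. \<forall>p\<in>JU. U p \<omega> \<in> C (p, True)}"
      using mult[OF CS CU] unfolding ES EU by simp
    also have "\<dots> = (\<Prod>p\<in>JS. prob (S p -` C (p, False) \<inter> space M)) * (\<Prod>p\<in>JU. prob (U p -` C (p, True) \<inter> space M))"
      using C(1) by (intro arg_cong2[where f = "(*)"] cyl S U fin sub) (auto simp: JS_def JU_def)
    also have "\<dots> = (\<Prod>q\<in>(\<lambda>p. (p, False)) ` JS. prob (A q)) * (\<Prod>q\<in>(\<lambda>p. (p, True)) ` JU. prob (A q))"
      by (subst (1 2) prod.reindex) (auto simp: inj_on_def JS_def JU_def C(2) intro!: arg_cong2[where f = "(*)"] prod.cong)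
    also have "\<dots> = (\<Prod>q\<in>J. prob (A q))"
      unfolding JSU using fin by (intro prod.union_disjoint[symmetric]) auto
    finally show "prob (\<Inter>q\<in>J. A q) = (\<Prod>q\<in>J. prob (A q))" .
  qed
qed

lemma emeasure_point_measure:
  assumes x: "x ` J \<subseteq> E" and A: "A \<in> sets (restrict_space borel E)"
  shows "emeasure (point_measure E J x) A = emeasure (count_space J) {j \<in> J. x j \<in> A}"
proof -
  have "x \<in> count_space J \<rightarrow>\<^sub>M restrict_space borel E"
    using x by (auto simp: measurable_count_space_eq1 space_restrict_space)
  then show ?thesis
    unfolding point_measure_def using A
    by (subst emeasure_distr) (auto intro!: arg_cong2[where f = emeasure])
qed

lemma point_measure_null_iff:
  assumes "x ` J \<subseteq> E" and "A \<in> sets (restrict_space borel E)"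
  shows "emeasure (point_measure E J x) A = 0 \<longleftrightarrow> (\<forall>j\<in>J. x j \<notin> A)"
  unfolding emeasure_point_measure[OF assms]
  by (subst emeasure_count_space_eq_0) auto

lemma sets_stair_quadrant: "stair k t y \<inter> quadrant \<in> sets (restrict_space borel quadrant)"
proof -
  have "stair k t y \<in> sets borel"
    using sets.compl_sets[OF sets_stair[of k t y, unfolded borel_prod]]
    by (simp add: Compl_eq_Diff_UNIV double_diff)
  then show ?thesis by (auto simp: sets_restrict_space Int_commute)
qed

text \<open>The atom at 1 makes (T, U) itself a point of N, and every other point of the cluster has
  the same time and a height U Y \<ge> U; a staircase is closed under lowering the height. This
  rests on U being nonnegative, which holds almost surely.\<close>

lemma mori_hsing_marked_array:
  assumes R: "prob_space R" and \<theta>: "0 < \<theta>" and N: "mori_hsing_type R \<theta> N"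
  obtains S U where "marked_array R S U \<theta>"
    "\<And>k t y. AE \<omega> in R. emeasure (N \<omega>) (stair k t y \<inter> quadrant) = 0 \<longleftrightarrow>
       (\<forall>i\<ge>1. \<forall>j\<ge>1. ((\<Sum>m=1..j. S i m \<omega>), U i j \<omega>) \<in> - stair k t y)"
proof -
  interpret prob_space R by fact
  let ?G = "\<lambda>K Y i j \<omega>. point_measure {1 :: real..} {k. 1 \<le> k \<and> enat k \<le> K i j \<omega>} (\<lambda>k. Y i j k \<omega>)"
  let ?B = "borel_of (vague_topology {1 :: real..})"
  obtain S U :: "nat \<Rightarrow> nat \<Rightarrow> 'a \<Rightarrow> real" and K :: "nat \<Rightarrow> nat \<Rightarrow> 'a \<Rightarrow> enat"
    and Y :: "nat \<Rightarrow> nat \<Rightarrow> nat \<Rightarrow> 'a \<Rightarrow> real" where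
    S: "indep_vars (\<lambda>_. borel) (\<lambda>(i, j). S i j) pos_pairs"
    and dS: "\<forall>i\<ge>1. \<forall>j\<ge>1. distributed R lborel (S i j) (exponential_density \<theta>)"
    and U: "indep_vars (\<lambda>_. borel) (\<lambda>(i, j). U i j) pos_pairs"
    and dU: "\<forall>i\<ge>1. \<forall>j\<ge>1. distr R lborel (U i j) = uniform_measure lborel {real i - 1<..real i}"
    and Y1: "\<forall>i\<ge>1. \<forall>j\<ge>1. \<forall>k\<ge>1. \<forall>\<omega>\<in>space R. enat k \<le> K i j \<omega> \<longrightarrow> 1 \<le> Y i j k \<omega>"
    and atom: "\<forall>i\<ge>1. \<forall>j\<ge>1. ?G K Y i j \<in> R \<rightarrow>\<^sub>M ?B \<and> distr R ?B (?G K Y i j) = distr R ?B (?G K Y 1 1) \<and>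
      (AE \<omega> in R. 1 \<le> emeasure (?G K Y i j \<omega>) {1})"
    and arrays: "\<forall>k\<ge>1. indep_vars (\<lambda>_. Pi\<^sub>M pos_pairs (\<lambda>_. borel))
          (\<lambda>a \<omega>. \<lambda>(i, j)\<in>pos_pairs.
             [S i j \<omega>, U i j \<omega>, if enat k \<le> K i j \<omega> then Y i j k \<omega> else 0] ! a) {..<3 :: nat}"
    and Neq: "AE \<omega> in R. N \<omega> =
          point_measure quadrant {(i, j, k). 1 \<le> i \<and> 1 \<le> j \<and> 1 \<le> k \<and> enat k \<le> K i j \<omega>}
            (\<lambda>(i, j, k). (\<Sum>m=1..j. S i m \<omega>, U i j \<omega> * Y i j k \<omega>))"
    using N unfolding mori_hsing_type_def Let_def by (elim conjE exE) (rule that; assumption)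
  have J1: "indep_vars (\<lambda>_. borel) (\<lambda>(p, b). if b then (case p of (i, j) \<Rightarrow> U i j) else (case p of (i, j) \<Rightarrow> S i j)) (pos_pairs \<times> UNIV)"
  proof (rule indep_vars_join[OF S U])
    fix A B :: "(nat \<times> nat \<Rightarrow> real) set"
    assume A: "A \<in> sets (PiM pos_pairs (\<lambda>_. borel))" and B: "B \<in> sets (PiM pos_pairs (\<lambda>_. borel))"
    let ?S = "\<lambda>\<omega>. \<lambda>p\<in>pos_pairs. (case p of (i, j) \<Rightarrow> S i j) \<omega>"
    let ?U = "\<lambda>\<omega>. \<lambda>p\<in>pos_pairs. (case p of (i, j) \<Rightarrow> U i j) \<omega>"
    \<comment> \<open>The instance k = 1 of the independence requirement; its components 0 and 1 are
      the arrays S and U.\<close>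
    let ?X = "\<lambda>a \<omega>. \<lambda>(i, j)\<in>pos_pairs. [S i j \<omega>, U i j \<omega>, if enat 1 \<le> K i j \<omega> then Y i j 1 \<omega> else 0] ! a"
    have X: "?X 0 = ?S" "?X (Suc 0) = ?U" by (auto simp: fun_eq_iff restrict_def)
    have "prob (\<Inter>a\<in>{0, Suc 0}. ?X a -` (if a = 0 then A else B) \<inter> space R) =
        (\<Prod>a\<in>{0, Suc 0}. prob (?X a -` (if a = 0 then A else B) \<inter> space R))"
      using A B by (intro indep_varsD[OF arrays[rule_format, OF order_refl]]) auto
    then show "prob ((?S -` A \<inter> space R) \<inter> (?U -` B \<inter> space R)) = prob (?S -` A \<inter> space R) * prob (?U -` B \<inter> space R)"
      by (simp only: X image_insert image_empty Inter_insert Inter_empty if_True if_False refl nat.distinct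
          prod.insert finite.intros prod.empty insert_iff empty_iff simp_thms Int_UNIV_right mult_1_right not_False_eq_True)
  qed
  have J2: "(\<lambda>(i, j, b). ((i, j), b)) ` ({1..} \<times> {1..} \<times> UNIV) = pos_pairs \<times> UNIV"
    by (auto simp: image_iff)
  have inj: "inj_on (\<lambda>(i :: nat, j :: nat, b :: bool). ((i, j), b)) ({1..} \<times> {1..} \<times> UNIV)"
    by (auto simp: inj_on_def)
  have *: "indep_vars (\<lambda>_. borel) (\<lambda>q. (\<lambda>(p, b). if b then (case p of (i, j) \<Rightarrow> U i j) else (case p of (i, j) \<Rightarrow> S i j))
      ((\<lambda>(i, j, b). ((i, j), b)) q)) ({1..} \<times> {1..} \<times> UNIV)"
    by (rule indep_vars_reindex_inj[OF inj]) (use J1 in \<open>simp only: J2\<close>)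
  have eq: "(\<lambda>q. (\<lambda>(p, b). if b then (case p of (i, j) \<Rightarrow> U i j) else (case p of (i, j) \<Rightarrow> S i j))
      ((\<lambda>(i, j, b). ((i, j), b)) q)) = (\<lambda>(i, j, b). if b then U i j else S i j)"
    by (auto simp: fun_eq_iff)
  have marked: "marked_array R S U \<theta>"
    using * unfolding eq by unfold_locales (simp_all add: \<theta> dS dU)
  interpret marked_array R S U \<theta> by fact
  have arrpos: "AE \<omega> in R. \<forall>i j. 1 \<le> i \<longrightarrow> 0 \<le> arr i j \<omega>"
    unfolding AE_all_countable
    using marked_renewal.AE_arrival_nonneg[OF row] by (auto simp: arrival_row)
  have Upos: "AE \<omega> in R. \<forall>i j. 1 \<le> i \<longrightarrow> 1 \<le> j \<longrightarrow> 0 \<le> U i j \<omega>"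
    unfolding AE_all_countable using AE_U_nonneg by auto
  have one: "AE \<omega> in R. \<forall>i j. 1 \<le> i \<longrightarrow> 1 \<le> j \<longrightarrow> (\<exists>k\<ge>1. enat k \<le> K i j \<omega> \<and> Y i j k \<omega> = 1)"
    unfolding AE_all_countable
  proof (intro allI)
    fix i j :: nat
    show "AE \<omega> in R. 1 \<le> i \<longrightarrow> 1 \<le> j \<longrightarrow> (\<exists>k\<ge>1. enat k \<le> K i j \<omega> \<and> Y i j k \<omega> = 1)"
    proof (cases "1 \<le> i \<and> 1 \<le> j")
      case True
      then have ij: "1 \<le> i" "1 \<le> j" by auto
      have "AE \<omega> in R. 1 \<le> emeasure (?G K Y i j \<omega>) {1}" using atom ij by blast
      from this AE_space show ?thesis
      proof eventually_elim
        case (elim \<omega>)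
        have "{1 :: real} \<in> sets (restrict_space borel {1..})"
          by (auto simp: sets_restrict_space intro!: image_eqI[of _ _ "{1}"])
        moreover have "(\<lambda>k. Y i j k \<omega>) ` {k. 1 \<le> k \<and> enat k \<le> K i j \<omega>} \<subseteq> {1..}"
          using Y1 ij elim(2) by auto
        ultimately have "\<not> (\<forall>k\<in>{k. 1 \<le> k \<and> enat k \<le> K i j \<omega>}. Y i j k \<omega> \<notin> {1})"
          using point_measure_null_iff[of "\<lambda>k. Y i j k \<omega>" "{k. 1 \<le> k \<and> enat k \<le> K i j \<omega>}" "{1..}" "{1}"] elim(1)
          by fastforce
        then show ?case by auto
      qed
    qed auto
  qed
  show thesis
  proof (rule that[OF marked])
    fix k' t y
    show "AE \<omega> in R. emeasure (N \<omega>) (stair k' t y \<inter> quadrant) = 0 \<longleftrightarrow>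
       (\<forall>i\<ge>1. \<forall>j\<ge>1. ((\<Sum>m=1..j. S i m \<omega>), U i j \<omega>) \<in> - stair k' t y)"
      using Neq one Upos arrpos AE_space
    proof eventually_elim
      case (elim \<omega>)
      let ?J = "{(i, j, k). 1 \<le> i \<and> 1 \<le> j \<and> 1 \<le> k \<and> enat k \<le> K i j \<omega>}"
      let ?x = "\<lambda>(i, j, k). (arr i j \<omega>, U i j \<omega> * Y i j k \<omega>)"
      have N': "N \<omega> = point_measure quadrant ?J ?x" using elim(1) by (simp add: arr_def)
      have quad: "?x ` ?J \<subseteq> quadrant"
      proof
        fix z assume "z \<in> ?x ` ?J"
        then obtain i j k where ijk: "1 \<le> i" "1 \<le> j" "1 \<le> k" "enat k \<le> K i j \<omega>"
          "z = (arr i j \<omega>, U i j \<omega> * Y i j k \<omega>)" by auto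
        have "1 \<le> Y i j k \<omega>" using Y1 ijk elim(5) by blast
        moreover have "0 \<le> U i j \<omega>" "0 \<le> arr i j \<omega>" using elim(3,4) ijk by auto
        ultimately show "z \<in> quadrant" using ijk by simp
      qed
      have "(\<forall>q\<in>?J. ?x q \<notin> stair k' t y \<inter> quadrant) \<longleftrightarrow>
          (\<forall>i\<ge>1. \<forall>j\<ge>1. (arr i j \<omega>, U i j \<omega>) \<in> - stair k' t y)"
      proof safe
        fix i j :: nat
        assume *: "\<forall>q\<in>?J. ?x q \<notin> stair k' t y \<inter> quadrant" and ij: "1 \<le> i" "1 \<le> j"
          and st: "(arr i j \<omega>, U i j \<omega>) \<in> stair k' t y"
        obtain k where k: "1 \<le> k" "enat k \<le> K i j \<omega>" "Y i j k \<omega> = 1" using elim(2) ij by blast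
        then have ijk: "(i, j, k) \<in> ?J" using ij by simp
        have "?x (i, j, k) \<in> quadrant" by (rule subsetD[OF quad imageI[OF ijk]])
        moreover have "?x (i, j, k) \<notin> stair k' t y \<inter> quadrant" by (rule bspec[OF * ijk])
        ultimately show False using st k by simp
      next
        fix i j k
        assume *: "\<forall>i\<ge>1. \<forall>j\<ge>1. (arr i j \<omega>, U i j \<omega>) \<in> - stair k' t y"
          and ij: "1 \<le> i" "1 \<le> j" "1 \<le> k" "enat k \<le> K i j \<omega>"
          and st: "(arr i j \<omega>, U i j \<omega> * Y i j k \<omega>) \<in> stair k' t y"
        have "1 \<le> Y i j k \<omega>" using Y1 ij elim(5) by blast
        moreover have "0 \<le> U i j \<omega>" using elim(3) ij by auto
        ultimately have "U i j \<omega> * 1 \<le> U i j \<omega> * Y i j k \<omega>" by (intro mult_left_mono)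
        then have "(arr i j \<omega>, U i j \<omega>) \<in> stair k' t y" using st by (fastforce simp: stair_def)
        with * ij show False by blast
      qed
      then show ?case
        unfolding N' point_measure_null_iff[OF quad sets_stair_quadrant] by (simp add: arr_def)
    qed
  qed
qed

section \<open>Vague convergence and void probabilities\<close>

definition ramp :: "real \<Rightarrow> real \<Rightarrow> real" where
  "ramp \<epsilon> z = max 0 (min 1 (1 - z / \<epsilon>))"

lemma ramp_props:
  assumes "0 < \<epsilon>"
  shows "0 \<le> ramp \<epsilon> z" "z \<le> 0 \<Longrightarrow> ramp \<epsilon> z = 1" "\<epsilon> \<le> z \<Longrightarrow> ramp \<epsilon> z = 0"
  using assms by (auto simp: ramp_def divide_nonpos_pos)

text \<open>A continuous function that is at least 1 on the staircase and 0 off its enlargement by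
  \<epsilon>. A plain sum may exceed 1 where steps overlap, which is harmless since only the values
  0 and at least 1 are distinguished.\<close>

definition stair_bump :: "nat \<Rightarrow> (nat \<Rightarrow> real) \<Rightarrow> (nat \<Rightarrow> real) \<Rightarrow> real \<Rightarrow> real \<times> real \<Rightarrow> real" where
  "stair_bump k t y \<epsilon> z = (\<Sum>l=1..k. ramp \<epsilon> (fst z - t l) * ramp \<epsilon> (snd z - y l))"

lemma stair_bump_nonneg: "0 < \<epsilon> \<Longrightarrow> 0 \<le> stair_bump k t y \<epsilon> z"
  unfolding stair_bump_def by (intro sum_nonneg mult_nonneg_nonneg ramp_props)

lemma continuous_stair_bump: "continuous_on A (stair_bump k t y \<epsilon>)"
  unfolding stair_bump_def ramp_def divide_inverse by (intro continuous_intros)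

lemma stair_bump_ge_1:
  assumes \<epsilon>: "0 < \<epsilon>" and z: "z \<in> stair k t y"
  shows "1 \<le> stair_bump k t y \<epsilon> z"
proof -
  from z obtain l where l: "l \<in> {1..k}" "fst z \<le> t l" "snd z < y l" by (auto simp: stair_def)
  then have "1 = ramp \<epsilon> (fst z - t l) * ramp \<epsilon> (snd z - y l)" by (simp add: ramp_props[OF \<epsilon>])
  also have "\<dots> \<le> stair_bump k t y \<epsilon> z"
    unfolding stair_bump_def using l by (intro member_le_sum mult_nonneg_nonneg ramp_props \<epsilon>) auto
  finally show ?thesis .
qed

lemma stair_bump_support:
  assumes \<epsilon>: "0 < \<epsilon>" and z: "stair_bump k t y \<epsilon> z \<noteq> 0"
  shows "\<exists>l\<in>{1..k}. fst z < t l + \<epsilon> \<and> snd z < y l + \<epsilon>"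
proof -
  obtain l where l: "l \<in> {1..k}" "ramp \<epsilon> (fst z - t l) * ramp \<epsilon> (snd z - y l) \<noteq> 0"
    using z unfolding stair_bump_def by (meson sum.not_neutral_contains_not_neutral)
  then have "\<not> \<epsilon> \<le> fst z - t l" "\<not> \<epsilon> \<le> snd z - y l" using ramp_props(3)[OF \<epsilon>] by auto
  then have "fst z < t l + \<epsilon>" "snd z < y l + \<epsilon>" by linarith+
  with l(1) show ?thesis by blast
qed

lemma stair_bump_compactly_supported:
  assumes \<epsilon>: "0 < \<epsilon>"
  shows "stair_bump k t y \<epsilon> \<in> compactly_supported quadrant"
proof -
  let ?A = "(\<Sum>l=1..k. \<bar>t l\<bar>) + \<epsilon>" and ?B = "(\<Sum>l=1..k. \<bar>y l\<bar>) + \<epsilon>"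
  have "stair_bump k t y \<epsilon> z = 0" if z: "z \<in> quadrant - {0..?A} \<times> {0..?B}" for z
  proof (rule ccontr)
    assume "stair_bump k t y \<epsilon> z \<noteq> 0"
    from stair_bump_support[OF \<epsilon> this] obtain l where
      l: "l \<in> {1..k}" "fst z < t l + \<epsilon>" "snd z < y l + \<epsilon>" by blast
    have "\<bar>t l\<bar> \<le> (\<Sum>l=1..k. \<bar>t l\<bar>)" "\<bar>y l\<bar> \<le> (\<Sum>l=1..k. \<bar>y l\<bar>)"
      using l(1) by (auto intro!: member_le_sum)
    with l z show False by (cases z) auto
  qed
  then have "compact ({0..?A} \<times> {0..?B}) \<and> {0..?A} \<times> {0..?B} \<subseteq> quadrant \<and>
      (\<forall>z\<in>quadrant - {0..?A} \<times> {0..?B}. stair_bump k t y \<epsilon> z = 0)"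
    by (auto intro: compact_Times)
  then show ?thesis
    unfolding compactly_supported_def using continuous_stair_bump stair_bump_nonneg[OF \<epsilon>] by blast
qed

text \<open>A vaguely continuous substitute for the indicator that the staircase is void: a single
  point in the staircase brings it down to 0, and it is 1 when the enlarged staircase is
  void.\<close>

definition bump_functional :: "nat \<Rightarrow> (nat \<Rightarrow> real) \<Rightarrow> (nat \<Rightarrow> real) \<Rightarrow> real \<Rightarrow> (real \<times> real) measure \<Rightarrow> real" where
  "bump_functional k t y \<epsilon> m = max 0 (1 - (\<integral>z. stair_bump k t y \<epsilon> z \<partial>m))"

lemma topspace_vague: "topspace (vague_topology E) = radon_point_measures E"
proof -
  have "(\<lambda>_. 0 :: real) \<in> compactly_supported E"
    unfolding compactly_supported_def by (auto intro!: exI[of _ "{}"])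
  then have "radon_point_measures E \<in> {{m \<in> radon_point_measures E. (\<integral>x. f x \<partial>m) \<in> V} | f V.
      f \<in> compactly_supported E \<and> open V}"
    by (auto intro!: exI[of _ "\<lambda>_. 0 :: real"] exI[of _ "UNIV :: real set"])
  then show ?thesis
    unfolding vague_topology_def topology_generated_by_topspace by blast
qed

lemma continuous_map_integral:
  assumes "f \<in> compactly_supported E"
  shows "continuous_map (vague_topology E) euclideanreal (\<lambda>m. \<integral>x. f x \<partial>m)"
  unfolding continuous_map_def topspace_vague
proof (intro conjI allI impI)
  fix V :: "real set" assume "openin euclideanreal V"
  then have "open V" by simp
  with assms show "openin (vague_topology E) {m \<in> radon_point_measures E. (\<integral>x. f x \<partial>m) \<in> V}"
    unfolding vague_topology_def openin_topology_generated_by_iff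
    by (intro generate_topology_on.Basis) blast
qed auto

lemma continuous_bump_functional:
  assumes "0 < \<epsilon>"
  shows "continuous_map (vague_topology quadrant) euclideanreal (bump_functional k t y \<epsilon>)"
  unfolding bump_functional_def
  by (intro continuous_map_real_max continuous_map_diff continuous_map_integral
      stair_bump_compactly_supported assms) auto

lemma bump_functional_bounds:
  assumes "0 < \<epsilon>"
  shows "0 \<le> bump_functional k t y \<epsilon> m" "bump_functional k t y \<epsilon> m \<le> 1"
proof -
  have "0 \<le> (\<integral>z. stair_bump k t y \<epsilon> z \<partial>m)"
    by (intro Bochner_Integration.integral_nonneg stair_bump_nonneg assms)
  then show "0 \<le> bump_functional k t y \<epsilon> m" "bump_functional k t y \<epsilon> m \<le> 1"
    by (auto simp: bump_functional_def)
qed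

lemma integral_point_measure:
  fixes f :: "'s::topological_space \<Rightarrow> real"
  assumes f: "f \<in> borel_measurable borel" and x: "x ` J \<subseteq> E" and fin: "finite {j \<in> J. f (x j) \<noteq> 0}"
  shows "(\<integral>z. f z \<partial>point_measure E J x) = (\<Sum>j | j \<in> J \<and> f (x j) \<noteq> 0. f (x j))"
proof -
  have "x \<in> count_space J \<rightarrow>\<^sub>M restrict_space borel E"
    using x by (auto simp: measurable_count_space_eq1 space_restrict_space)
  then have "(\<integral>z. f z \<partial>point_measure E J x) = (\<integral>j. f (x j) \<partial>count_space J)"
    unfolding point_measure_def using f by (intro integral_distr measurable_restrict_space1)
  also have "\<dots> = (\<Sum>j | j \<in> J \<and> f (x j) \<noteq> 0. f (x j))"
    by (rule lebesgue_integral_count_space_finite_support[OF fin])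
  finally show ?thesis .
qed

lemma bump_functional_sandwich:
  assumes \<epsilon>: "0 < \<epsilon>" and m: "m \<in> radon_point_measures quadrant"
  shows "emeasure m (stair k (\<lambda>l. t l + \<epsilon>) (\<lambda>l. y l + \<epsilon>) \<inter> quadrant) = 0 \<Longrightarrow> bump_functional k t y \<epsilon> m = 1"
    and "emeasure m (stair k t y \<inter> quadrant) \<noteq> 0 \<Longrightarrow> bump_functional k t y \<epsilon> m = 0"
proof -
  obtain J :: "nat set" and x where m': "m = point_measure quadrant J x" "x ` J \<subseteq> quadrant"
    and fin: "\<And>C. compact C \<Longrightarrow> C \<subseteq> quadrant \<Longrightarrow> finite {j \<in> J. x j \<in> C}"
    using m by (auto simp: radon_point_measures_def)
  let ?f = "stair_bump k t y \<epsilon>"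
  obtain C where C: "compact C" "C \<subseteq> quadrant" "\<And>z. z \<in> quadrant - C \<Longrightarrow> ?f z = 0"
    using stair_bump_compactly_supported[OF \<epsilon>, of k t y] by (auto simp: compactly_supported_def)
  have "{j \<in> J. ?f (x j) \<noteq> 0} \<subseteq> {j \<in> J. x j \<in> C}" using C(3) m'(2) by blast
  then have fin': "finite {j \<in> J. ?f (x j) \<noteq> 0}" using fin[OF C(1,2)] finite_subset by blast
  have "?f \<in> borel_measurable borel" by (intro borel_measurable_continuous_onI continuous_stair_bump)
  then have int: "(\<integral>z. ?f z \<partial>m) = (\<Sum>j | j \<in> J \<and> ?f (x j) \<noteq> 0. ?f (x j))"
    unfolding m'(1) by (rule integral_point_measure[OF _ m'(2) fin'])
  note null = point_measure_null_iff[OF m'(2) sets_stair_quadrant, folded m'(1)]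
  show "bump_functional k t y \<epsilon> m = 1"
    if void: "emeasure m (stair k (\<lambda>l. t l + \<epsilon>) (\<lambda>l. y l + \<epsilon>) \<inter> quadrant) = 0"
  proof -
    have "?f (x j) = 0" if j: "j \<in> J" for j
    proof (rule ccontr)
      assume "?f (x j) \<noteq> 0"
      from stair_bump_support[OF \<epsilon> this] have "x j \<in> stair k (\<lambda>l. t l + \<epsilon>) (\<lambda>l. y l + \<epsilon>)"
        by (cases "x j") (force simp: stair_def)
      moreover have "x j \<notin> stair k (\<lambda>l. t l + \<epsilon>) (\<lambda>l. y l + \<epsilon>) \<inter> quadrant"
        using void null[of k "\<lambda>l. t l + \<epsilon>" "\<lambda>l. y l + \<epsilon>"] j by simp
      ultimately show False using m'(2) j by blast
    qed
    then have "(\<integral>z. ?f z \<partial>m) = 0" unfolding int by (intro sum.neutral) auto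
    then show ?thesis by (simp add: bump_functional_def)
  qed
  show "bump_functional k t y \<epsilon> m = 0" if hit: "emeasure m (stair k t y \<inter> quadrant) \<noteq> 0"
  proof -
    obtain j where j: "j \<in> J" "x j \<in> stair k t y" using hit null[of k t y] by auto
    then have ge: "1 \<le> ?f (x j)" by (intro stair_bump_ge_1[OF \<epsilon>])
    also have "\<dots> \<le> (\<Sum>j | j \<in> J \<and> ?f (x j) \<noteq> 0. ?f (x j))"
      using j ge fin' by (intro member_le_sum stair_bump_nonneg \<epsilon>) auto
    finally show ?thesis by (simp add: bump_functional_def int)
  qed
qed

text \<open>The void events are represented by measurable sets A and B that agree with them almost
  surely, which spares a proof that numbers of points in staircases are measurable on the vague
  space.\<close>

lemma integral_bump_functional_bounds:
  assumes M: "prob_space M" and \<Xi>: "\<Xi> \<in> M \<rightarrow>\<^sub>M borel_of (vague_topology quadrant)" and \<epsilon>: "0 < \<epsilon>"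
    and A: "A \<in> sets M" "B \<in> sets M"
    and A_iff: "AE \<omega> in M. \<omega> \<in> A \<longleftrightarrow> emeasure (\<Xi> \<omega>) (stair k (\<lambda>l. t l + \<epsilon>) (\<lambda>l. y l + \<epsilon>) \<inter> quadrant) = 0"
    and B_iff: "AE \<omega> in M. \<omega> \<in> B \<longleftrightarrow> emeasure (\<Xi> \<omega>) (stair k t y \<inter> quadrant) = 0"
  shows "measure M A \<le> (\<integral>\<omega>. bump_functional k t y \<epsilon> (\<Xi> \<omega>) \<partial>M)"
    and "(\<integral>\<omega>. bump_functional k t y \<epsilon> (\<Xi> \<omega>) \<partial>M) \<le> measure M B"
proof -
  interpret prob_space M by fact
  let ?F = "bump_functional k t y \<epsilon>"
  have rad: "\<Xi> \<omega> \<in> radon_point_measures quadrant" if "\<omega> \<in> space M" for \<omega>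
    using measurable_space[OF \<Xi> that] by (simp add: space_borel_of topspace_vague)
  have "(\<lambda>\<omega>. ?F (\<Xi> \<omega>)) \<in> borel_measurable M"
    using measurable_comp[OF \<Xi> continuous_map_borel_of[OF continuous_bump_functional[OF \<epsilon>]]]
    by (simp add: comp_def)
  then have int: "integrable M (\<lambda>\<omega>. ?F (\<Xi> \<omega>))"
    using bump_functional_bounds[OF \<epsilon>] by (intro integrable_const_bound[of _ 1]) auto
  have "AE \<omega> in M. indicat_real A \<omega> \<le> ?F (\<Xi> \<omega>)"
    using A_iff AE_space
  proof eventually_elim
    case (elim \<omega>)
    then show ?case
      using bump_functional_sandwich(1)[OF \<epsilon> rad] bump_functional_bounds(1)[OF \<epsilon>]
      by (cases "\<omega> \<in> A") auto
  qed
  then have "(\<integral>\<omega>. indicat_real A \<omega> \<partial>M) \<le> (\<integral>\<omega>. ?F (\<Xi> \<omega>) \<partial>M)"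
    using A(1) by (intro integral_mono_AE int integrable_real_indicator) (auto simp: less_top[symmetric])
  then show "measure M A \<le> (\<integral>\<omega>. ?F (\<Xi> \<omega>) \<partial>M)" using A(1) by simp
  have "AE \<omega> in M. ?F (\<Xi> \<omega>) \<le> indicat_real B \<omega>"
    using B_iff AE_space
  proof eventually_elim
    case (elim \<omega>)
    then show ?case
      using bump_functional_sandwich(2)[OF \<epsilon> rad] bump_functional_bounds(2)[OF \<epsilon>]
      by (cases "\<omega> \<in> B") auto
  qed
  then have "(\<integral>\<omega>. ?F (\<Xi> \<omega>) \<partial>M) \<le> (\<integral>\<omega>. indicat_real B \<omega> \<partial>M)"
    using A(2) by (intro integral_mono_AE int integrable_real_indicator) (auto simp: less_top[symmetric])
  then show "(\<integral>\<omega>. ?F (\<Xi> \<omega>) \<partial>M) \<le> measure M B" using A(2) by simp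
qed

text \<open>Shrinking a staircase can push heights below 0, where \<open>staircase\<close> does not
  allow them; within the quadrant clipping makes no difference.\<close>

lemma stair_max_0: "stair k t (\<lambda>l. max 0 (y l)) \<inter> quadrant = stair k t y \<inter> quadrant"
  by (fastforce simp: stair_def)

lemma tendsto_Max:
  fixes f :: "'n \<Rightarrow> 'i \<Rightarrow> real"
  assumes "finite A" "A \<noteq> {}" "\<And>i. i \<in> A \<Longrightarrow> ((\<lambda>n. f n i) \<longlongrightarrow> g i) F"
  shows "((\<lambda>n. Max (f n ` A)) \<longlongrightarrow> Max (g ` A)) F"
  using assms
proof (induction A rule: finite_ne_induct)
  case (insert i A)
  then show ?case by (auto intro!: tendsto_max)
qed simp

lemma tendsto_stair_area:
  assumes t: "\<And>l. l \<in> {1..k} \<Longrightarrow> ((\<lambda>n. t' n l) \<longlongrightarrow> t l) F"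
    and y: "\<And>l. l \<in> {1..k} \<Longrightarrow> ((\<lambda>n. y' n l) \<longlongrightarrow> y l) F"
  shows "((\<lambda>n. stair_area k (t' n) (y' n)) \<longlongrightarrow> stair_area k t y) F"
proof -
  have g: "((\<lambda>n. grid (t' n) l) \<longlongrightarrow> grid t l) F" if "l \<le> k" for l
    using t[of l] that by (cases "l = 0") (auto simp: grid_def)
  show ?thesis
    unfolding stair_area_def
    by (intro tendsto_sum tendsto_mult tendsto_diff g tendsto_Max y) auto
qed

text \<open>Void probabilities of staircases depend continuously on the staircase, so sandwiching a
  continuous functional between two staircases spares any discussion of boundary points.\<close>

lemma void_probabilities_tendsto:
  assumes P: "prob_space P" and R: "prob_space R"
    and conv: "converges_weakly (vague_topology quadrant) P \<Xi> R N"
    and A: "\<And>n k t y. A n k t y \<in> sets P"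
      "\<And>n k t y. AE \<omega> in P. \<omega> \<in> A n k t y \<longleftrightarrow> emeasure (\<Xi> n \<omega>) (stair k t y \<inter> quadrant) = 0"
    and B: "\<And>k t y. B k t y \<in> sets R"
      "\<And>k t y. AE \<omega> in R. \<omega> \<in> B k t y \<longleftrightarrow> emeasure (N \<omega>) (stair k t y \<inter> quadrant) = 0"
    and void: "\<And>k t y. staircase k t y \<Longrightarrow> measure R (B k t y) = exp (- \<theta> * stair_area k t y)"
    and st: "staircase k t y" and t_pos: "0 < t 1"
  shows "(\<lambda>n. measure P (A n k t y)) \<longlonglongrightarrow> exp (- \<theta> * stair_area k t y)"
proof -
  interpret staircase k t y by fact
  have \<Xi>: "\<Xi> n \<in> P \<rightarrow>\<^sub>M borel_of (vague_topology quadrant)" for n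
    using conv by (auto simp: converges_weakly_def)
  have N: "N \<in> R \<rightarrow>\<^sub>M borel_of (vague_topology quadrant)"
    using conv by (auto simp: converges_weakly_def)
  have lim: "(\<lambda>n. \<integral>\<omega>. bump_functional k t y \<epsilon> (\<Xi> n \<omega>) \<partial>P) \<longlonglongrightarrow> (\<integral>\<omega>. bump_functional k t y \<epsilon> (N \<omega>) \<partial>R)"
    if "0 < \<epsilon>" for k t y \<epsilon>
  proof -
    have "bounded (bump_functional k t y \<epsilon> ` topspace (vague_topology quadrant))"
      using bump_functional_bounds[OF that] by (intro boundedI[of _ 1]) auto
    with continuous_bump_functional[OF that] conv show ?thesis by (auto simp: converges_weakly_def)
  qed
  \<comment> \<open>At most \<open>t 1\<close>, so that the times remain nonnegative when they are
    moved back by \<open>e m\<close>.\<close>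
  define e where "e m = t 1 / real (Suc m)" for m
  have e0: "0 < e m" "e m \<le> t 1" for m using t_pos by (auto simp: e_def field_simps)
  have e_lim: "e \<longlonglongrightarrow> 0"
    unfolding e_def by (rule LIMSEQ_Suc[OF lim_const_over_n])
  define up_t where "up_t m = (\<lambda>l. t l + e m)" for m
  define up_y where "up_y m = (\<lambda>l. y l + e m)" for m
  define lo_t where "lo_t m = (\<lambda>l. t l - e m)" for m
  define lo_y where "lo_y m = (\<lambda>l. max 0 (y l - e m))" for m
  have st_up: "staircase k (up_t m) (up_y m)" for m
    using t_pos t_mono y_nonneg e0[of m] by unfold_locales (auto simp: up_t_def up_y_def less_imp_le add_nonneg_nonneg)
  have st_lo: "staircase k (lo_t m) (lo_y m)" for m
    using t_pos t_mono e0[of m] by unfold_locales (auto simp: lo_t_def lo_y_def)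
  have up_lim: "(\<lambda>m. exp (- \<theta> * stair_area k (up_t m) (up_y m))) \<longlonglongrightarrow> exp (- \<theta> * stair_area k t y)"
    unfolding up_t_def up_y_def
    by (intro tendsto_intros tendsto_stair_area) (auto intro!: tendsto_eq_intros e_lim)
  have "(\<lambda>m. max 0 (y l - e m)) \<longlonglongrightarrow> y l" if "l \<in> {1..k}" for l
  proof -
    have "(\<lambda>m. max 0 (y l - e m)) \<longlonglongrightarrow> max 0 (y l - 0)" by (intro tendsto_intros e_lim)
    then show ?thesis using y_nonneg[OF that] by simp
  qed
  then have lo_lim: "(\<lambda>m. exp (- \<theta> * stair_area k (lo_t m) (lo_y m))) \<longlonglongrightarrow> exp (- \<theta> * stair_area k t y)"
    unfolding lo_t_def lo_y_def
    by (intro tendsto_intros tendsto_stair_area) (auto intro!: tendsto_eq_intros e_lim)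
  \<comment> \<open>The same functional lies above the void indicator of the enlarged staircase,
    used for the limit N, and below that of the given one, used for the processes.\<close>
  have lower: "exp (- \<theta> * stair_area k (up_t m) (up_y m)) \<le> (\<integral>\<omega>. bump_functional k t y (e m) (N \<omega>) \<partial>R)"
    for m
    unfolding void[OF st_up, symmetric]
    by (rule integral_bump_functional_bounds(1)[OF R N e0(1) B(1) B(1) _ B(2)])
       (use B(2) in \<open>simp add: up_t_def up_y_def\<close>)
  have B_lo: "AE \<omega> in R. \<omega> \<in> B k (lo_t m) (lo_y m) \<longleftrightarrow>
      emeasure (N \<omega>) (stair k (lo_t m) (\<lambda>l. y l - e m) \<inter> quadrant) = 0" for m
    using B(2)[of k "lo_t m" "lo_y m"] unfolding lo_y_def stair_max_0 .
  have upper: "(\<integral>\<omega>. bump_functional k (lo_t m) (\<lambda>l. y l - e m) (e m) (N \<omega>) \<partial>R) \<le>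
      exp (- \<theta> * stair_area k (lo_t m) (lo_y m))" for m
    unfolding void[OF st_lo, symmetric]
    by (rule integral_bump_functional_bounds(2)[OF R N e0(1) B(1) B(1) B(2) B_lo])
  have P_lower: "(\<integral>\<omega>. bump_functional k t y (e m) (\<Xi> n \<omega>) \<partial>P) \<le> measure P (A n k t y)" for m n
    by (rule integral_bump_functional_bounds(2)[OF P \<Xi> e0(1) A(1) A(1) A(2) A(2)])
  \<comment> \<open>Enlarging the shrunken staircase by \<open>e m\<close> gives back t and y
    exactly, provided that the heights are not clipped at 0.\<close>
  have P_upper: "measure P (A n k t y) \<le> (\<integral>\<omega>. bump_functional k (lo_t m) (\<lambda>l. y l - e m) (e m) (\<Xi> n \<omega>) \<partial>P)"
    for m n
    by (rule integral_bump_functional_bounds(1)[OF P \<Xi> e0(1) A(1) A(1) _ A(2)])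
       (use A(2)[of n k t y] in \<open>simp add: lo_t_def\<close>)
  show ?thesis
  proof (rule order_tendstoI)
    fix a assume "a < exp (- \<theta> * stair_area k t y)"
    from order_tendstoD(1)[OF up_lim this]
    obtain m where "a < exp (- \<theta> * stair_area k (up_t m) (up_y m))" by (auto simp: eventually_sequentially)
    with lower[of m] have "a < (\<integral>\<omega>. bump_functional k t y (e m) (N \<omega>) \<partial>R)" by linarith
    from order_tendstoD(1)[OF lim[OF e0(1)] this]
    show "\<forall>\<^sub>F n in sequentially. a < measure P (A n k t y)"
      by eventually_elim (use P_lower in \<open>auto intro: less_le_trans\<close>)
  next
    fix a assume "a > exp (- \<theta> * stair_area k t y)"
    from order_tendstoD(2)[OF lo_lim this]
    obtain m where "a > exp (- \<theta> * stair_area k (lo_t m) (lo_y m))" by (auto simp: eventually_sequentially)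
    with upper[of m] have "a > (\<integral>\<omega>. bump_functional k (lo_t m) (\<lambda>l. y l - e m) (e m) (N \<omega>) \<partial>R)" by linarith
    from order_tendstoD(2)[OF lim[OF e0(1)] this]
    show "\<forall>\<^sub>F n in sequentially. a > measure P (A n k t y)"
      by eventually_elim (use P_upper in \<open>auto intro: le_less_trans\<close>)
  qed
qed

section \<open>The normalised maxima\<close>

locale levels = prob_space P for P :: "'a measure" +
  fixes X :: "nat \<Rightarrow> 'a \<Rightarrow> real" and u :: "nat \<Rightarrow> real \<Rightarrow> real"
  assumes stationary: "stationary_process P X" and normalising: "normalising_levels P X u"
begin

lemma measurable_X [measurable]: "X j \<in> borel_measurable P"
  using stationary by (simp add: stationary_process_def)

context
  fixes n :: nat assumes n: "1 \<le> n"
begin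

lemma u_cont: "continuous_on {0<..} (u n)"
  and u_anti: "0 < \<sigma> \<Longrightarrow> \<sigma> < \<tau> \<Longrightarrow> u n \<tau> < u n \<sigma>"
  and X0_range: "\<omega> \<in> space P \<Longrightarrow> X 0 \<omega> \<in> u n ` {0<..}"
proof -
  have "continuous_on {0<..} (u n) \<and> (\<forall>\<sigma>>0. \<forall>\<tau>>0. \<sigma> < \<tau> \<longrightarrow> u n \<tau> < u n \<sigma>) \<and>
      X 0 ` space P \<subseteq> u n ` {0<..}"
    using normalising n unfolding normalising_levels_def by blast
  then show "continuous_on {0<..} (u n)" "0 < \<sigma> \<Longrightarrow> \<sigma> < \<tau> \<Longrightarrow> u n \<tau> < u n \<sigma>"
    "\<omega> \<in> space P \<Longrightarrow> X 0 \<omega> \<in> u n ` {0<..}"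
    by (auto simp del: image_iff)
qed

lemma u_inj: "inj_on (u n) {0<..}"
proof (rule inj_onI)
  fix x y assume "x \<in> {0<..}" "y \<in> {0<..}" "u n x = u n y"
  then show "x = y" using u_anti[of x y] u_anti[of y x] by (cases x y rule: linorder_cases) auto
qed

lemma level_inv_range:
  assumes "x \<in> u n ` {0<..}"
  shows "0 < level_inv u n x" "u n (level_inv u n x) = x"
  using the_inv_into_into[OF u_inj assms, of "{0<..}"] f_the_inv_into_f[OF u_inj assms]
  by (auto simp: level_inv_def)

text \<open>Off the range every argument is sent to one and the same unspecified value, so
  \<open>level_inv\<close> is constant there; its measurability depends on this.\<close>

lemma level_inv_outside:
  assumes "x \<notin> u n ` {0<..}"
  shows "level_inv u n x = (THE y. False)"
proof -
  have "(y \<in> {0<..} \<and> u n y = x) = False" for y using assms by auto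
  then show ?thesis unfolding level_inv_def the_inv_into_def by (simp only:)
qed

lemma level_inv_ge_iff:
  assumes x: "x \<in> u n ` {0<..}" and a: "0 < a"
  shows "a \<le> level_inv u n x \<longleftrightarrow> x \<le> u n a"
  using level_inv_range[OF x] u_anti[OF a, of "level_inv u n x"] u_anti[of "level_inv u n x" a]
  by (cases a "level_inv u n x" rule: linorder_cases) auto

lemma level_inv_antimono:
  assumes "x \<in> u n ` {0<..}" "y \<in> u n ` {0<..}" "x \<le> y"
  shows "level_inv u n y \<le> level_inv u n x"
  using level_inv_ge_iff[OF assms(1), of "level_inv u n y"] level_inv_range[OF assms(2)] assms(3) by simp

text \<open>The open half-line is a countable union of compact intervals, and their continuous
  images are compact.\<close>

lemma sets_range_u: "u n ` {0<..} \<in> sets borel"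
proof -
  have "{0<..} = (\<Union>m. {1 / real (Suc m)..real m})"
  proof (intro set_eqI iffI)
    fix x :: real assume "x \<in> {0<..}"
    then have x: "0 < x" by simp
    obtain m1 where m1: "1 / real (Suc m1) < x" using reals_Archimedean[OF x] by (auto simp: inverse_eq_divide)
    obtain m2 where m2: "x \<le> real m2" using real_arch_simple by blast
    have "1 / real (Suc (max m1 m2)) \<le> 1 / real (Suc m1)" by (intro divide_left_mono) auto
    with m1 m2 have "x \<in> {1 / real (Suc (max m1 m2))..real (max m1 m2)}" by auto
    then show "x \<in> (\<Union>m. {1 / real (Suc m)..real m})" by blast
  next
    fix x :: real assume "x \<in> (\<Union>m. {1 / real (Suc m)..real m})"
    then obtain m where m: "1 / real (Suc m) \<le> x" by auto
    have "0 < 1 / real (Suc m)" by simp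
    also note m
    finally show "x \<in> {0<..}" by simp
  qed
  then have "u n ` {0<..} = (\<Union>m. u n ` {1 / real (Suc m)..real m})" by (simp only: image_UN)
  also have "\<dots> \<in> sets borel"
  proof (intro sets.countable_UN image_subsetI)
    fix m
    have "{1 / real (Suc m)..real m} \<subseteq> {0<..}"
    proof
      fix x assume "x \<in> {1 / real (Suc m)..real m}"
      then have m: "1 / real (Suc m) \<le> x" by simp
      have "0 < 1 / real (Suc m)" by simp
      also note m
      finally show "x \<in> {0<..}" by simp
    qed
    then have "compact (u n ` {1 / real (Suc m)..real m})"
      by (intro compact_continuous_image continuous_on_subset[OF u_cont]) auto
    then show "u n ` {1 / real (Suc m)..real m} \<in> sets borel" by (intro borel_compact)
  qed
  finally show ?thesis .
qed

lemma measurable_level_inv [measurable]: "level_inv u n \<in> borel_measurable borel"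
proof (rule borel_measurable_iff_ge[THEN iffD2], rule allI)
  fix a :: real
  let ?R = "u n ` {0<..}"
  \<comment> \<open>On the range, a positive a is compared through \<open>u n a\<close>, while for a
    nonpositive a all of the range qualifies, the inverse being positive there. Off the range the
    unspecified value decides for all points at once.\<close>
  have "{x \<in> space borel. a \<le> level_inv u n x} =
      (if 0 < a then ?R \<inter> {..u n a} else ?R) \<union> (if a \<le> (THE y. False) then - ?R else {})"
  proof (rule set_eqI)
    fix x
    show "x \<in> {x \<in> space borel. a \<le> level_inv u n x} \<longleftrightarrow>
      x \<in> (if 0 < a then ?R \<inter> {..u n a} else ?R) \<union> (if a \<le> (THE y. False) then - ?R else {})"
    proof (cases "x \<in> ?R")
      case True
      then show ?thesis using level_inv_ge_iff[OF True, of a] level_inv_range(1)[OF True] by auto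
    next
      case False
      then show ?thesis using level_inv_outside[OF False] by auto
    qed
  qed
  also have "\<dots> \<in> sets borel" using sets_range_u by (auto intro!: sets.Un borel_comp)
  finally show "{x \<in> space borel. a \<le> level_inv u n x} \<in> sets borel" .
qed

text \<open>The levels are assumed to cover the values of \<open>X 0\<close> only. The range is a
  Borel set, so stationarity passes this on to every \<open>X j\<close>, but only almost
  surely.\<close>

lemma AE_range: "AE \<omega> in P. \<forall>j. X j \<omega> \<in> u n ` {0<..}"
  unfolding AE_all_countable
proof
  fix m
  let ?R = "u n ` {0<..}" and ?B = "{x \<in> space (Pi\<^sub>M UNIV (\<lambda>_. borel)). x (0 :: nat) \<in> u n ` {0<..}}"
  have B: "?B \<in> sets (Pi\<^sub>M UNIV (\<lambda>_. borel))"
    by (intro measurable_sets_Collect[OF measurable_component_singleton]) (use sets_range_u in \<open>auto simp: pred_def\<close>)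
  have meas: "(\<lambda>\<omega> j. X (j + m) \<omega>) \<in> P \<rightarrow>\<^sub>M Pi\<^sub>M UNIV (\<lambda>_. borel)" for m
    by (rule measurable_PiM_single') (auto simp: space_PiM)
  have "measure (distr P (Pi\<^sub>M UNIV (\<lambda>_. borel)) (\<lambda>\<omega> j. X (j + m) \<omega>)) ?B =
      measure (distr P (Pi\<^sub>M UNIV (\<lambda>_. borel)) (\<lambda>\<omega> j. X j \<omega>)) ?B"
    using stationary by (simp add: stationary_process_def)
  then have "prob {\<omega> \<in> space P. X m \<omega> \<in> ?R} = prob {\<omega> \<in> space P. X 0 \<omega> \<in> ?R}"
    using measure_distr[OF meas B, of m] measure_distr[OF meas B, of 0]
    by (simp add: space_PiM vimage_def Int_def conj_commute)
  also have "{\<omega> \<in> space P. X 0 \<omega> \<in> ?R} = space P" using X0_range by blast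
  finally have "prob {\<omega> \<in> space P. X m \<omega> \<in> ?R} = 1" by (simp add: prob_space)
  moreover have "{\<omega> \<in> space P. X m \<omega> \<in> ?R} \<in> events"
    using sets_range_u by (intro measurable_sets_Collect[OF measurable_X]) (auto simp: pred_def)
  ultimately show "AE \<omega> in P. X m \<omega> \<in> ?R"
    by (subst (asm) prob_eq_1) (auto elim: AE_mp)
qed

lemma measurable_partial_max [measurable]: "partial_max X m \<in> borel_measurable P"
  unfolding partial_max_def by (intro borel_measurable_Max) auto

lemma measurable_max_process [measurable]: "max_process X u n t \<in> borel_measurable P"
  unfolding max_process_def by measurable

text \<open>The decreasing inverse turns the maximum into a minimum, and the + 1 in the number of
  variables makes the indices exactly those with j / n \<le> t.\<close>

lemma max_process_ge_iff:
  assumes range: "\<And>j. X j \<omega> \<in> u n ` {0<..}" and t: "0 \<le> t"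
  shows "y \<le> max_process X u n t \<omega> \<longleftrightarrow> (\<forall>j. real j / real n \<le> t \<longrightarrow> y \<le> level_inv u n (X j \<omega>))"
proof -
  define m where "m = nat \<lfloor>real n * t\<rfloor> + 1"
  have m: "j < m \<longleftrightarrow> real j / real n \<le> t" for j
  proof -
    have "j < m \<longleftrightarrow> int j \<le> \<lfloor>real n * t\<rfloor>" using t by (simp add: m_def less_Suc_eq_le le_nat_iff)
    also have "\<dots> \<longleftrightarrow> real j \<le> real n * t" by (simp add: le_floor_iff)
    also have "\<dots> \<longleftrightarrow> real j / real n \<le> t" using n by (simp add: field_simps)
    finally show ?thesis .
  qed
  have "Max ((\<lambda>j. X j \<omega>) ` {..<m}) \<in> (\<lambda>j. X j \<omega>) ` {..<m}" by (intro Max_in) (auto simp: m_def)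
  then obtain j0 where j0: "j0 < m" "Max ((\<lambda>j. X j \<omega>) ` {..<m}) = X j0 \<omega>" by auto
  have mp: "max_process X u n t \<omega> = level_inv u n (X j0 \<omega>)"
    unfolding max_process_def partial_max_def m_def[symmetric] j0(2) ..
  have "level_inv u n (X j0 \<omega>) \<le> level_inv u n (X j \<omega>)" if "j < m" for j
  proof (rule level_inv_antimono[OF range range])
    have "X j \<omega> \<le> Max ((\<lambda>j. X j \<omega>) ` {..<m})" using that by (intro Max_ge) auto
    then show "X j \<omega> \<le> X j0 \<omega>" using j0 by simp
  qed
  then show ?thesis unfolding mp m[symmetric] using j0(1) by (meson order_trans)
qed

text \<open>The guard 0 \<le> t l is needed because a step that ends before time 0 contains no point
  at all, whereas the maximum process at a negative time still evaluates \<open>X 0\<close>.\<close>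

lemma empirical_null_iff:
  assumes range: "\<And>j. X j \<omega> \<in> u n ` {0<..}"
  shows "emeasure (empirical_process X u n \<omega>) (stair k t y \<inter> quadrant) = 0 \<longleftrightarrow>
    (\<forall>l\<in>{1..k}. 0 \<le> t l \<longrightarrow> y l \<le> max_process X u n (t l) \<omega>)"
proof -
  let ?x = "\<lambda>j. (real j / real n, level_inv u n (X j \<omega>))"
  have quad: "?x ` UNIV \<subseteq> quadrant"
    using level_inv_range(1)[OF range] by (auto intro: less_imp_le)
  have "emeasure (empirical_process X u n \<omega>) (stair k t y \<inter> quadrant) = 0 \<longleftrightarrow>
      (\<forall>j. ?x j \<notin> stair k t y \<inter> quadrant)"
    unfolding empirical_process_def point_measure_null_iff[OF quad sets_stair_quadrant] by simp
  also have "\<dots> \<longleftrightarrow> (\<forall>j. ?x j \<notin> stair k t y)" using quad by blast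
  also have "\<dots> \<longleftrightarrow> (\<forall>l\<in>{1..k}. \<forall>j. real j / real n \<le> t l \<longrightarrow> y l \<le> level_inv u n (X j \<omega>))"
    by (auto simp: stair_def not_less)
  also have "\<dots> \<longleftrightarrow> (\<forall>l\<in>{1..k}. 0 \<le> t l \<longrightarrow> y l \<le> max_process X u n (t l) \<omega>)"
  proof (intro ball_cong refl)
    fix l
    show "(\<forall>j. real j / real n \<le> t l \<longrightarrow> y l \<le> level_inv u n (X j \<omega>)) \<longleftrightarrow>
      (0 \<le> t l \<longrightarrow> y l \<le> max_process X u n (t l) \<omega>)"
    proof (cases "0 \<le> t l")
      case True
      then show ?thesis using max_process_ge_iff[OF range True] by simp
    next
      case False
      then have "\<not> real j / real n \<le> t l" for j
        using divide_nonneg_nonneg[of "real j" "real n"] by linarith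
      with False show ?thesis by simp
    qed
  qed
  finally show ?thesis .
qed

section \<open>Sample paths of the normalised maxima\<close>

definition time_index :: "real \<Rightarrow> real \<Rightarrow> nat" where
  "time_index s t = nat \<lfloor>real n * (s + t)\<rfloor>"

lemma lattice_time_index:
  assumes s: "0 \<le> s" shows "lattice_index (time_index s)"
  unfolding lattice_index_def
proof (intro conjI allI impI)
  fix x y :: real assume "0 \<le> x" "x \<le> y"
  then show "time_index s x \<le> time_index s y"
    unfolding time_index_def by (intro nat_mono floor_mono mult_left_mono) auto
next
  have n0: "0 < real n" using n by simp
  fix t :: real assume t: "0 \<le> t"
  let ?z = "real n * (s + t)"
  \<comment> \<open>The next lattice time: n (s + b) is the first integer above n (s + t).\<close>
  define b where "b = t + (of_int \<lfloor>?z\<rfloor> + 1 - ?z) / real n"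
  have "t < b" unfolding b_def using n0 by (simp add: field_simps) linarith
  moreover have "time_index s r = time_index s t" if "t < r" "r < b" for r
  proof -
    have "?z \<le> real n * (s + r)" using that n0 by (intro mult_left_mono) auto
    moreover have "real n * (s + r) < of_int \<lfloor>?z\<rfloor> + 1"
      using that(2) n0 unfolding b_def by (simp add: field_simps)
    ultimately have "\<lfloor>real n * (s + r)\<rfloor> = \<lfloor>?z\<rfloor>" by linarith
    then show ?thesis by (simp add: time_index_def)
  qed
  ultimately show "\<forall>\<^sub>F r in at_right t. time_index s r = time_index s t"
    unfolding eventually_at_right_field by blast
next
  have n0: "0 < real n" using n by simp
  fix t :: real assume t: "0 < t"
  let ?z = "real n * (s + t)"
  have z: "0 < ?z" using n0 s t by simp
  \<comment> \<open>The last lattice time strictly before t. The ceiling minus 1, not the floor, is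
    used because at a lattice time the left limit belongs to the preceding index.\<close>
  define b where "b = t - (?z - (of_int \<lceil>?z\<rceil> - 1)) / real n"
  have "b < t" unfolding b_def using n0 by (simp add: field_simps) linarith
  moreover have "time_index s r = nat (\<lceil>?z\<rceil> - 1)" if "b < r" "r < t" for r
  proof -
    have "real n * (s + r) < ?z" using that n0 by (intro mult_strict_left_mono) auto
    moreover have "of_int \<lceil>?z\<rceil> - 1 < real n * (s + r)"
      using that(1) n0 unfolding b_def by (simp add: field_simps)
    ultimately have "\<lfloor>real n * (s + r)\<rfloor> = \<lceil>?z\<rceil> - 1" by linarith
    then show ?thesis by (simp add: time_index_def)
  qed
  ultimately have "\<forall>\<^sub>F r in at_left t. time_index s r = nat (\<lceil>?z\<rceil> - 1)"
    unfolding eventually_at_left_field by blast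
  moreover have "time_index s t = nat (\<lceil>?z\<rceil> - 1) \<or> time_index s t = Suc (nat (\<lceil>?z\<rceil> - 1))"
  proof -
    have "1 \<le> \<lceil>?z\<rceil>" using z by linarith
    moreover have "\<lfloor>?z\<rfloor> = \<lceil>?z\<rceil> - 1 \<or> \<lfloor>?z\<rfloor> = \<lceil>?z\<rceil>" by linarith
    ultimately show ?thesis unfolding time_index_def by auto
  qed
  ultimately show "\<exists>k. (\<forall>\<^sub>F r in at_left t. time_index s r = k) \<and> (time_index s t = k \<or> time_index s t = Suc k)"
    by blast
qed

lemma path_from_max_process:
  "path_from s (max_process X u n) \<omega> = step_path (time_index s) (\<lambda>m. level_inv u n (partial_max X (m + 1) \<omega>))"
  by (simp add: path_from_def step_path_def max_process_def time_index_def)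

lemma measurable_path_max_process:
  assumes "0 \<le> s"
  shows "path_from s (max_process X u n) \<in> P \<rightarrow>\<^sub>M borel_of M1_topology"
proof -
  have "(\<lambda>\<omega>. step_path (time_index s) (\<lambda>m. level_inv u n (partial_max X (m + 1) \<omega>))) \<in> P \<rightarrow>\<^sub>M borel_of M1_topology"
    by (rule measurable_step_path[OF lattice_time_index[OF assms]]) measurable
  then show ?thesis by (simp add: path_from_max_process[abs_def])
qed

lemma path_max_process_decr:
  assumes range: "\<And>j. X j \<omega> \<in> u n ` {0<..}" and s: "0 \<le> s"
  shows "path_from s (max_process X u n) \<omega> \<in> nonneg_decr_paths"
proof -
  note ge = max_process_ge_iff[OF range]
  have "max_process X u n y \<omega> \<le> max_process X u n x \<omega>" if "0 \<le> x" "x \<le> y" for x y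
    unfolding ge[OF that(1)] using ge[of y "max_process X u n y \<omega>"] that by (auto intro: order_trans)
  moreover have "0 \<le> max_process X u n x \<omega>" if "0 \<le> x" for x
    unfolding ge[OF that] using level_inv_range(1)[OF range] by (auto intro: less_imp_le)
  moreover have "path_from s (max_process X u n) \<omega> \<in> cadlag"
    unfolding path_from_max_process by (rule step_path_cadlag[OF lattice_time_index[OF s]])
  ultimately show ?thesis
    using s by (auto simp: nonneg_decr_paths_def decr_paths_def path_from_def)
qed

end

end

section \<open>Construction of the limit process\<close>

lemma antimono_left_limit:
  fixes g :: "real \<Rightarrow> real"
  assumes t: "0 < t" and g: "\<And>x y. 0 \<le> x \<Longrightarrow> x \<le> y \<Longrightarrow> g y \<le> g x"
  shows "\<exists>l. (g \<longlongrightarrow> l) (at_left t)"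
proof -
  let ?l = "Inf (g ` {0..<t})"
  have bdd: "bdd_below (g ` {0..<t})" using g by (intro bdd_belowI[of _ "g t"]) auto
  have ne: "g ` {0..<t} \<noteq> {}" using t by auto
  have "(g \<longlongrightarrow> ?l) (at_left t)"
  proof (rule order_tendstoI)
    fix a assume a: "a < ?l"
    have "a < g r" if "0 < r" "r < t" for r
      using a cInf_lower[OF _ bdd, of "g r"] that by force
    then show "\<forall>\<^sub>F r in at_left t. a < g r" unfolding eventually_at_left_field using t by blast
  next
    fix a assume "?l < a"
    then obtain r0 where r0: "0 \<le> r0" "r0 < t" "g r0 < a" using cInf_lessD[OF ne, of a] by auto
    have "g r < a" if "r0 < r" "r < t" for r using g[of r0 r] r0 that by simp
    then show "\<forall>\<^sub>F r in at_left t. g r < a" unfolding eventually_at_left_field using r0 by blast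
  qed
  then show ?thesis ..
qed

context marked_array
begin

text \<open>Besides the signs: unbounded arrivals leave each row only finitely many points up to any
  time, and arbitrarily early first arrivals make the minimum finite at every positive time.\<close>

definition good :: "'b \<Rightarrow> bool" where
  "good \<omega> \<longleftrightarrow> (\<forall>i\<ge>1. \<forall>j\<ge>1. 0 \<le> S i j \<omega> \<and> real i - 1 \<le> U i j \<omega>) \<and>
     (\<forall>i\<ge>1. \<forall>m. \<exists>j. real m < arr i j \<omega>) \<and> (\<forall>m. \<exists>i\<ge>1. arr i 1 \<omega> \<le> 1 / real (Suc m))"

lemma measurable_S: "1 \<le> i \<Longrightarrow> 1 \<le> j \<Longrightarrow> S i j \<in> borel_measurable M"
  using marked_renewal.measurable_sv(1)[OF row] .

lemma pred_good [measurable]: "Measurable.pred M good"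
proof -
  have 1: "Measurable.pred M (\<lambda>\<omega>. 1 \<le> i \<longrightarrow> 1 \<le> j \<longrightarrow> 0 \<le> S i j \<omega> \<and> real i - 1 \<le> U i j \<omega>)" for i j
  proof (cases "1 \<le> i \<and> 1 \<le> j")
    case True
    then have [measurable]: "S i j \<in> borel_measurable M" "U i j \<in> borel_measurable M"
      using measurable_S measurable_U by auto
    show ?thesis by measurable
  qed auto
  have 2: "Measurable.pred M (\<lambda>\<omega>. 1 \<le> i \<longrightarrow> real m < arr i j \<omega>)" for i j and m :: nat
  proof (cases "1 \<le> i")
    case True
    then have [measurable]: "arr i j \<in> borel_measurable M" by (rule measurable_arr)
    show ?thesis by measurable
  qed auto
  have 3: "Measurable.pred M (\<lambda>\<omega>. 1 \<le> i \<and> arr i 1 \<omega> \<le> c)" for i c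
  proof (cases "1 \<le> i")
    case True
    then have [measurable]: "arr i 1 \<in> borel_measurable M" by (rule measurable_arr)
    show ?thesis by measurable
  qed auto
  have "Measurable.pred M (\<lambda>\<omega>. (\<forall>i j. 1 \<le> i \<longrightarrow> 1 \<le> j \<longrightarrow> 0 \<le> S i j \<omega> \<and> real i - 1 \<le> U i j \<omega>) \<and>
      (\<forall>i m. \<exists>j. 1 \<le> i \<longrightarrow> real m < arr i j \<omega>) \<and> (\<forall>m. \<exists>i. 1 \<le> i \<and> arr i 1 \<omega> \<le> 1 / real (Suc m)))"
    by (intro pred_intros_logic pred_intros_countable 1 2 3)
  also have "(\<lambda>\<omega>. (\<forall>i j. 1 \<le> i \<longrightarrow> 1 \<le> j \<longrightarrow> 0 \<le> S i j \<omega> \<and> real i - 1 \<le> U i j \<omega>) \<and>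
      (\<forall>i m. \<exists>j. 1 \<le> i \<longrightarrow> real m < arr i j \<omega>) \<and> (\<forall>m. \<exists>i. 1 \<le> i \<and> arr i 1 \<omega> \<le> 1 / real (Suc m))) = good"
    by (auto simp: good_def fun_eq_iff)
  finally show ?thesis .
qed

lemma AE_arr_unbounded: "1 \<le> i \<Longrightarrow> AE \<omega> in M. \<exists>j. real m < arr i j \<omega>"
proof -
  assume i: "1 \<le> i"
  have [measurable]: "arr i j \<in> borel_measurable M" for j by (rule measurable_arr[OF i])
  have "\<P>(\<omega> in M. \<forall>j. arr i j \<omega> \<le> real m) \<le> 0"
  proof (rule LIMSEQ_le_const)
    show "(\<lambda>j. \<P>(\<omega> in M. arr i j \<omega> \<le> real m)) \<longlonglongrightarrow> 0"
      using marked_renewal.prob_arrival_le_tendsto[OF row[OF i], of "real m"] by (simp add: arrival_row[OF i])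
    show "\<exists>N. \<forall>n\<ge>N. \<P>(\<omega> in M. \<forall>j. arr i j \<omega> \<le> real m) \<le> \<P>(\<omega> in M. arr i n \<omega> \<le> real m)"
      by (intro exI allI impI finite_measure_mono) auto
  qed
  then have "\<P>(\<omega> in M. \<forall>j. arr i j \<omega> \<le> real m) = 0" by (simp add: measure_le_0_iff)
  then have "AE \<omega> in M. \<not> (\<forall>j. arr i j \<omega> \<le> real m)"
    by (subst (asm) prob_eq_0) auto
  then show ?thesis by (simp add: not_le)
qed

text \<open>The first gaps of the rows are independent and exponential, so all of the first I rows
  are late with probability exp (- c \<theta>) ^ I, which tends to 0.\<close>

lemma AE_early_arrival:
  assumes c: "0 < c"
  shows "AE \<omega> in M. \<exists>i\<ge>1. arr i 1 \<omega> \<le> c"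
proof -
  let ?X = "\<lambda>(i, j, b). if b then U i j else S i j"
  have arr1: "arr i 1 = S i 1" for i by (simp add: arr_def fun_eq_iff)
  have bound: "\<P>(\<omega> in M. \<forall>i\<in>{1..I}. c < S i 1 \<omega>) = exp (- c * \<theta>) ^ I" if I: "1 \<le> I" for I
  proof -
    have "{\<omega> \<in> space M. \<forall>i\<in>{1..I}. c < S i 1 \<omega>} =
        (\<Inter>q\<in>(\<lambda>i. (i, 1 :: nat, False)) ` {1..I}. ?X q -` {c<..} \<inter> space M)" using I by auto
    also have "prob \<dots> = (\<Prod>q\<in>(\<lambda>i. (i, 1 :: nat, False)) ` {1..I}. prob (?X q -` {c<..} \<inter> space M))"
      using I by (intro indep_varsD[OF indep]) auto
    also have "\<dots> = (\<Prod>i=1..I. exp (- c * \<theta>))"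
    proof (subst prod.reindex)
      show "(\<Prod>i=1..I. ((\<lambda>q. prob (?X q -` {c<..} \<inter> space M)) \<circ> (\<lambda>i. (i, 1, False))) i) = (\<Prod>i=1..I. exp (- c * \<theta>))"
      proof (intro prod.cong refl)
        fix i assume "i \<in> {1..I}"
        then have i: "1 \<le> i" by simp
        have "((\<lambda>q. prob (?X q -` {c<..} \<inter> space M)) \<circ> (\<lambda>i. (i, 1, False))) i = \<P>(\<omega> in M. c < S i 1 \<omega>)"
          by (auto intro!: arg_cong[where f = prob])
        then show "((\<lambda>q. prob (?X q -` {c<..} \<inter> space M)) \<circ> (\<lambda>i. (i, 1, False))) i = exp (- c * \<theta>)"
          using exponential_distributedD_gt[OF dist_S[OF i order_refl] less_imp_le[OF c] \<theta>] by simp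
      qed
    qed (auto simp: inj_on_def)
    finally show ?thesis by simp
  qed
  have fin: "{\<omega> \<in> space M. \<forall>i\<in>{1..I}. c < S i 1 \<omega>} \<in> events" for I :: nat
    by (intro sets.sets_Collect_finite_All borel_measurable_less measurable_S) auto
  have pi: "Measurable.pred M (\<lambda>\<omega>. 1 \<le> i \<longrightarrow> c < S i 1 \<omega>)" for i
  proof (cases "1 \<le> i")
    case True
    then have [measurable]: "S i 1 \<in> borel_measurable M" by (intro measurable_S) auto
    show ?thesis by measurable
  qed auto
  have "Measurable.pred M (\<lambda>\<omega>. \<forall>i. 1 \<le> i \<longrightarrow> c < S i 1 \<omega>)"
    by (intro pred_intros_countable pi)
  then have all: "{\<omega> \<in> space M. \<forall>i. 1 \<le> i \<longrightarrow> c < S i 1 \<omega>} \<in> events"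
    unfolding pred_def .
  have "\<P>(\<omega> in M. \<forall>i. 1 \<le> i \<longrightarrow> c < S i 1 \<omega>) \<le> 0"
  proof (rule LIMSEQ_le_const)
    have "exp (- c * \<theta>) < 1" using c \<theta> by simp
    then show "(\<lambda>I. exp (- c * \<theta>) ^ I) \<longlonglongrightarrow> 0" by (intro LIMSEQ_power_zero) simp
    show "\<exists>N. \<forall>n\<ge>N. \<P>(\<omega> in M. \<forall>i. 1 \<le> i \<longrightarrow> c < S i 1 \<omega>) \<le> exp (- c * \<theta>) ^ n"
    proof (intro exI[of _ 1] allI impI)
      fix n :: nat assume "1 \<le> n"
      show "\<P>(\<omega> in M. \<forall>i. 1 \<le> i \<longrightarrow> c < S i 1 \<omega>) \<le> exp (- c * \<theta>) ^ n"
        unfolding bound[OF \<open>1 \<le> n\<close>, symmetric] by (intro finite_measure_mono fin) auto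
    qed
  qed
  then have "\<P>(\<omega> in M. \<forall>i. 1 \<le> i \<longrightarrow> c < S i 1 \<omega>) = 0" by (simp add: measure_le_0_iff)
  then have "AE \<omega> in M. \<omega> \<notin> {\<omega> \<in> space M. \<forall>i. 1 \<le> i \<longrightarrow> c < S i 1 \<omega>}"
    unfolding prob_eq_0[OF all] .
  then show ?thesis
    using AE_space
  proof eventually_elim
    case (elim \<omega>)
    then show ?case unfolding arr1 by (simp add: not_less)
  qed
qed

lemma AE_good: "AE \<omega> in M. good \<omega>"
proof -
  have "AE \<omega> in M. \<forall>i j. 1 \<le> i \<longrightarrow> 1 \<le> j \<longrightarrow> 0 \<le> S i j \<omega> \<and> real i - 1 \<le> U i j \<omega>"
    unfolding AE_all_countable
  proof (intro allI)
    fix i j :: nat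
    show "AE \<omega> in M. 1 \<le> i \<longrightarrow> 1 \<le> j \<longrightarrow> 0 \<le> S i j \<omega> \<and> real i - 1 \<le> U i j \<omega>"
    proof (cases "1 \<le> i \<and> 1 \<le> j")
      case True
      then have "AE \<omega> in M. 0 < S i j \<omega>" "AE \<omega> in M. real i - 1 \<le> U i j \<omega>"
        using marked_renewal.AE_s_pos[OF row] AE_U_ge by auto
      then show ?thesis by eventually_elim auto
    qed auto
  qed
  moreover have "AE \<omega> in M. \<forall>i m. 1 \<le> i \<longrightarrow> (\<exists>j. real m < arr i j \<omega>)"
    unfolding AE_all_countable using AE_arr_unbounded by auto
  moreover have "AE \<omega> in M. \<forall>m. \<exists>i\<ge>1. arr i 1 \<omega> \<le> 1 / real (Suc m)"
    unfolding AE_all_countable by (intro allI AE_early_arrival) simp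
  ultimately show ?thesis by eventually_elim (auto simp: good_def)
qed

text \<open>The value \<open>0\<close> off the almost sure event makes every path real-valued and cadlag at positive
  times.\<close>

definition minimum_process :: "real \<Rightarrow> 'b \<Rightarrow> ereal" where
  "minimum_process t \<omega> = (if good \<omega>
     then INF (i, j)\<in>pos_pairs. if arr i j \<omega> \<le> t then ereal (U i j \<omega>) else \<infinity> else 0)"

lemma measurable_minimum_process: "minimum_process t \<in> borel_measurable M"
proof -
  have "(\<lambda>\<omega>. INF (i, j)\<in>pos_pairs. if arr i j \<omega> \<le> t then ereal (U i j \<omega>) else \<infinity>) \<in> borel_measurable M"
  proof (intro borel_measurable_INF)
    fix p :: "nat \<times> nat" assume "p \<in> pos_pairs"
    then obtain i j where p: "p = (i, j)" "1 \<le> i" "1 \<le> j" by auto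
    have [measurable]: "arr i j \<in> borel_measurable M" "U i j \<in> borel_measurable M"
      using p measurable_arr measurable_U by auto
    show "(\<lambda>\<omega>. case p of (i, j) \<Rightarrow> if arr i j \<omega> \<le> t then ereal (U i j \<omega>) else \<infinity>) \<in> borel_measurable M"
      unfolding p(1) prod.case by measurable
  qed auto
  then show ?thesis unfolding minimum_process_def by measurable
qed

lemma le_minimum_process_iff:
  assumes "good \<omega>"
  shows "ereal y \<le> minimum_process t \<omega> \<longleftrightarrow> (\<forall>i\<ge>1. \<forall>j\<ge>1. arr i j \<omega> \<le> t \<longrightarrow> y \<le> U i j \<omega>)"
  using assms by (auto simp: minimum_process_def le_INF_iff)

lemma minimum_process_extremal: "extremal_process M (\<lambda>\<tau>. exp (- \<theta> * \<tau>)) minimum_process"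
  unfolding extremal_process_def
proof (intro conjI allI impI measurable_minimum_process)
  fix k :: nat and t y :: "nat \<Rightarrow> real"
  assume k: "1 \<le> k" and *: "0 \<le> t 1 \<and> (\<forall>i\<in>{1..<k}. t i < t (i + 1)) \<and> (\<forall>i\<in>{1..k}. 0 \<le> y i)"
  then have st: "staircase k t y" by unfold_locales auto
  have "\<P>(\<omega> in M. \<forall>i\<in>{1..k}. ereal (y i) \<le> minimum_process (t i) \<omega>) =
      \<P>(\<omega> in M. \<forall>i\<ge>1. \<forall>j\<ge>1. (arr i j \<omega>, U i j \<omega>) \<in> - stair k t y)"
  proof (rule measure_eq_AE)
    show "AE \<omega> in M. \<omega> \<in> {\<omega> \<in> space M. \<forall>i\<in>{1..k}. ereal (y i) \<le> minimum_process (t i) \<omega>} \<longleftrightarrow>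
      \<omega> \<in> {\<omega> \<in> space M. \<forall>i\<ge>1. \<forall>j\<ge>1. (arr i j \<omega>, U i j \<omega>) \<in> - stair k t y}"
      using AE_good
    proof eventually_elim
      case (elim \<omega>)
      have "(\<forall>i\<in>{1..k}. ereal (y i) \<le> minimum_process (t i) \<omega>) \<longleftrightarrow>
          (\<forall>i\<ge>1. \<forall>j\<ge>1. (arr i j \<omega>, U i j \<omega>) \<in> - stair k t y)"
        unfolding le_minimum_process_iff[OF elim] by (auto simp: stair_def not_less)
      then show ?case by auto
    qed
    show "{\<omega> \<in> space M. \<forall>i\<in>{1..k}. ereal (y i) \<le> minimum_process (t i) \<omega>} \<in> events"
      using measurable_minimum_process by (intro sets.sets_Collect_finite_All borel_measurable_le) auto
  qed (rule sets_avoid)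
  then show "\<P>(\<omega> in M. \<forall>i\<in>{1..k}. ereal (y i) \<le> minimum_process (t i) \<omega>) =
      exp (- \<theta> * Max (y ` {1..k})) powr t 1 *
      (\<Prod>i=2..k. exp (- \<theta> * Max (y ` {i..k})) powr (t i - t (i - 1)))"
    unfolding exp_stair_area[OF k] prob_avoid[OF st] .
qed

text \<open>The height b bounds the row number, since marks of row i are at least i - 1; within a
  row the arrivals increase and pass a at some index.\<close>

lemma finite_early_low:
  assumes "good \<omega>"
  shows "finite {(i, j). 1 \<le> i \<and> 1 \<le> j \<and> arr i j \<omega> \<le> a \<and> U i j \<omega> < b}"
proof -
  from assms have S0: "\<And>i j. 1 \<le> i \<Longrightarrow> 1 \<le> j \<Longrightarrow> 0 \<le> S i j \<omega>"
    and U: "\<And>i j. 1 \<le> i \<Longrightarrow> 1 \<le> j \<Longrightarrow> real i - 1 \<le> U i j \<omega>"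
    and unb: "\<And>i m. 1 \<le> i \<Longrightarrow> \<exists>j. real m < arr i j \<omega>" by (auto simp: good_def)
  obtain m where m: "a \<le> real m" using real_arch_simple by blast
  obtain B where B: "b + 1 \<le> real B" using real_arch_simple by blast
  define J where "J i = (SOME j. real m < arr i j \<omega>)" for i
  have J: "real m < arr i (J i) \<omega>" if "1 \<le> i" for i
    unfolding J_def using unb[OF that] by (rule someI_ex)
  have "{(i, j). 1 \<le> i \<and> 1 \<le> j \<and> arr i j \<omega> \<le> a \<and> U i j \<omega> < b} \<subseteq> (SIGMA i:{..B}. {..J i})"
  proof
    fix p assume "p \<in> {(i, j). 1 \<le> i \<and> 1 \<le> j \<and> arr i j \<omega> \<le> a \<and> U i j \<omega> < b}"
    then obtain i j where p: "p = (i, j)" and ij: "1 \<le> i" "1 \<le> j" "arr i j \<omega> \<le> a" "U i j \<omega> < b" by auto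
    have "i \<in> {..B}" using U[OF ij(1,2)] ij(4) B by simp
    moreover have "j \<in> {..J i}"
    proof (rule ccontr)
      assume "j \<notin> {..J i}"
      then have "arr i (J i) \<omega> \<le> arr i j \<omega>"
        unfolding arr_def using S0 ij(1) by (intro sum_mono2) auto
      with J[OF ij(1)] ij(3) m show False by linarith
    qed
    ultimately show "p \<in> (SIGMA i:{..B}. {..J i})" using p by simp
  qed
  then show ?thesis by (rule finite_subset) auto
qed

lemma minimum_process_finite:
  assumes "good \<omega>" "0 < t"
  shows "0 \<le> minimum_process t \<omega>" "minimum_process t \<omega> < \<infinity>"
proof -
  show "0 \<le> minimum_process t \<omega>"
    unfolding zero_ereal_def le_minimum_process_iff[OF assms(1)]
  proof (intro allI impI)
    fix i j :: nat assume ij: "1 \<le> i" "1 \<le> j"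
    then have "real i - 1 \<le> U i j \<omega>" using assms(1) by (simp add: good_def)
    with ij show "0 \<le> U i j \<omega>" by linarith
  qed
  obtain m where m: "1 / real (Suc m) < t"
    using reals_Archimedean[OF assms(2)] by (auto simp: inverse_eq_divide)
  obtain i where i: "1 \<le> i" "arr i 1 \<omega> \<le> 1 / real (Suc m)" using assms(1) unfolding good_def by blast
  have "minimum_process t \<omega> \<le> (case (i, 1) of (i, j) \<Rightarrow> if arr i j \<omega> \<le> t then ereal (U i j \<omega>) else \<infinity>)"
    unfolding minimum_process_def if_P[OF assms(1)] using i(1) by (intro INF_lower) auto
  also have "\<dots> < \<infinity>" using i(2) m by simp
  finally show "minimum_process t \<omega> < \<infinity>" .
qed

lemma minimum_process_antimono: "x \<le> y \<Longrightarrow> minimum_process y \<omega> \<le> minimum_process x \<omega>"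
  unfolding minimum_process_def by (auto intro!: INF_mono')

text \<open>Only finitely many points below the current minimum v arrive by time \<tau> + 1, and all
  of them arrive strictly after \<tau>, as an earlier one would have lowered the minimum. \<delta>
  is the shortest wait for one of them, capped at 1.\<close>

lemma minimum_process_right_const:
  assumes g: "good \<omega>" and \<tau>: "0 < \<tau>"
  obtains \<delta> where "0 < \<delta>" "\<And>r. \<tau> < r \<Longrightarrow> r < \<tau> + \<delta> \<Longrightarrow> minimum_process r \<omega> = minimum_process \<tau> \<omega>"
proof -
  obtain v where v: "minimum_process \<tau> \<omega> = ereal v"
    using minimum_process_finite[OF g \<tau>] by (cases "minimum_process \<tau> \<omega>") auto
  define A where "A = {(i, j). 1 \<le> i \<and> 1 \<le> j \<and> arr i j \<omega> \<le> \<tau> + 1 \<and> U i j \<omega> < v}"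
  have A: "finite A" unfolding A_def by (rule finite_early_low[OF g])
  have v_le: "v \<le> U i j \<omega>" if "1 \<le> i" "1 \<le> j" "arr i j \<omega> \<le> \<tau>" for i j
    using le_minimum_process_iff[OF g, of v \<tau>] v that by auto
  define \<delta> where "\<delta> = Min (insert 1 ((\<lambda>(i, j). arr i j \<omega> - \<tau>) ` A))"
  have pos: "0 < \<delta>"
    unfolding \<delta>_def using A v_le by (subst Min_gr_iff) (force simp: A_def)+
  have \<delta>_le: "\<delta> \<le> 1" "\<And>i j. (i, j) \<in> A \<Longrightarrow> \<delta> \<le> arr i j \<omega> - \<tau>"
  proof -
    show "\<delta> \<le> 1" unfolding \<delta>_def using A by (intro Min_le) auto
    fix i j assume "(i, j) \<in> A"
    then have "arr i j \<omega> - \<tau> \<in> (\<lambda>(i, j). arr i j \<omega> - \<tau>) ` A" by force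
    then show "\<delta> \<le> arr i j \<omega> - \<tau>" unfolding \<delta>_def using A by (intro Min_le) auto
  qed
  have "minimum_process r \<omega> = minimum_process \<tau> \<omega>" if r: "\<tau> < r" "r < \<tau> + \<delta>" for r
  proof (rule antisym)
    show "minimum_process r \<omega> \<le> minimum_process \<tau> \<omega>" using r by (intro minimum_process_antimono) simp
    show "minimum_process \<tau> \<omega> \<le> minimum_process r \<omega>"
      unfolding v le_minimum_process_iff[OF g]
    proof (intro allI impI)
      fix i j :: nat assume ij: "1 \<le> i" "1 \<le> j" "arr i j \<omega> \<le> r"
      show "v \<le> U i j \<omega>"
      proof (rule ccontr)
        assume "\<not> v \<le> U i j \<omega>"
        then have "(i, j) \<in> A" using ij r \<delta>_le(1) by (auto simp: A_def)
        with \<delta>_le(2)[of i j] ij r show False by simp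
      qed
    qed
  qed
  with that pos show thesis by blast
qed

lemma minimum_path_decr:
  assumes s: "0 < s"
  shows "path_from s (\<lambda>t \<omega>. real_of_ereal (minimum_process t \<omega>)) \<omega> \<in> decr_paths"
    (is "?g \<in> _")
proof -
  have g: "?g t = real_of_ereal (minimum_process (s + t) \<omega>)" if "0 \<le> t" for t
    using that by (simp add: path_from_def)
  have decr: "?g y \<le> ?g x" if "0 \<le> x" "x \<le> y" for x y
  proof (cases "good \<omega>")
    case True
    have xy: "0 < s + x" "0 < s + y" using s that by auto
    have "minimum_process (s + y) \<omega> \<le> minimum_process (s + x) \<omega>" using that by (intro minimum_process_antimono) simp
    then show ?thesis
      using that minimum_process_finite[OF True xy(1)] minimum_process_finite[OF True xy(2)]
      by (subst (1 2) g) (auto intro: real_of_ereal_positive_mono)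
  next
    case False
    then show ?thesis using that by (subst (1 2) g) (auto simp: minimum_process_def)
  qed
  have right: "(?g \<longlongrightarrow> ?g t) (at_right t)" if t: "0 \<le> t" for t
  proof (rule tendsto_eventually)
    show "\<forall>\<^sub>F r in at_right t. ?g r = ?g t"
    proof (cases "good \<omega>")
      case True
      have st: "0 < s + t" using s t by simp
      obtain \<delta> where \<delta>: "0 < \<delta>"
        "\<And>r. s + t < r \<Longrightarrow> r < s + t + \<delta> \<Longrightarrow> minimum_process r \<omega> = minimum_process (s + t) \<omega>"
        using minimum_process_right_const[OF True st] by blast
      have "?g r = ?g t" if "t < r" "r < t + \<delta>" for r
        using \<delta>(2)[of "s + r"] that t by (simp add: g)
      then show ?thesis unfolding eventually_at_right_field using \<delta>(1) by (intro exI[of _ "t + \<delta>"]) auto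
    next
      case False
      then have "minimum_process r \<omega> = 0" for r by (simp add: minimum_process_def)
      then have "?g r = ?g t" if "t < r" "r < t + 1" for r
        using that t by (simp add: g)
      then show ?thesis unfolding eventually_at_right_field by (intro exI[of _ "t + 1"]) auto
    qed
  qed
  have left: "\<exists>l. (?g \<longlongrightarrow> l) (at_left t)" if "0 < t" for t
    by (rule antimono_left_limit[OF that decr])
  have "?g \<in> extensional {0..}" by (simp add: path_from_def)
  with right left have "?g \<in> cadlag" unfolding cadlag_def by blast
  with decr show ?thesis by (simp add: decr_paths_def)
qed

lemma minimum_process_cadlag:
  assumes s: "0 < s"
  shows "cadlag_from M s minimum_process"
  unfolding cadlag_from_def
proof (intro conjI allI impI ballI)
  fix t \<omega> assume "s \<le> t"
  with s have "0 < t" by simp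
  show "\<bar>minimum_process t \<omega>\<bar> \<noteq> \<infinity>"
  proof (cases "good \<omega>")
    case True
    from minimum_process_finite[OF this \<open>0 < t\<close>] show ?thesis by auto
  qed (simp add: minimum_process_def)
next
  show "path_from s (\<lambda>t \<omega>. real_of_ereal (minimum_process t \<omega>)) \<in> M \<rightarrow>\<^sub>M borel_of M1_topology"
  proof (rule measurable_decr_path[OF minimum_path_decr[OF s]])
    fix t :: real assume t: "0 \<le> t"
    have "(\<lambda>\<omega>. real_of_ereal (minimum_process (s + t) \<omega>)) \<in> borel_measurable M"
      using measurable_minimum_process by measurable
    then show "(\<lambda>\<omega>. path_from s (\<lambda>t \<omega>. real_of_ereal (minimum_process t \<omega>)) \<omega> t) \<in> borel_measurable M"
      using t by (simp add: path_from_def)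
  qed
qed

end

section \<open>The convergence theorem\<close>

text \<open>By right continuity a violated inequality at real times x < y persists at rationals q
  and q' slightly to the right, with x < q < y < q'.\<close>

lemma decr_path_from_rationals:
  fixes g :: "real \<Rightarrow> real"
  assumes g: "g \<in> cadlag"
    and decr: "\<And>q q' :: rat. 0 \<le> q \<Longrightarrow> q < q' \<Longrightarrow> g (of_rat q') \<le> g (of_rat q)"
    and nonneg: "\<And>q :: rat. 0 \<le> q \<Longrightarrow> 0 \<le> g (of_rat q)"
  shows "g \<in> nonneg_decr_paths"
proof -
  have near: "\<exists>q :: rat. x < of_rat q \<and> of_rat q < b \<and> P (g (of_rat q))"
    if "0 \<le> x" and xb: "x < b" and ev: "\<forall>\<^sub>F r in at_right x. P (g r)" for x b :: real and P
  proof -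
    obtain c where c: "x < c" "\<And>r. x < r \<Longrightarrow> r < c \<Longrightarrow> P (g r)"
      using ev unfolding eventually_at_right_field by auto
    obtain q :: rat where "x < of_rat q" "of_rat q < min b c" using of_rat_dense[of x "min b c"] xb c(1) by auto
    with c(2) show ?thesis by auto
  qed
  have le: "g y \<le> g x" if xy: "0 \<le> x" "x \<le> y" for x y
  proof (rule ccontr)
    assume "\<not> g y \<le> g x"
    then have less: "g x < g y" and "x < y" using xy by (auto simp: le_less not_le)
    obtain c where c: "g x < c" "c < g y" using dense[OF less] by blast
    have "\<forall>\<^sub>F r in at_right x. g r < c" using cadlag_right[OF g xy(1)] c(1) by (rule order_tendstoD)
    from near[OF xy(1) \<open>x < y\<close> this] obtain q :: rat where q: "x < of_rat q" "of_rat q < y" "g (of_rat q) < c" by blast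
    have "\<forall>\<^sub>F r in at_right y. c < g r" using cadlag_right[OF g] xy c(2) by (intro order_tendstoD(1)[of g "g y"]) auto
    from near[OF _ _ this, of "y + 1"] xy obtain q' :: rat where q': "y < of_rat q'" "c < g (of_rat q')" by auto
    have "0 < (of_rat q :: real)" "(of_rat q :: real) < of_rat q'" using q q' xy by linarith+
    then have "0 \<le> q" "q < q'" by (auto simp: of_rat_less)
    from decr[OF this] q q' show False by linarith
  qed
  moreover have "0 \<le> g x" if x: "0 \<le> x" for x
  proof (rule ccontr)
    assume "\<not> 0 \<le> g x"
    then have "\<forall>\<^sub>F r in at_right x. g r < 0" using cadlag_right[OF g x] by (intro order_tendstoD(2)[of g "g x"]) auto
    from near[OF x _ this, of "x + 1"] obtain q :: rat where q: "x < of_rat q" "g (of_rat q) < 0" by auto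
    then have "0 < (of_rat q :: real)" using x by linarith
    then have "0 \<le> q" by simp
    from nonneg[OF this] q show False by linarith
  qed
  ultimately show ?thesis using g by (auto simp: nonneg_decr_paths_def decr_paths_def)
qed

section \<open>Extremal processes on an arbitrary probability space\<close>

context
  fixes Q :: "'c measure" and Z :: "real \<Rightarrow> 'c \<Rightarrow> ereal" and \<theta> :: real
  assumes Q: "prob_space Q" and Z: "extremal_process Q (\<lambda>\<tau>. exp (- \<theta> * \<tau>)) Z"
begin

interpretation Q: prob_space Q by (rule Q)

lemma extremal_prob:
  assumes k: "1 \<le> k" and t: "0 \<le> t 1" "\<And>i. i \<in> {1..<k} \<Longrightarrow> t i < t (i + 1)" "\<And>i. i \<in> {1..k} \<Longrightarrow> 0 \<le> y i"
  shows "measure Q {\<omega> \<in> space Q. \<forall>i\<in>{1..k}. ereal (y i) \<le> Z (t i) \<omega>} = exp (- \<theta> * stair_area k t y)"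
proof -
  have "measure Q {\<omega> \<in> space Q. \<forall>i\<in>{1..k}. ereal (y i) \<le> Z (t i) \<omega>} =
      exp (- \<theta> * Max (y ` {1..k})) powr t 1 *
      (\<Prod>i=2..k. exp (- \<theta> * Max (y ` {i..k})) powr (t i - t (i - 1)))"
    using Z k t unfolding extremal_process_def by blast
  then show ?thesis unfolding exp_stair_area[OF k] .
qed

lemma measurable_extremal: "0 \<le> t \<Longrightarrow> Z t \<in> borel_measurable Q"
  using Z by (simp add: extremal_process_def)

lemma sets_extremal_ge: "0 \<le> t \<Longrightarrow> {\<omega> \<in> space Q. ereal y \<le> Z t \<omega>} \<in> sets Q"
  using measurable_extremal by (intro borel_measurable_le) auto

lemma extremal_one:
  assumes "0 \<le> t" "0 \<le> y"
  shows "measure Q {\<omega> \<in> space Q. ereal y \<le> Z t \<omega>} = exp (- \<theta> * (y * t))"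
  using extremal_prob[of 1 "\<lambda>_. t" "\<lambda>_. y"] assms by (simp add: stair_area_def grid_def)

text \<open>The staircase only sees the largest later bound, so the smaller bound x at the earlier
  time drops out of the probability.\<close>

lemma extremal_two:
  assumes "0 \<le> t" "t < t'" "0 \<le> x" "x \<le> y"
  shows "measure Q {\<omega> \<in> space Q. ereal x \<le> Z t \<omega> \<and> ereal y \<le> Z t' \<omega>} = exp (- \<theta> * (y * t'))"
proof -
  let ?t = "\<lambda>i :: nat. if i = 1 then t else t'" and ?y = "\<lambda>i :: nat. if i = 1 then x else y"
  have 12: "{1..2 :: nat} = {1, 2}" "{Suc 0..2} = {1, 2}" "{Suc 1..2 :: nat} = {2}" "{Suc (Suc 0)..2 :: nat} = {2}"
    "{..<2 :: nat} = {0, 1}" by auto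
  have "measure Q {\<omega> \<in> space Q. \<forall>i\<in>{1..2}. ereal (?y i) \<le> Z (?t i) \<omega>} = exp (- \<theta> * stair_area 2 ?t ?y)"
    using assms by (intro extremal_prob) auto
  also have "{\<omega> \<in> space Q. \<forall>i\<in>{1..2}. ereal (?y i) \<le> Z (?t i) \<omega>} =
      {\<omega> \<in> space Q. ereal x \<le> Z t \<omega> \<and> ereal y \<le> Z t' \<omega>}" unfolding 12 by auto
  also have "stair_area 2 ?t ?y = y * t'"
    using assms unfolding stair_area_def 12 by (simp add: grid_def 12 max_absorb2 algebra_simps)
  finally show ?thesis .
qed

lemma AE_extremal_nonneg: "0 \<le> t \<Longrightarrow> AE \<omega> in Q. 0 \<le> Z t \<omega>"
proof -
  assume t: "0 \<le> t"
  have "measure Q {\<omega> \<in> space Q. ereal 0 \<le> Z t \<omega>} = 1" using extremal_one[OF t, of 0] by simp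
  then have "AE \<omega> in Q. \<omega> \<in> {\<omega> \<in> space Q. ereal 0 \<le> Z t \<omega>}"
    using Q.prob_eq_1[OF sets_extremal_ge[OF t]] by blast
  then show ?thesis by eventually_elim (simp add: zero_ereal_def)
qed

text \<open>Raising the bound at the earlier time from 0 to y does not change the probability, by
  \<open>extremal_two\<close>; the difference of the two nested events is null.\<close>

lemma AE_extremal_decr:
  assumes t: "0 \<le> t" "t < t'" and y: "0 \<le> y"
  shows "AE \<omega> in Q. ereal y \<le> Z t' \<omega> \<longrightarrow> ereal y \<le> Z t \<omega>"
proof -
  let ?A = "{\<omega> \<in> space Q. ereal y \<le> Z t \<omega> \<and> ereal y \<le> Z t' \<omega>}"
  let ?B = "{\<omega> \<in> space Q. ereal 0 \<le> Z t \<omega> \<and> ereal y \<le> Z t' \<omega>}"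
  have A: "?A \<in> sets Q" and B: "?B \<in> sets Q"
    using t by (auto intro!: sets.sets_Collect_conj sets_extremal_ge)
  have sub: "?A \<subseteq> ?B" using y by (auto intro: order_trans[of "ereal 0" "ereal y"])
  have "measure Q (?B - ?A) = 0"
    using Q.finite_measure_Diff[OF B A sub] extremal_two[OF t y order_refl] extremal_two[OF t order_refl y] by simp
  then have "AE \<omega> in Q. \<omega> \<notin> ?B - ?A" using Q.prob_eq_0[of "?B - ?A"] A B by blast
  then show ?thesis
    using AE_extremal_nonneg[OF t(1)] AE_space
    by eventually_elim (auto simp: zero_ereal_def)
qed

text \<open>At time 0 the survival function is constantly 1, so \<open>Z 0\<close> almost surely
  exceeds every integer.\<close>

lemma extremal_not_real_at_0: "\<not> cadlag_from Q 0 Z"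
proof
  assume "cadlag_from Q 0 Z"
  then have fin: "\<And>\<omega>. \<omega> \<in> space Q \<Longrightarrow> \<bar>Z 0 \<omega>\<bar> \<noteq> \<infinity>" by (auto simp: cadlag_from_def)
  have "AE \<omega> in Q. \<forall>m :: nat. ereal (real m) \<le> Z 0 \<omega>"
    unfolding AE_all_countable
  proof
    fix m :: nat
    have "measure Q {\<omega> \<in> space Q. ereal (real m) \<le> Z 0 \<omega>} = 1" using extremal_one[of 0 "real m"] by simp
    then have "AE \<omega> in Q. \<omega> \<in> {\<omega> \<in> space Q. ereal (real m) \<le> Z 0 \<omega>}"
      using Q.prob_eq_1[OF sets_extremal_ge[of 0 "real m"]] by auto
    then show "AE \<omega> in Q. ereal (real m) \<le> Z 0 \<omega>" by eventually_elim simp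
  qed
  then have "AE \<omega> in Q. False"
    using AE_space
  proof eventually_elim
    case (elim \<omega>)
    obtain z where z: "Z 0 \<omega> = ereal z" using fin[OF elim(2)] by (cases "Z 0 \<omega>") auto
    obtain m where "z < real m" using reals_Archimedean2 by blast
    moreover have "real m \<le> z" using elim(1) z by (metis ereal_less_eq(3))
    ultimately show False by simp
  qed
  then show False by simp
qed

text \<open>Monotonicity is known almost surely for each pair of times and each level. Rational
  offsets and rational levels keep the null sets countable in number, and right continuity does the
  rest.\<close>

lemma extremal_path_decr:
  assumes s: "0 < s" and cad: "cadlag_from Q s Z"
  shows "AE \<omega> in Q. path_from s (\<lambda>t \<omega>. real_of_ereal (Z t \<omega>)) \<omega> \<in> nonneg_decr_paths"
proof -
  let ?g = "path_from s (\<lambda>t \<omega>. real_of_ereal (Z t \<omega>))"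
  have meas: "?g \<in> Q \<rightarrow>\<^sub>M borel_of M1_topology"
    and fin: "\<And>t \<omega>. s \<le> t \<Longrightarrow> \<omega> \<in> space Q \<Longrightarrow> \<bar>Z t \<omega>\<bar> \<noteq> \<infinity>"
    using cad by (auto simp: cadlag_from_def)
  have "AE \<omega> in Q. \<forall>q q' r :: rat. 0 \<le> q \<longrightarrow> q < q' \<longrightarrow> 0 \<le> r \<longrightarrow>
      ereal (of_rat r) \<le> Z (s + of_rat q') \<omega> \<longrightarrow> ereal (of_rat r) \<le> Z (s + of_rat q) \<omega>"
    unfolding AE_all_countable
  proof (intro allI)
    fix q q' r :: rat
    show "AE \<omega> in Q. 0 \<le> q \<longrightarrow> q < q' \<longrightarrow> 0 \<le> r \<longrightarrow>
      ereal (of_rat r) \<le> Z (s + of_rat q') \<omega> \<longrightarrow> ereal (of_rat r) \<le> Z (s + of_rat q) \<omega>"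
    proof (cases "0 \<le> q \<and> q < q' \<and> 0 \<le> r")
      case True
      then have "AE \<omega> in Q. ereal (of_rat r) \<le> Z (s + of_rat q') \<omega> \<longrightarrow> ereal (of_rat r) \<le> Z (s + of_rat q) \<omega>"
        using s by (intro AE_extremal_decr) (auto simp: of_rat_less)
      then show ?thesis by eventually_elim simp
    qed auto
  qed
  moreover have "AE \<omega> in Q. \<forall>q :: rat. 0 \<le> q \<longrightarrow> 0 \<le> Z (s + of_rat q) \<omega>"
    unfolding AE_all_countable
  proof
    fix q :: rat
    show "AE \<omega> in Q. 0 \<le> q \<longrightarrow> 0 \<le> Z (s + of_rat q) \<omega>"
      using AE_extremal_nonneg[of "s + of_rat q"] s by (cases "0 \<le> q") auto
  qed
  ultimately show ?thesis
    using AE_space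
  proof eventually_elim
    case (elim \<omega>)
    have g: "?g \<omega> (of_rat q) = real_of_ereal (Z (s + of_rat q) \<omega>)" "ereal (?g \<omega> (of_rat q)) = Z (s + of_rat q) \<omega>"
      if "0 \<le> q" for q :: rat
      using that fin[of "s + of_rat q" \<omega>] elim(3) by (auto simp: path_from_def ereal_real)
    show ?case
    proof (rule decr_path_from_rationals)
      show "?g \<omega> \<in> cadlag"
        using measurable_space[OF meas elim(3)] by (simp add: space_borel_of topspace_M1_topology)
      show nonneg: "0 \<le> ?g \<omega> (of_rat q)" if "0 \<le> q" for q :: rat
        using elim(2) that g(1)[OF that] by (simp add: real_of_ereal_pos)
      fix q q' :: rat assume q: "0 \<le> q" "q < q'"
      show "?g \<omega> (of_rat q') \<le> ?g \<omega> (of_rat q)"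
      proof (rule ccontr)
        assume "\<not> ?thesis"
        then obtain r :: rat where r: "?g \<omega> (of_rat q) < of_rat r" "of_rat r < ?g \<omega> (of_rat q')"
          using of_rat_dense[of "?g \<omega> (of_rat q)" "?g \<omega> (of_rat q')"] by (auto simp: not_le)
        have "0 < (of_rat r :: real)" using nonneg[OF q(1)] r(1) by linarith
        then have "0 \<le> r" by simp
        moreover have "ereal (of_rat r) \<le> Z (s + of_rat q') \<omega>"
          unfolding g(2)[OF order.trans[OF q(1) less_imp_le[OF q(2)]], symmetric] using r(2) by simp
        ultimately have "ereal (of_rat r) \<le> Z (s + of_rat q) \<omega>" using elim(1) q by blast
        then have "of_rat r \<le> ?g \<omega> (of_rat q)" unfolding g(2)[OF q(1), symmetric] by simp
        with r(1) show False by linarith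
      qed
    qed
  qed
qed

end

text \<open>The existence part shows that for s > 0 the convergence part is not vacuous; its process
  is built on R itself from the arrays behind N. Convergence is asserted for every version of the
  limit because only the finite-dimensional laws enter.\<close>

theorem proposition5p3:
  fixes P :: "'a measure" and X :: "nat \<Rightarrow> 'a \<Rightarrow> real" and u :: "nat \<Rightarrow> real \<Rightarrow> real"
    and R :: "'b measure" and N :: "'b \<Rightarrow> (real \<times> real) measure" and \<theta> :: real
  assumes "prob_space P" and "stationary_process P X"
    and "normalising_levels P X u"
    and "0 < \<theta>" and "\<theta> \<le> 1" and "extremal_index P X u \<theta>"
    and "prob_space R" and "mori_hsing_type R \<theta> N"
    and "converges_weakly (vague_topology quadrant) P (\<lambda>n. empirical_process X u (Suc n)) R N"
  shows "(\<exists>Z :: real \<Rightarrow> 'b \<Rightarrow> ereal.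
            extremal_process R (\<lambda>\<tau>. exp (- \<theta> * \<tau>)) Z \<and> (\<forall>s>0. cadlag_from R s Z)) \<and>
         (\<forall>(Q :: 'c measure) Z. \<forall>s\<ge>0.
            prob_space Q \<and> extremal_process Q (\<lambda>\<tau>. exp (- \<theta> * \<tau>)) Z \<and> cadlag_from Q s Z \<longrightarrow>
            converges_weakly M1_topology P
              (\<lambda>n. path_from s (max_process X u (Suc n)))
              Q (path_from s (\<lambda>t \<omega>. real_of_ereal (Z t \<omega>))))"
proof -
  obtain S U where SU: "marked_array R S U \<theta>"
    and null: "\<And>k t y. AE \<omega> in R. emeasure (N \<omega>) (stair k t y \<inter> quadrant) = 0 \<longleftrightarrow>
       (\<forall>i\<ge>1. \<forall>j\<ge>1. ((\<Sum>m=1..j. S i m \<omega>), U i j \<omega>) \<in> - stair k t y)"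
    using mori_hsing_marked_array[OF assms(7,4,8)] by blast
  interpret marked_array R S U \<theta> by (rule SU)
  interpret lv: levels P X u
    using assms(1-3) by (simp add: levels_def levels_axioms_def)
  define A where "A n k t y = {\<omega> \<in> space P. \<forall>l\<in>{1..k}. 0 \<le> t l \<longrightarrow> y l \<le> max_process X u (Suc n) (t l) \<omega>}"
    for n k and t y :: "nat \<Rightarrow> real"
  define B where "B k t y = {\<omega> \<in> space R. \<forall>i\<ge>1. \<forall>j\<ge>1. (arr i j \<omega>, U i j \<omega>) \<in> - stair k t y}" for k t y
  have n1: "1 \<le> Suc n" for n by simp
  have A_sets: "A n k t y \<in> sets P" for n k t y
    unfolding A_def
    by (intro sets.sets_Collect_finite_All sets.sets_Collect_imp sets.sets_Collect_const
        borel_measurable_le lv.measurable_max_process[OF n1]) auto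
  have A_iff: "AE \<omega> in P. \<omega> \<in> A n k t y \<longleftrightarrow>
      emeasure (empirical_process X u (Suc n) \<omega>) (stair k t y \<inter> quadrant) = 0" for n k t y
    using lv.AE_range[OF n1, of n] AE_space
  proof eventually_elim
    case (elim \<omega>)
    then show ?case using lv.empirical_null_iff[OF n1, of \<omega> n k t y] by (simp add: A_def)
  qed
  have B_sets: "B k t y \<in> sets R" for k t y unfolding B_def by (rule sets_avoid)
  have B_iff: "AE \<omega> in R. \<omega> \<in> B k t y \<longleftrightarrow> emeasure (N \<omega>) (stair k t y \<inter> quadrant) = 0" for k t y
    using null[of k t y] AE_space by eventually_elim (simp add: B_def arr_def)
  have void: "measure R (B k t y) = exp (- \<theta> * stair_area k t y)" if "staircase k t y" for k t y
    unfolding B_def by (rule prob_avoid[OF that])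
  note fidi = void_probabilities_tendsto[OF assms(1,7,9) A_sets A_iff B_sets B_iff void]
  have limit: "converges_weakly M1_topology P (\<lambda>n. path_from s (max_process X u (Suc n)))
      Q (path_from s (\<lambda>t \<omega>. real_of_ereal (Z t \<omega>)))"
    if s0: "0 \<le> s" and Q: "prob_space Q" and Z: "extremal_process Q (\<lambda>\<tau>. exp (- \<theta> * \<tau>)) Z"
      and cad: "cadlag_from Q s Z" for Q :: "'c measure" and Z s
  proof -
    \<comment> \<open>The case s = 0 contradicts real-valuedness. A positive s makes the first
      staircase time positive, as the limit of the void probabilities demands.\<close>
    have s: "0 < s" using s0 cad extremal_not_real_at_0[OF Q Z] by (cases "s = 0") auto
    have fin: "\<And>t \<omega>. s \<le> t \<Longrightarrow> \<omega> \<in> space Q \<Longrightarrow> \<bar>Z t \<omega>\<bar> \<noteq> \<infinity>"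
      and Zm: "path_from s (\<lambda>t \<omega>. real_of_ereal (Z t \<omega>)) \<in> Q \<rightarrow>\<^sub>M borel_of M1_topology"
      using cad by (auto simp: cadlag_from_def)
    show ?thesis
    proof (rule converges_weakly_decr_paths[OF assms(1) Q lv.measurable_path_max_process[OF n1 s0] Zm])
      show "(\<lambda>\<omega>. path_from s (max_process X u (Suc n)) \<omega> t) \<in> borel_measurable P" if "0 \<le> t" for n t
        using that lv.measurable_max_process[OF n1, of n "s + t"] by (simp add: path_from_def)
      show "(\<lambda>\<omega>. path_from s (\<lambda>t \<omega>. real_of_ereal (Z t \<omega>)) \<omega> t) \<in> borel_measurable Q" if "0 \<le> t" for t
      proof -
        have "Z (s + t) \<in> borel_measurable Q" using that s by (intro measurable_extremal[OF Q Z]) simp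
        then have "(\<lambda>\<omega>. real_of_ereal (Z (s + t) \<omega>)) \<in> borel_measurable Q" by measurable
        then show ?thesis using that by (simp add: path_from_def)
      qed
      show "AE \<omega> in P. path_from s (max_process X u (Suc n)) \<omega> \<in> nonneg_decr_paths" for n
        using lv.AE_range[OF n1, of n] by eventually_elim (rule lv.path_max_process_decr[OF n1 _ s0], blast)
      show "AE \<omega> in Q. path_from s (\<lambda>t \<omega>. real_of_ereal (Z t \<omega>)) \<omega> \<in> nonneg_decr_paths"
        by (rule extremal_path_decr[OF Q Z s cad])
      fix k and y :: "nat \<Rightarrow> real" assume y: "\<And>i. 0 \<le> y i"
      \<comment> \<open>Dyadic times are counted from 0 and staircase steps from 1; hence K is one
        more than the last dyadic index, and \<open>t\<close> and \<open>y'\<close> shift by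
        1.\<close>
      define K where "K = Suc (k * 2 ^ k)"
      define t where "t l = s + real (l - 1) / 2 ^ k" for l
      define y' where "y' l = y (l - 1)" for l
      have K1: "1 \<le> K" by (simp add: K_def)
      have t_pos: "0 < t l" and t_ge: "s \<le> t l" for l
        using s by (auto simp: t_def intro!: add_pos_nonneg)
      have t_mono: "t i < t (i + 1)" if "i \<in> {1..<K}" for i
        using that by (simp add: t_def divide_strict_right_mono)
      have st: "staircase K t y'"
        using t_pos[of 1] t_mono y by unfold_locales (auto simp: y'_def)
      have shift: "(\<forall>i\<in>{..k * 2 ^ k}. \<Phi> i) \<longleftrightarrow> (\<forall>l\<in>{1..K}. \<Phi> (l - 1))" for \<Phi> :: "nat \<Rightarrow> bool"
      proof
        assume *: "\<forall>l\<in>{1..K}. \<Phi> (l - 1)"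
        show "\<forall>i\<in>{..k * 2 ^ k}. \<Phi> i"
        proof
          fix i assume "i \<in> {..k * 2 ^ k}"
          then have "Suc i \<in> {1..K}" by (simp add: K_def)
          with * show "\<Phi> i" by fastforce
        qed
      qed (auto simp: K_def)
      have path: "path_from s (max_process X u (Suc n)) \<omega> (real (l - 1) / 2 ^ k) = max_process X u (Suc n) (t l) \<omega>"
        for n l \<omega> by (simp add: path_from_def t_def)
      have pathQ: "path_from s (\<lambda>t \<omega>. real_of_ereal (Z t \<omega>)) \<omega> (real (l - 1) / 2 ^ k) = real_of_ereal (Z (t l) \<omega>)"
        for l \<omega> by (simp add: path_from_def t_def)
      have eqP: "{\<omega> \<in> space P. \<forall>i\<in>{..k * 2 ^ k}. y i \<le> path_from s (max_process X u (Suc n)) \<omega> (real i / 2 ^ k)} =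
          A n K t y'" for n
        unfolding shift A_def path y'_def using less_imp_le[OF t_pos] by simp
      have "y' l \<le> real_of_ereal (Z (t l) \<omega>) \<longleftrightarrow> ereal (y' l) \<le> Z (t l) \<omega>" if "\<omega> \<in> space Q" for l \<omega>
        using fin[OF t_ge that, of l] by (cases "Z (t l) \<omega>") auto
      then have "{\<omega> \<in> space Q. \<forall>i\<in>{..k * 2 ^ k}. y i \<le> path_from s (\<lambda>t \<omega>. real_of_ereal (Z t \<omega>)) \<omega> (real i / 2 ^ k)} =
          {\<omega> \<in> space Q. \<forall>l\<in>{1..K}. ereal (y' l) \<le> Z (t l) \<omega>}"
        unfolding shift pathQ y'_def by auto
      moreover have "measure Q \<dots> = exp (- \<theta> * stair_area K t y')"
        using K1 t_pos[of 1] t_mono y by (intro extremal_prob[OF Q Z]) (auto simp: y'_def)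
      moreover have "(\<lambda>n. measure P (A n K t y')) \<longlonglongrightarrow> exp (- \<theta> * stair_area K t y')"
        by (rule fidi[OF _ st t_pos])
      ultimately show "(\<lambda>n. measure P {\<omega> \<in> space P. \<forall>i\<in>{..k * 2 ^ k}.
            y i \<le> path_from s (max_process X u (Suc n)) \<omega> (real i / 2 ^ k)})
          \<longlonglongrightarrow> measure Q {\<omega> \<in> space Q. \<forall>i\<in>{..k * 2 ^ k}.
            y i \<le> path_from s (\<lambda>t \<omega>. real_of_ereal (Z t \<omega>)) \<omega> (real i / 2 ^ k)}"
        unfolding eqP by simp
    qed
  qed
  show ?thesis
    using minimum_process_extremal minimum_process_cadlag limit by blast
qed

end
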